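(* Let $n\ge4$ and let $\mathbf F_n$ be the Fermat surface, the compact Riemann surface of the projective curve $x^n+y^n+z^n=0$ (of genus $(n-1)(n-2)/2$). Then $\operatorname{Aut}\mathbf F_n$ acts transitively on the Weierstrass points of $\mathbf F_n$ if and only if $n=4$.
   Context: For $p$ in a compact Riemann surface $X$ of genus $g$, the gaps at $p$ are the $g$ integers $1=\gamma_1<\dots<\gamma_g<2g$ such that no meromorphic function on $X$ has a pole of order exactly $\gamma_j$ at $p$ and is holomorphic elsewhere; the weight is $w_p=\sum_{i=1}^g(\gamma_i-i)$ and $p$ is a Weierstrass point if $w_p\ne0$. *)

theory Defs
  imports "HOL-Complex_Analysis.Complex_Analysis"
begin

type_synonym c3 = "complex \<times> complex \<times> complex"

definition smul3 :: "complex \<Rightarrow> c3 \<Rightarrow> c3" where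
  "smul3 c v = (c * fst v, c * fst (snd v), c * snd (snd v))"

text \<open>Projective point of CP^2 represented by a nonzero vector: the line it spans.\<close>
definition ppt :: "c3 \<Rightarrow> c3 set" where
  "ppt v = {smul3 c v | c. True}"

definition on_fermat :: "nat \<Rightarrow> c3 \<Rightarrow> bool" where
  "on_fermat n v \<longleftrightarrow> v \<noteq> (0,0,0) \<and>
     fst v ^ n + fst (snd v) ^ n + snd (snd v) ^ n = 0"

definition fermat :: "nat \<Rightarrow> c3 set set" where
  "fermat n = {ppt v | v. on_fermat n v}"

definition holo3 :: "(complex \<Rightarrow> c3) \<Rightarrow> complex set \<Rightarrow> bool" where
  "holo3 \<phi> S \<longleftrightarrow> (\<lambda>t. fst (\<phi> t)) holomorphic_on S \<and>
     (\<lambda>t. fst (snd (\<phi> t))) holomorphic_on S \<and> (\<lambda>t. snd (snd (\<phi> t))) holomorphic_on S"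

definition deriv3 :: "(complex \<Rightarrow> c3) \<Rightarrow> complex \<Rightarrow> c3" where
  "deriv3 \<phi> t = (deriv (\<lambda>s. fst (\<phi> s)) t, deriv (\<lambda>s. fst (snd (\<phi> s))) t,
                  deriv (\<lambda>s. snd (snd (\<phi> s))) t)"

text \<open>A local holomorphic coordinate (uniformizing parameter) of the Fermat curve at the
  point q: a holomorphic lift t \<mapsto> \<phi> t into C^3 - {0}, landing on the curve, with
  ppt (\<phi> 0) = q, and immersive in CP^2 (\<phi> 0 and \<phi>'(0) linearly independent).\<close>
definition fchart :: "nat \<Rightarrow> c3 set \<Rightarrow> (complex \<Rightarrow> c3) \<Rightarrow> real \<Rightarrow> bool" where
  "fchart n q \<phi> r \<longleftrightarrow> r > 0 \<and> holo3 \<phi> (ball 0 r) \<and>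
     (\<forall>t\<in>ball 0 r. on_fermat n (\<phi> t)) \<and> ppt (\<phi> 0) = q \<and>
     \<not> (\<exists>c. deriv3 \<phi> 0 = smul3 c (\<phi> 0))"

definition holo_at :: "nat \<Rightarrow> (c3 set \<Rightarrow> complex) \<Rightarrow> c3 set \<Rightarrow> bool" where
  "holo_at n f q \<longleftrightarrow> (\<exists>\<phi> r. fchart n q \<phi> r \<and> (\<lambda>t. f (ppt (\<phi> t))) holomorphic_on ball 0 r)"

definition pole_order :: "nat \<Rightarrow> (c3 set \<Rightarrow> complex) \<Rightarrow> c3 set \<Rightarrow> nat \<Rightarrow> bool" where
  "pole_order n f p k \<longleftrightarrow> (\<exists>\<phi> r h. fchart n p \<phi> r \<and> h holomorphic_on ball 0 r \<and> h 0 \<noteq> 0 \<and>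
     (\<forall>t\<in>ball 0 r - {0}. f (ppt (\<phi> t)) = h t / t ^ k))"

definition gaps :: "nat \<Rightarrow> c3 set \<Rightarrow> nat set" where
  "gaps n p = {k. k \<ge> 1 \<and> \<not> (\<exists>f. (\<forall>q\<in>fermat n - {p}. holo_at n f q) \<and> pole_order n f p k)}"

text \<open>Weight: sum over the increasingly ordered gaps gamma_1<...<gamma_g of (gamma_i - i),
  i.e. (sum of gaps) - (1 + ... + g).\<close>
definition weight :: "nat \<Rightarrow> c3 set \<Rightarrow> int" where
  "weight n p = int (\<Sum>(gaps n p)) - int (\<Sum>i\<in>{1..card (gaps n p)}. i)"

definition weierstrass_pt :: "nat \<Rightarrow> c3 set \<Rightarrow> bool" where
  "weierstrass_pt n p \<longleftrightarrow> p \<in> fermat n \<and> weight n p \<noteq> 0"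

definition holo_map :: "nat \<Rightarrow> (c3 set \<Rightarrow> c3 set) \<Rightarrow> bool" where
  "holo_map n \<sigma> \<longleftrightarrow> \<sigma> ` fermat n \<subseteq> fermat n \<and>
     (\<forall>q\<in>fermat n. \<exists>\<phi> r \<psi> s. fchart n q \<phi> r \<and> 0 < s \<and> s \<le> r \<and> holo3 \<psi> (ball 0 s) \<and>
        (\<forall>t\<in>ball 0 s. \<psi> t \<noteq> (0,0,0) \<and> ppt (\<psi> t) = \<sigma> (ppt (\<phi> t))))"

definition fermat_aut :: "nat \<Rightarrow> (c3 set \<Rightarrow> c3 set) set" where
  "fermat_aut n = {\<sigma>. bij_betw \<sigma> (fermat n) (fermat n) \<and> holo_map n \<sigma> \<and>
                       holo_map n (inv_into (fermat n) \<sigma>)}"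

end

theory Submission
  imports Defs
begin

text \<open>Let \<open>s\<close> be a local branch of \<open>s^n = - (1 + u^n)\<close> at a point with \<open>y z \<noteq> 0\<close>. If some polynomial
  \<open>P(u, s)\<close> of degree at most \<open>n - 3\<close> vanishes there to order exactly \<open>k - 1\<close>, then \<open>k\<close> is a gap: for a
  function \<open>f\<close> with a pole of order \<open>k\<close> only at that point, the trace of \<open>f P du / s^(n - 1)\<close> to the line
  is rational with a single simple pole and decays quadratically at infinity, which is impossible.
  Conversely, linear algebra on principal parts produces enough functions to show that there are at
  most \<open>g = (n - 1)(n - 2) / 2\<close> gaps. So no Riemann-Roch theorem is needed.

  For \<open>n = 4\<close>, powers of \<open>u - u\<^sub>0\<close> and the tangent line give the gaps 1, 2, 3 at every point with
  \<open>x y z \<noteq> 0\<close>; hence all Weierstrass points are flexes, and these are permuted transitively by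
  monomial matrices. For \<open>n \<ge> 5\<close>, both a flex \<open>(0 : 1 : \<zeta>)\<close> and a fixed point \<open>(1 : 1 : c)\<close> of the
  involution \<open>x \<leftrightarrow> y\<close> are Weierstrass points, the latter because the invariant differentials have even
  order there and are too numerous. They are not equivalent, since \<open>n - 1\<close> is a gap only at the
  second.\<close>


text \<open>\<open>holo_at\<close> and \<open>pole_order\<close> only promise some chart, so their
  content must first be moved to the parameter t = x/y - u of a branch; the chart inverses below
  serve this. The same pairs i + j <= n - 3 govern both bounds. A numerator of degree n - 3 over
  s^(n-1) decays like |u|^(-2), just enough to beat the factor that removes the simple pole of the
  trace. Conversely, pairing principal parts with these differentials removes exactly the terms that
  would be singular at y = 0. Weight zero forces the gaps to be an initial interval. A flex violates
  this because n + 1 is a gap and n - 1 is not: its tangent meets the curve n times there, so x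
  divided by the tangent form has a pole of order n - 1. At (1 : 1 : c) the tangent has contact 2,
  and (x - y)^(n-4) times the tangent form makes n - 1 a gap. At that fixed point the even orders
  pay off: cancelling only even Taylor coefficients pushes the order of an invariant form up to the
  genus. This takes g + 2 <= 2e with e invariant exponents, which holds from n = 5 on; for n = 4 one
  has e = 2 and g = 3.\<close>

declare split_paired_All [simp del] split_paired_Ex [simp del]

section \<open>Lines in C^3 as points of the projective plane\<close>

lemma smul3_simps [simp]: "smul3 c (x, y, z) = (c * x, c * y, c * z)"
  by (simp add: smul3_def)

lemma smul3_smul3: "smul3 a (smul3 b v) = smul3 (a * b) v"
  by (cases v) (simp add: mult.assoc)

lemma smul3_one [simp]: "smul3 1 v = v"
  by (cases v) simp

lemma smul3_eq_0_iff: "smul3 c v = (0,0,0) \<longleftrightarrow> c = 0 \<or> v = (0,0,0)"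
  by (cases v) auto

lemma ppt_eq_iff:
  assumes "v \<noteq> (0,0,0)"
  shows "ppt v = ppt w \<longleftrightarrow> (\<exists>c. c \<noteq> 0 \<and> w = smul3 c v)"
proof
  assume eq: "ppt v = ppt w"
  have "w \<in> ppt w" "v \<in> ppt v"
    unfolding ppt_def by (auto intro!: exI[of _ 1])
  then have "w \<in> ppt v" "v \<in> ppt w" by (simp_all add: eq)
  then obtain c d where "w = smul3 c v" "v = smul3 d w"
    unfolding ppt_def by blast
  then show "\<exists>c. c \<noteq> 0 \<and> w = smul3 c v"
    using assms by (metis smul3_eq_0_iff)
next
  assume "\<exists>c. c \<noteq> 0 \<and> w = smul3 c v"
  then obtain c where c: "c \<noteq> 0" "w = smul3 c v" by blast
  have "smul3 d v = smul3 (d / c) w" "smul3 d w = smul3 (d * c) v" for d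
    using c by (simp_all add: smul3_smul3)
  then show "ppt v = ppt w"
    unfolding ppt_def by (intro Collect_cong) metis
qed

lemma ppt_smul3: "c \<noteq> 0 \<Longrightarrow> v \<noteq> (0,0,0) \<Longrightarrow> ppt (smul3 c v) = ppt v"
  using ppt_eq_iff by metis

lemma on_fermat_nonzero: "on_fermat n v \<Longrightarrow> v \<noteq> (0,0,0)"
  by (simp add: on_fermat_def)

lemma on_fermat_smul3:
  assumes "c \<noteq> 0"
  shows "on_fermat n (smul3 c v) \<longleftrightarrow> on_fermat n v"
proof (cases v)
  case (fields x y z)
  have "(c * x) ^ n + (c * y) ^ n + (c * z) ^ n = c ^ n * (x ^ n + y ^ n + z ^ n)"
    by (simp add: algebra_simps)
  then show ?thesis
    using assms fields by (simp add: on_fermat_def)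
qed

lemma ppt_in_fermat_iff:
  assumes "v \<noteq> (0,0,0)"
  shows "ppt v \<in> fermat n \<longleftrightarrow> on_fermat n v"
proof
  assume "ppt v \<in> fermat n"
  then obtain w where w: "ppt v = ppt w" "on_fermat n w"
    unfolding fermat_def by blast
  then obtain c where "c \<noteq> 0" "w = smul3 c v" using ppt_eq_iff[OF assms] by blast
  then show "on_fermat n v" using w on_fermat_smul3 by blast
qed (auto simp: fermat_def)

lemma fermatE:
  assumes "p \<in> fermat n"
  obtains v where "p = ppt v" "on_fermat n v"
  using assms unfolding fermat_def by auto

lemma on_fermat_affine: "on_fermat n (u, 1, s) \<longleftrightarrow> s ^ n = - (1 + u ^ n)"
  unfolding on_fermat_def using eq_neg_iff_add_eq_0[of "s ^ n" "1 + u ^ n"] by (simp add: add.commute)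

lemma ppt_affine_eq_iff: "ppt (u, 1, s) = ppt (u', 1, s') \<longleftrightarrow> u = u' \<and> s = s'"
  by (subst ppt_eq_iff) auto

subsection \<open>Linear symmetries\<close>

text \<open>Instead of matrices, this lists what is used of a linear symmetry of the cone. The last
  clause says that \<open>M\<close> commutes with differentiation along holomorphic curves, so it
  carries charts to charts. Points are lines, hence the induced action on points is the image of
  sets.\<close>

definition fermat_sym :: "nat \<Rightarrow> (c3 \<Rightarrow> c3) \<Rightarrow> bool" where
  "fermat_sym n M \<longleftrightarrow> inj M \<and> continuous_on UNIV M \<and> (\<forall>c v. M (smul3 c v) = smul3 c (M v)) \<and>
     (\<forall>v. on_fermat n (M v) \<longleftrightarrow> on_fermat n v) \<and>
     (\<forall>\<phi> S. open S \<longrightarrow> holo3 \<phi> S \<longrightarrow>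
        holo3 (\<lambda>t. M (\<phi> t)) S \<and> (\<forall>t\<in>S. deriv3 (\<lambda>t. M (\<phi> t)) t = M (deriv3 \<phi> t)))"

lemma fermat_sym_comp:
  assumes "fermat_sym n M" "fermat_sym n N"
  shows "fermat_sym n (\<lambda>v. M (N v))"
proof -
  have "inj (\<lambda>v. M (N v))"
    using assms unfolding fermat_sym_def inj_def by metis
  moreover have "continuous_on UNIV (\<lambda>v. M (N v))"
    using assms unfolding fermat_sym_def
    by (metis continuous_on_compose2 top_greatest)
  moreover have "M (N (smul3 c v)) = smul3 c (M (N v))" for c v
    using assms unfolding fermat_sym_def by metis
  moreover have "on_fermat n (M (N v)) \<longleftrightarrow> on_fermat n v" for v
    using assms unfolding fermat_sym_def by metis
  moreover have "holo3 (\<lambda>t. M (N (\<phi> t))) S \<and> (\<forall>t\<in>S. deriv3 (\<lambda>t. M (N (\<phi> t))) t = M (N (deriv3 \<phi> t)))"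
    if "open S" "holo3 \<phi> S" for \<phi> S
    using assms that unfolding fermat_sym_def by simp
  ultimately show ?thesis
    unfolding fermat_sym_def by blast
qed

lemma fermat_sym_id: "fermat_sym n (\<lambda>v. v)"
  unfolding fermat_sym_def by auto

definition swap12 :: "c3 \<Rightarrow> c3" where
  "swap12 v = (fst (snd v), fst v, snd (snd v))"

definition swap13 :: "c3 \<Rightarrow> c3" where
  "swap13 v = (snd (snd v), fst (snd v), fst v)"

definition scale3 :: "complex \<Rightarrow> c3 \<Rightarrow> c3" where
  "scale3 a v = (fst v, fst (snd v), a * snd (snd v))"

lemma fermat_sym_swap12: "fermat_sym n swap12"
  unfolding fermat_sym_def
proof (intro conjI allI impI ballI)
  show "inj swap12" by (auto simp: inj_def swap12_def)
  show "continuous_on UNIV swap12" unfolding swap12_def by (intro continuous_intros)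
qed (auto simp: swap12_def on_fermat_def holo3_def deriv3_def algebra_simps)

lemma fermat_sym_swap13: "fermat_sym n swap13"
  unfolding fermat_sym_def
proof (intro conjI allI impI ballI)
  show "inj swap13" by (auto simp: inj_def swap13_def)
  show "continuous_on UNIV swap13" unfolding swap13_def by (intro continuous_intros)
qed (auto simp: swap13_def on_fermat_def holo3_def deriv3_def algebra_simps)

lemma fermat_sym_scale3:
  assumes "a ^ n = 1" "n \<ge> 1"
  shows "fermat_sym n (scale3 a)"
  unfolding fermat_sym_def
proof (intro conjI allI impI ballI)
  have a: "a \<noteq> 0" using assms by (auto simp: power_0_left)
  show "inj (scale3 a)" using a by (auto simp: inj_def scale3_def)
  show "continuous_on UNIV (scale3 a)" unfolding scale3_def by (intro continuous_intros)
  show "on_fermat n (scale3 a v) = on_fermat n v" for v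
    using a assms by (cases v) (auto simp: on_fermat_def scale3_def power_mult_distrib)
  fix \<phi> S assume "open S" "holo3 \<phi> S"
  then show "holo3 (\<lambda>t. scale3 a (\<phi> t)) S"
    by (auto simp: holo3_def scale3_def intro!: holomorphic_intros)
  fix t assume "t \<in> S"
  have "(\<lambda>t. snd (snd (\<phi> t))) field_differentiable (at t)"
    using \<open>open S\<close> \<open>holo3 \<phi> S\<close> \<open>t \<in> S\<close> by (auto simp: holo3_def holomorphic_on_imp_differentiable_at)
  then show "deriv3 (\<lambda>t. scale3 a (\<phi> t)) t = scale3 a (deriv3 \<phi> t)"
    by (simp add: deriv3_def scale3_def)
qed (auto simp: scale3_def smul3_def)

lemma ppt_fermat_sym:
  assumes "fermat_sym n M"
  shows "ppt (M v) = M ` ppt v"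
proof -
  have "M (smul3 c v) = smul3 c (M v)" for c
    using assms unfolding fermat_sym_def by metis
  then show ?thesis
    unfolding ppt_def by (simp only: setcompr_eq_image image_image)
qed

text \<open>Immersivity survives because \<open>M\<close> commutes with \<open>deriv3\<close> and
  scalars and is injective, so a dependence between the images would pull back.\<close>

lemma fchart_sym:
  assumes "fermat_sym n M" "fchart n q \<phi> r"
  shows "fchart n (M ` q) (\<lambda>t. M (\<phi> t)) r"
proof -
  have r: "r > 0" and h: "holo3 \<phi> (ball 0 r)" and q: "ppt (\<phi> 0) = q"
    using assms(2) unfolding fchart_def by auto
  have d: "deriv3 (\<lambda>t. M (\<phi> t)) 0 = M (deriv3 \<phi> 0)"
    using assms(1) r h unfolding fermat_sym_def by (metis centre_in_ball open_ball)
  have "\<not> (\<exists>c. deriv3 (\<lambda>t. M (\<phi> t)) 0 = smul3 c (M (\<phi> 0)))"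
    unfolding d using assms unfolding fchart_def fermat_sym_def inj_def by metis
  moreover have "holo3 (\<lambda>t. M (\<phi> t)) (ball 0 r)"
    using assms(1) h unfolding fermat_sym_def by blast
  moreover have "\<forall>t\<in>ball 0 r. on_fermat n (M (\<phi> t))"
    using assms unfolding fermat_sym_def fchart_def by blast
  ultimately show ?thesis
    unfolding fchart_def using r q ppt_fermat_sym[OF assms(1)] by auto
qed

text \<open>At most one coordinate of a point of the curve vanishes, and a transposition moves it to
  the first place. This reduces local questions to the chart where x/y is a coordinate.\<close>

lemma fermat_sym_nonzero_coords:
  assumes "on_fermat n v" "n \<ge> 1"
  obtains M where "fermat_sym n M" "\<And>w. M (M w) = w"
    "fst (snd (M v)) \<noteq> 0" "snd (snd (M v)) \<noteq> 0"
proof (cases v)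
  case (fields x y z)
  have v: "x ^ n + y ^ n + z ^ n = 0" "x \<noteq> 0 \<or> y \<noteq> 0 \<or> z \<noteq> 0"
    using assms fields by (auto simp: on_fermat_def)
  consider "y \<noteq> 0" "z \<noteq> 0" | "y = 0" "x \<noteq> 0" "z \<noteq> 0" | "z = 0" "x \<noteq> 0" "y \<noteq> 0"
    using v assms(2) by (cases "x = 0"; cases "y = 0"; cases "z = 0"; simp add: power_0_left)
  then show ?thesis
  proof cases
    case 1
    then show ?thesis using that[OF fermat_sym_id] fields by simp
  next
    case 2
    then show ?thesis using that[OF fermat_sym_swap12] fields by (simp add: swap12_def)
  next
    case 3
    then show ?thesis using that[OF fermat_sym_swap13] fields by (simp add: swap13_def)
  qed
qed

subsection \<open>Local charts\<close>

lemma local_root_unique: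
  fixes s :: complex
  assumes "s \<noteq> 0" "n \<ge> 1"
  obtains e where "e > 0"
    "\<And>a b. a \<in> ball s e \<Longrightarrow> b \<in> ball s e \<Longrightarrow> a ^ n = b ^ n \<Longrightarrow> a = b"
proof -
  have "((\<lambda>z. z ^ n) has_field_derivative (of_nat n * s ^ (n - 1))) (at s)"
    by (auto intro!: derivative_eq_intros)
  then have "deriv (\<lambda>z. z ^ n) s \<noteq> 0"
    using assms by (simp add: DERIV_imp_deriv)
  moreover have "(\<lambda>z. z ^ n) holomorphic_on UNIV" by (intro holomorphic_intros)
  ultimately obtain e where "e > 0" "inj_on (\<lambda>z. z ^ n) (ball s e)"
    using has_complex_derivative_locally_injective[of "\<lambda>z. z ^ n" UNIV s] by auto
  then show ?thesis using that by (metis inj_onD)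
qed

text \<open>Dividing by \<open>g 0\<close> starts the argument of \<open>Ln\<close> at 1; while it
  stays within distance 1 it avoids the cut, and the factor \<open>s\<close> selects the desired
  root.\<close>

lemma holomorphic_local_root:
  fixes g :: "complex \<Rightarrow> complex"
  assumes g: "g holomorphic_on UNIV" and s: "s ^ n = g 0" "s \<noteq> 0" and n: "n \<ge> 1"
  shows "\<exists>r S. r > 0 \<and> S holomorphic_on ball 0 r \<and> S 0 = s \<and>
    (\<forall>t\<in>ball 0 r. S t ^ n = g t \<and> S t \<noteq> 0)"
proof -
  have g0: "g 0 \<noteq> 0" using s by (metis power_not_zero)
  have "continuous_on UNIV (\<lambda>t. g t / g 0)"
    using g g0 by (intro continuous_intros holomorphic_on_imp_continuous_on) auto
  then have "open ((\<lambda>t. g t / g 0) -` ball 1 1)"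
    using open_vimage by blast
  moreover have "0 \<in> (\<lambda>t. g t / g 0) -` ball 1 1" using g0 by simp
  ultimately obtain r where r: "r > 0" "ball 0 r \<subseteq> (\<lambda>t. g t / g 0) -` ball 1 1"
    by (meson openE)
  have nn: "g t / g 0 \<notin> \<real>\<^sub>\<le>\<^sub>0" if "t \<in> ball 0 r" for t
  proof
    assume "g t / g 0 \<in> \<real>\<^sub>\<le>\<^sub>0"
    then have "Re (g t / g 0) \<le> 0" by (simp add: complex_nonpos_Reals_iff)
    moreover have "norm (1 - g t / g 0) < 1" using r that by (auto simp: dist_norm)
    ultimately show False
      using abs_Re_le_cmod[of "1 - g t / g 0"] by simp
  qed
  let ?S = "\<lambda>t. s * exp (Ln (g t / g 0) / of_nat n)"
  have "?S holomorphic_on ball 0 r"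
    using nn g0 by (intro holomorphic_intros holomorphic_on_subset[OF g]) auto
  moreover have "?S t ^ n = g t" if "t \<in> ball 0 r" for t
  proof -
    have "g t / g 0 \<noteq> 0" using nn[OF that] by auto
    then have "exp (Ln (g t / g 0) / of_nat n) ^ n = g t / g 0"
      using n by (simp flip: exp_of_nat_mult)
    then show ?thesis using s g0 by (simp add: power_mult_distrib)
  qed
  moreover have "?S 0 = s" using g0 by simp
  moreover have "?S t \<noteq> 0" for t using s by simp
  ultimately show ?thesis using r(1) by (intro exI[of _ r] exI[of _ ?S]) blast
qed

text \<open>Here t = x/y - u and S = z/y. Requiring S nonzero keeps away from the ramification of
  the projection to x/y, so that t is a uniformizing parameter.\<close>

definition fermat_branch :: "nat \<Rightarrow> complex \<Rightarrow> (complex \<Rightarrow> complex) \<Rightarrow> real \<Rightarrow> bool" where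
  "fermat_branch n u S r \<longleftrightarrow> r > 0 \<and> S holomorphic_on ball 0 r \<and>
     (\<forall>t\<in>ball 0 r. S t ^ n = - (1 + (u + t) ^ n) \<and> S t \<noteq> 0)"

lemma fermat_branch_exists:
  assumes "s ^ n = - (1 + u ^ n)" "s \<noteq> 0" "n \<ge> 1"
  shows "\<exists>r S. fermat_branch n u S r \<and> S 0 = s"
proof -
  have "(\<lambda>t. - (1 + (u + t) ^ n)) holomorphic_on UNIV" by (intro holomorphic_intros)
  moreover have "s ^ n = - (1 + (u + 0) ^ n)" using assms(1) by simp
  ultimately show ?thesis
    using holomorphic_local_root[of "\<lambda>t. - (1 + (u + t) ^ n)" s n] assms(2,3)
    unfolding fermat_branch_def by blast
qed

lemma fermat_branch_subset:
  "fermat_branch n u S r \<Longrightarrow> 0 < r' \<Longrightarrow> r' \<le> r \<Longrightarrow> fermat_branch n u S r'"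
  unfolding fermat_branch_def by (meson holomorphic_on_subset subset_ball subsetD)

lemma fermat_branch_on_fermat:
  "fermat_branch n u S r \<Longrightarrow> t \<in> ball 0 r \<Longrightarrow> on_fermat n (u + t, 1, S t)"
  unfolding on_fermat_affine fermat_branch_def by blast

lemma fermat_branch_holo3:
  "fermat_branch n u S r \<Longrightarrow> holo3 (\<lambda>t. (u + t, 1, S t)) (ball 0 r)"
  unfolding holo3_def fermat_branch_def by (auto intro!: holomorphic_intros)

lemma fchart_affine:
  assumes "fermat_branch n u S r"
  shows "fchart n (ppt (u, 1, S 0)) (\<lambda>t. (u + t, 1, S t)) r"
proof -
  \<comment> \<open>The middle coordinate of the lift is constant 1, so a dependence would have
    factor c = 0, contradicting derivative 1 in the first coordinate.\<close>
  have "deriv (\<lambda>t. u + t) 0 = 1"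
    by (rule DERIV_imp_deriv) (auto intro!: derivative_eq_intros)
  then have "\<not> (\<exists>c. deriv3 (\<lambda>t. (u + t, 1, S t)) 0 = smul3 c (u + 0, 1, S 0))"
    by (simp add: deriv3_def)
  then show ?thesis
    unfolding fchart_def
    using fermat_branch_holo3[OF assms] fermat_branch_on_fermat[OF assms] assms
    by (simp add: fermat_branch_def)
qed

lemma fchart_exists:
  assumes "q \<in> fermat n" "n \<ge> 1"
  shows "\<exists>\<phi> r. fchart n q \<phi> r"
proof -
  obtain v where v: "q = ppt v" "on_fermat n v" using assms(1) by (rule fermatE)
  obtain M where M: "fermat_sym n M" "\<And>w. M (M w) = w"
    and nz: "fst (snd (M v)) \<noteq> 0" "snd (snd (M v)) \<noteq> 0"
    using fermat_sym_nonzero_coords[OF v(2) assms(2)] by blast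
  obtain x y z where w: "M v = (x, y, z)" by (cases "M v")
  have y: "y \<noteq> 0" and z: "z \<noteq> 0" using nz w by auto
  have of: "on_fermat n (M v)" using M(1) v(2) unfolding fermat_sym_def by blast
  have eq: "smul3 (1 / y) (M v) = (x / y, 1, z / y)" using y by (simp add: w)
  have "on_fermat n (x / y, 1, z / y)"
    using of on_fermat_smul3[of "1 / y" n "M v"] y by (simp add: eq)
  then have eqn: "(z / y) ^ n = - (1 + (x / y) ^ n)" by (simp only: on_fermat_affine)
  have zy: "z / y \<noteq> 0" using y z by simp
  obtain r S where S: "fermat_branch n (x / y) S r" "S 0 = z / y"
    using fermat_branch_exists[OF eqn zy assms(2)] by metis
  from fchart_sym[OF M(1) fchart_affine[OF S(1)]]
  have "fchart n (ppt (M (x / y, 1, z / y))) (\<lambda>t. M (x / y + t, 1, S t)) r"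
    by (simp add: ppt_fermat_sym[OF M(1)] S(2))
  moreover have "ppt (M (x / y, 1, z / y)) = q"
  proof -
    have "M (x / y, 1, z / y) = smul3 (1 / y) v"
      using M(1) unfolding eq[symmetric] fermat_sym_def by (simp only: M(2))
    then show ?thesis using ppt_smul3[of "1 / y" v] y v(1) on_fermat_nonzero[OF v(2)] by simp
  qed
  ultimately show ?thesis by metis
qed


lemma small_ball_in_open_vimage:
  fixes f :: "'a::metric_space \<Rightarrow> 'b::topological_space"
  assumes "continuous_on A f" "open A" "open U" "a \<in> A" "f a \<in> U"
  shows "\<exists>e>0. ball a e \<subseteq> A \<and> f ` ball a e \<subseteq> U"
proof -
  have "open (A \<inter> f -` U)" using continuous_open_preimage assms by blast
  moreover have "a \<in> A \<inter> f -` U" using assms by blast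
  ultimately obtain e where "e > 0" "ball a e \<subseteq> A \<inter> f -` U" by (meson openE)
  then show ?thesis by blast
qed

text \<open>Every chart at a point with y z nonzero has x/y as a local coordinate. If the derivative
  of X/Y vanished, X and Y would have the same logarithmic derivative factor c; differentiating the
  curve equation then gives Z' = c Z because Z is nonzero, against immersivity.\<close>

lemma fchart_ratio:
  assumes ch: "fchart n (ppt v) \<phi> r" and v: "fst (snd v) \<noteq> 0" "snd (snd v) \<noteq> 0" and n: "n \<ge> 1"
  obtains \<delta> where "0 < \<delta>" "\<delta> \<le> r" "\<And>t. t \<in> ball 0 \<delta> \<Longrightarrow> fst (snd (\<phi> t)) \<noteq> 0"
    "inj_on (\<lambda>t. fst (\<phi> t) / fst (snd (\<phi> t))) (ball 0 \<delta>)"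
proof -
  define X Y Z where "X = (\<lambda>t. fst (\<phi> t))" and "Y = (\<lambda>t. fst (snd (\<phi> t)))"
    and "Z = (\<lambda>t. snd (snd (\<phi> t)))"
  have r: "r > 0" and hol: "X holomorphic_on ball 0 r" "Y holomorphic_on ball 0 r" "Z holomorphic_on ball 0 r"
    and curve: "\<And>t. t \<in> ball 0 r \<Longrightarrow> on_fermat n (\<phi> t)" and p0: "ppt (\<phi> 0) = ppt v"
    and imm: "\<And>c. (deriv X 0, deriv Y 0, deriv Z 0) \<noteq> smul3 c (\<phi> 0)"
    using ch unfolding fchart_def holo3_def deriv3_def X_def Y_def Z_def by auto
  have \<phi>: "\<phi> t = (X t, Y t, Z t)" for t by (simp add: X_def Y_def Z_def)
  have curve': "X t ^ n + Y t ^ n + Z t ^ n = 0" if "t \<in> ball 0 r" for t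
    using curve[OF that] by (simp add: on_fermat_def \<phi>)
  obtain c where "v = smul3 c (\<phi> 0)"
    using p0 ppt_eq_iff on_fermat_nonzero curve[of 0] r by (metis centre_in_ball)
  with v have nz: "Y 0 \<noteq> 0" "Z 0 \<noteq> 0" by (auto simp: \<phi>)
  have "continuous_on (ball 0 r) Y" using hol holomorphic_on_imp_continuous_on by blast
  moreover have "open (- {0 :: complex})" by (intro open_Compl) auto
  ultimately have "\<exists>d>0. ball 0 d \<subseteq> ball (0::complex) r \<and> Y ` ball 0 d \<subseteq> - {0}"
    by (intro small_ball_in_open_vimage) (use r nz in auto)
  then obtain d where d: "d > 0" "ball 0 d \<subseteq> ball (0::complex) r" "Y ` ball 0 d \<subseteq> - {0}" by blast
  have hold: "X holomorphic_on ball 0 d" "Y holomorphic_on ball 0 d"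
    using hol d(2) holomorphic_on_subset by blast+
  have Ynz: "Y t \<noteq> 0" if "t \<in> ball 0 d" for t using d(3) that by blast
  have \<alpha>: "(\<lambda>t. X t / Y t) holomorphic_on ball 0 d"
    using hold Ynz by (intro holomorphic_intros) auto
  have dX: "(X has_field_derivative deriv X 0) (at 0)" and dY: "(Y has_field_derivative deriv Y 0) (at 0)"
    and dZ: "(Z has_field_derivative deriv Z 0) (at 0)"
    using hol r by (metis centre_in_ball holomorphic_derivI open_ball)+
  have "deriv (\<lambda>t. X t / Y t) 0 \<noteq> 0"
  proof
    have "((\<lambda>t. X t / Y t) has_field_derivative (deriv X 0 * Y 0 - X 0 * deriv Y 0) / (Y 0 * Y 0)) (at 0)"
      using dX dY nz by (intro DERIV_divide)
    moreover assume "deriv (\<lambda>t. X t / Y t) 0 = 0"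
    ultimately have eq: "deriv X 0 * Y 0 = X 0 * deriv Y 0"
      using nz by (auto dest!: DERIV_imp_deriv)
    \<comment> \<open>The candidate factor in \<open>deriv3 \<phi> 0 = smul3 c (\<phi> 0)\<close>;
      the first two coordinates already agree.\<close>
    define c where "c = deriv Y 0 / Y 0"
    have cX: "deriv X 0 = c * X 0" and cY: "deriv Y 0 = c * Y 0"
      using nz eq by (simp_all add: c_def field_simps)
    have "((\<lambda>t. X t ^ n + Y t ^ n + Z t ^ n) has_field_derivative
        of_nat n * X 0 ^ (n - 1) * deriv X 0 + of_nat n * Y 0 ^ (n - 1) * deriv Y 0
          + of_nat n * Z 0 ^ (n - 1) * deriv Z 0) (at 0)"
      by (rule derivative_eq_intros dX dY dZ refl | simp)+
    moreover have "((\<lambda>t. X t ^ n + Y t ^ n + Z t ^ n) has_field_derivative 0) (at 0)"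
    proof (rule has_field_derivative_transform_within_open[where S = "ball 0 r"])
      show "((\<lambda>t. 0) has_field_derivative 0) (at 0)" by simp
    qed (use r curve' in auto)
    ultimately have "of_nat n * (X 0 ^ (n - 1) * deriv X 0 + Y 0 ^ (n - 1) * deriv Y 0
        + Z 0 ^ (n - 1) * deriv Z 0) = 0"
      using DERIV_unique by (fastforce simp: algebra_simps)
    then have "X 0 ^ (n - 1) * deriv X 0 + Y 0 ^ (n - 1) * deriv Y 0 + Z 0 ^ (n - 1) * deriv Z 0 = 0"
      using n by simp
    moreover have pw: "w ^ (n - 1) * (c * w) = c * w ^ n" for w
      using n by (cases n) auto
    ultimately have "Z 0 ^ (n - 1) * deriv Z 0 = - c * (X 0 ^ n + Y 0 ^ n)"
      unfolding cX cY pw by (simp add: algebra_simps add_eq_0_iff)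
    also have "X 0 ^ n + Y 0 ^ n = - (Z 0 ^ n)"
      using curve'[of 0] r by (simp add: eq_neg_iff_add_eq_0)
    also have "- c * - (Z 0 ^ n) = Z 0 ^ (n - 1) * (c * Z 0)" by (simp only: pw minus_mult_minus)
    finally have "deriv Z 0 = c * Z 0" using nz by simp
    then show False using imm[of c] cX cY by (simp add: \<phi>)
  qed
  then obtain e where e: "e > 0" "ball 0 e \<subseteq> ball (0::complex) d" "inj_on (\<lambda>t. X t / Y t) (ball 0 e)"
    using has_complex_derivative_locally_injective[OF \<alpha> centre_in_ball[THEN iffD2, OF d(1)] open_ball]
    by blast
  have sub: "ball 0 (min e r) \<subseteq> ball (0::complex) e" by auto
  show ?thesis
  proof (rule that[of "min e r"])
    show "fst (snd (\<phi> t)) \<noteq> 0" if "t \<in> ball 0 (min e r)" for t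
      using Ynz[of t] that sub e(2) unfolding Y_def by blast
    show "inj_on (\<lambda>t. fst (\<phi> t) / fst (snd (\<phi> t))) (ball 0 (min e r))"
      using inj_on_subset[OF e(3) sub] unfolding X_def Y_def .
  qed (use e r in auto)
qed

text \<open>A local inverse of the chart, defined on vectors near the lift \<open>v\<close> instead
  of on lines. Its holomorphy is expressed by composition with holomorphic curves, which avoids
  functions of several variables.\<close>

definition chart_inverse :: "nat \<Rightarrow> (complex \<Rightarrow> c3) \<Rightarrow> c3 \<Rightarrow> real \<Rightarrow> (c3 \<Rightarrow> complex) \<Rightarrow> real \<Rightarrow> bool" where
  "chart_inverse n \<phi> v d T e \<longleftrightarrow> e > 0 \<and>
     (\<forall>w\<in>ball v e. on_fermat n w \<longrightarrow> T w \<in> ball 0 d \<and> ppt (\<phi> (T w)) = ppt w) \<and>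
     (\<forall>\<psi> D. open D \<longrightarrow> holo3 \<psi> D \<longrightarrow> \<psi> ` D \<subseteq> ball v e \<longrightarrow> (\<lambda>\<tau>. T (\<psi> \<tau>)) holomorphic_on D)"

text \<open>The inverse is \<beta>(x/y), where \<beta> inverts x/y along the chart. Since x/y leaves
  n choices for z/y, both points are kept where n-th powers near z/y are injective.\<close>

lemma fchart_inverse_aux:
  assumes ch: "fchart n (ppt v) \<phi> r" and on: "on_fermat n v"
    and v: "fst (snd v) \<noteq> 0" "snd (snd v) \<noteq> 0" and n: "n \<ge> 1" and d: "d > 0"
  shows "\<exists>T e. chart_inverse n \<phi> v d T e"
proof -
  obtain \<delta>0 where \<delta>0: "0 < \<delta>0" "\<delta>0 \<le> r" "\<And>t. t \<in> ball 0 \<delta>0 \<Longrightarrow> fst (snd (\<phi> t)) \<noteq> 0"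
    "inj_on (\<lambda>t. fst (\<phi> t) / fst (snd (\<phi> t))) (ball 0 \<delta>0)"
    using fchart_ratio[OF ch v n] by blast
  obtain x0 y0 z0 where v0: "v = (x0, y0, z0)" by (cases v)
  have nz: "y0 \<noteq> 0" "z0 \<noteq> 0" using v v0 by auto
  define a where "a = (\<lambda>w :: c3. fst w / fst (snd w))"
  define b where "b = (\<lambda>w :: c3. snd (snd w) / fst (snd w))"
  have hol: "(\<lambda>t. fst (\<phi> t)) holomorphic_on ball 0 r" "(\<lambda>t. fst (snd (\<phi> t))) holomorphic_on ball 0 r"
    "(\<lambda>t. snd (snd (\<phi> t))) holomorphic_on ball 0 r"
    using ch unfolding fchart_def holo3_def by auto
  have sub: "ball 0 \<delta>0 \<subseteq> ball (0::complex) r" using \<delta>0 by auto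
  have ha: "(\<lambda>t. a (\<phi> t)) holomorphic_on ball 0 \<delta>0" and hb: "(\<lambda>t. b (\<phi> t)) holomorphic_on ball 0 \<delta>0"
    unfolding a_def b_def using \<delta>0(3) by (auto intro!: holomorphic_intros holomorphic_on_subset[OF hol(1) sub]
      holomorphic_on_subset[OF hol(2) sub] holomorphic_on_subset[OF hol(3) sub])
  have "ppt (\<phi> 0) = ppt v" using ch unfolding fchart_def by blast
  then obtain c where c: "c \<noteq> 0" "\<phi> 0 = smul3 c v"
    using ppt_eq_iff[OF on_fermat_nonzero[OF on]] by metis
  have ab0: "a (\<phi> 0) = a v" "b (\<phi> 0) = b v" using c by (auto simp: a_def b_def v0)
  have bv: "b v \<noteq> 0" using nz by (simp add: b_def v0)
  \<comment> \<open>This radius isolates one sheet over the x/y line; all further shrinking keeps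
    z/y inside it.\<close>
  obtain \<eta> where \<eta>: "\<eta> > 0" "\<And>p q. p \<in> ball (b v) \<eta> \<Longrightarrow> q \<in> ball (b v) \<eta> \<Longrightarrow> p ^ n = q ^ n \<Longrightarrow> p = q"
    using local_root_unique[OF bv n] by blast
  have "\<exists>d>0. ball 0 d \<subseteq> ball (0::complex) \<delta>0 \<and> (\<lambda>t. b (\<phi> t)) ` ball 0 d \<subseteq> ball (b v) \<eta>"
    by (intro small_ball_in_open_vimage holomorphic_on_imp_continuous_on hb) (use \<delta>0(1) \<eta>(1) ab0 in auto)
  then obtain \<delta>1 where \<delta>1: "\<delta>1 > 0" "ball 0 \<delta>1 \<subseteq> ball (0::complex) \<delta>0" "(\<lambda>t. b (\<phi> t)) ` ball 0 \<delta>1 \<subseteq> ball (b v) \<eta>"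
    by blast
  define \<delta> where "\<delta> = min \<delta>1 d"
  have \<delta>: "\<delta> > 0" "ball 0 \<delta> \<subseteq> ball (0::complex) \<delta>1" "ball 0 \<delta> \<subseteq> ball (0::complex) d"
    using \<delta>1 d by (auto simp: \<delta>_def)
  have ha': "(\<lambda>t. a (\<phi> t)) holomorphic_on ball 0 \<delta>"
    using ha \<delta> \<delta>1 holomorphic_on_subset by blast
  have inj: "inj_on (\<lambda>t. a (\<phi> t)) (ball 0 \<delta>)"
    using \<delta>0(4) \<delta> \<delta>1 inj_on_subset unfolding a_def by blast
  have "\<exists>\<beta>. \<beta> holomorphic_on ((\<lambda>t. a (\<phi> t)) ` ball 0 \<delta>) \<and> (\<forall>t\<in>ball 0 \<delta>. \<beta> (a (\<phi> t)) = t)"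
  proof (rule holomorphic_has_inverse[OF ha' open_ball inj])
    fix g assume "g holomorphic_on (\<lambda>t. a (\<phi> t)) ` ball 0 \<delta>"
      and "\<And>z. z \<in> ball 0 \<delta> \<Longrightarrow> g (a (\<phi> z)) = z"
    then show ?thesis by blast
  qed
  then obtain \<beta> where \<beta>: "\<beta> holomorphic_on ((\<lambda>t. a (\<phi> t)) ` ball 0 \<delta>)"
    "\<And>t. t \<in> ball 0 \<delta> \<Longrightarrow> \<beta> (a (\<phi> t)) = t" by blast
  define U where "U = (\<lambda>t. a (\<phi> t)) ` ball 0 \<delta>"
  have "open U" unfolding U_def using open_mapping_thm3[OF ha' open_ball inj] .
  have aU: "a v \<in> U" unfolding U_def using \<delta>(1) ab0 by (metis centre_in_ball image_eqI)
  define A where "A = {w :: c3. fst (snd w) \<noteq> 0}"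
  have "open A"
    unfolding A_def by (intro open_Collect_neq continuous_intros)
  have cont: "continuous_on A (\<lambda>w. (a w, b w))"
    unfolding a_def b_def A_def by (intro continuous_intros) auto
  have opn: "open (U \<times> ball (b v) \<eta>)" using \<open>open U\<close> open_Times by blast
  have "v \<in> A" "(a v, b v) \<in> U \<times> ball (b v) \<eta>" using nz aU \<eta>(1) by (auto simp: A_def v0)
  then have "\<exists>e>0. ball v e \<subseteq> A \<and> (\<lambda>w. (a w, b w)) ` ball v e \<subseteq> U \<times> ball (b v) \<eta>"
    by (rule small_ball_in_open_vimage[OF cont \<open>open A\<close> opn])
  then obtain e where e: "e > 0" "ball v e \<subseteq> A"
    "(\<lambda>w. (a w, b w)) ` ball v e \<subseteq> U \<times> ball (b v) \<eta>" by blast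
  have eball: "w \<in> A" "a w \<in> U" "b w \<in> ball (b v) \<eta>" if "w \<in> ball v e" for w
    using e(2,3) that by blast+
  define T where "T = (\<lambda>w. \<beta> (a w))"
  have "T w \<in> ball 0 d \<and> ppt (\<phi> (T w)) = ppt w" if w: "w \<in> ball v e" "on_fermat n w" for w
  proof -
    note ew = eball[OF w(1)]
    obtain t where t: "a w = a (\<phi> t)" "t \<in> ball 0 \<delta>"
      using ew(2) unfolding U_def by (elim imageE)
    have Tt: "T w = t" using \<beta>(2)[OF t(2)] t(1) by (simp add: T_def)
    have tr: "t \<in> ball 0 r" "t \<in> ball 0 \<delta>0" "t \<in> ball 0 \<delta>1"
      using t(2) \<delta>(2) \<delta>1(2) sub by blast+
    have of: "on_fermat n (\<phi> t)" using ch tr(1) unfolding fchart_def by blast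
    obtain X Y Z where \<phi>: "\<phi> t = (X, Y, Z)" by (cases "\<phi> t")
    obtain x y z where w': "w = (x, y, z)" by (cases w)
    have Y: "Y \<noteq> 0" "y \<noteq> 0" using \<delta>0(3)[OF tr(2)] ew(1) by (auto simp: \<phi> w' A_def)
    have eqa: "X / Y = x / y" using t(1) by (simp add: a_def \<phi> w')
    have "(Z / Y) ^ n = - (1 + (X / Y) ^ n)"
      using of on_fermat_smul3[of "1 / Y" n "\<phi> t"] Y on_fermat_affine[of n "X / Y" "Z / Y"] by (simp add: \<phi>)
    moreover have "(z / y) ^ n = - (1 + (x / y) ^ n)"
      using w on_fermat_smul3[of "1 / y" n w] Y on_fermat_affine[of n "x / y" "z / y"] by (simp add: w')
    ultimately have "(Z / Y) ^ n = (z / y) ^ n" by (simp only: eqa)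
    moreover have "b (\<phi> t) \<in> ball (b v) \<eta>" using \<delta>1(3) tr(3) by blast
    then have "Z / Y \<in> ball (b v) \<eta>" by (simp add: b_def \<phi>)
    moreover have "z / y \<in> ball (b v) \<eta>" using ew(3) by (simp add: b_def w')
    ultimately have eqb: "Z / Y = z / y" using \<eta>(2) by metis
    have "w = smul3 (y / Y) (\<phi> t)" using eqa eqb Y by (simp add: \<phi> w' field_simps)
    then have "ppt (\<phi> t) = ppt w"
      using ppt_smul3[of "y / Y", OF _ on_fermat_nonzero[OF of]] Y by simp
    moreover have "t \<in> ball 0 d" using t(2) \<delta>(3) by blast
    ultimately show ?thesis by (simp only: Tt)
  qed
  moreover have "(\<lambda>\<tau>. T (\<psi> \<tau>)) holomorphic_on D" if D: "open D" "holo3 \<psi> D" "\<psi> ` D \<subseteq> ball v e" for \<psi> D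
  proof -
    have nz: "fst (snd (\<psi> \<tau>)) \<noteq> 0" if "\<tau> \<in> D" for \<tau> using D(3) eball(1)[of "\<psi> \<tau>"] that unfolding A_def by blast
    have "(\<lambda>\<tau>. a (\<psi> \<tau>)) holomorphic_on D"
      using D(2) nz unfolding holo3_def a_def by (intro holomorphic_intros) auto
    moreover have "(\<lambda>\<tau>. a (\<psi> \<tau>)) ` D \<subseteq> U" using D(3) eball(2) by blast
    ultimately have "(\<beta> \<circ> (\<lambda>\<tau>. a (\<psi> \<tau>))) holomorphic_on D"
      using holomorphic_on_compose_gen \<beta>(1) U_def by blast
    then show ?thesis by (simp add: T_def o_def)
  qed
  ultimately have "chart_inverse n \<phi> v d T e" unfolding chart_inverse_def using e(1) by blast
  then show ?thesis by blast
qed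

lemma fchart_inverse:
  assumes ch: "fchart n (ppt v) \<phi> r" and on: "on_fermat n v" and n: "n \<ge> 1" and d: "d > 0"
  shows "\<exists>T e. chart_inverse n \<phi> v d T e"
proof -
  obtain M where M: "fermat_sym n M" and nz: "fst (snd (M v)) \<noteq> 0" "snd (snd (M v)) \<noteq> 0"
    using fermat_sym_nonzero_coords[OF on n] by blast
  have inj: "inj M" and cont: "continuous_on UNIV M" and onM: "\<And>w. on_fermat n (M w) = on_fermat n w"
    and holM: "\<And>\<phi> S. open S \<Longrightarrow> holo3 \<phi> S \<Longrightarrow> holo3 (\<lambda>t. M (\<phi> t)) S"
    using M unfolding fermat_sym_def by blast+
  have "fchart n (ppt (M v)) (\<lambda>t. M (\<phi> t)) r"
    using fchart_sym[OF M ch] ppt_fermat_sym[OF M] by simp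
  moreover have "on_fermat n (M v)" using onM on by blast
  ultimately obtain T' e' where "chart_inverse n (\<lambda>t. M (\<phi> t)) (M v) d T' e'"
    using fchart_inverse_aux[OF _ _ nz n d] by blast
  then have e': "e' > 0"
    "\<And>w. w \<in> ball (M v) e' \<Longrightarrow> on_fermat n w \<Longrightarrow> T' w \<in> ball 0 d \<and> ppt (M (\<phi> (T' w))) = ppt w"
    "\<And>\<psi> D. open D \<Longrightarrow> holo3 \<psi> D \<Longrightarrow> \<psi> ` D \<subseteq> ball (M v) e' \<Longrightarrow> (\<lambda>\<tau>. T' (\<psi> \<tau>)) holomorphic_on D"
    unfolding chart_inverse_def by blast+
  obtain e where e: "e > 0" "M ` ball v e \<subseteq> ball (M v) e'"
    using small_ball_in_open_vimage[OF cont open_UNIV open_ball, of v "M v" e'] e'(1) by auto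
  have "T' (M w) \<in> ball 0 d \<and> ppt (\<phi> (T' (M w))) = ppt w" if "w \<in> ball v e" "on_fermat n w" for w
  proof -
    have *: "T' (M w) \<in> ball 0 d \<and> ppt (M (\<phi> (T' (M w)))) = ppt (M w)"
      using e'(2)[of "M w"] e(2) that onM by blast
    then have "M ` ppt (\<phi> (T' (M w))) = M ` ppt w" by (simp add: ppt_fermat_sym[OF M])
    then show ?thesis using * inj by (simp add: inj_image_eq_iff)
  qed
  moreover have "(\<lambda>\<tau>. T' (M (\<psi> \<tau>))) holomorphic_on D"
    if "open D" "holo3 \<psi> D" "\<psi> ` D \<subseteq> ball v e" for \<psi> D
    using that e(2) by (intro e'(3) holM) auto
  ultimately have "chart_inverse n \<phi> v d (\<lambda>w. T' (M w)) e"
    unfolding chart_inverse_def using e(1) by blast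
  then show ?thesis by blast
qed

lemma fchart_locally_injective:
  assumes ch: "fchart n q \<phi> r" and n: "n \<ge> 1"
  obtains d where "0 < d" "d \<le> r" "inj_on (\<lambda>t. ppt (\<phi> t)) (ball 0 d)"
proof -
  have r: "r > 0" and on: "\<And>t. t \<in> ball 0 r \<Longrightarrow> on_fermat n (\<phi> t)" and q: "ppt (\<phi> 0) = q"
    using ch unfolding fchart_def by auto
  obtain M where M: "fermat_sym n M" and nz: "fst (snd (M (\<phi> 0))) \<noteq> 0" "snd (snd (M (\<phi> 0))) \<noteq> 0"
    using fermat_sym_nonzero_coords[OF on n, of 0] r by (metis centre_in_ball)
  have "fchart n (ppt (M (\<phi> 0))) (\<lambda>t. M (\<phi> t)) r"
    using fchart_sym[OF M ch] ppt_fermat_sym[OF M] q by simp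
  then obtain d where d: "0 < d" "d \<le> r"
    "inj_on (\<lambda>t. fst (M (\<phi> t)) / fst (snd (M (\<phi> t)))) (ball 0 d)"
    using fchart_ratio[OF _ nz n] by blast
  have "inj_on (\<lambda>t. ppt (\<phi> t)) (ball 0 d)"
  proof (rule inj_onI)
    fix s t assume st: "s \<in> ball 0 d" "t \<in> ball 0 d" "ppt (\<phi> s) = ppt (\<phi> t)"
    then obtain c where c: "c \<noteq> 0" "\<phi> t = smul3 c (\<phi> s)"
      using ppt_eq_iff[OF on_fermat_nonzero[OF on]] d(2) by (meson subset_ball subsetD)
    then have "M (\<phi> t) = smul3 c (M (\<phi> s))" using M unfolding fermat_sym_def by metis
    then have "fst (M (\<phi> t)) / fst (snd (M (\<phi> t))) = fst (M (\<phi> s)) / fst (snd (M (\<phi> s)))"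
      using c(1) by (simp add: smul3_def)
    then show "s = t" using inj_onD[OF d(3) _ st(1,2)] by simp
  qed
  then show ?thesis using that[OF d(1,2)] by simp
qed


subsection \<open>Functions along holomorphic curves\<close>

lemma holo3_imp_continuous_on: "holo3 \<psi> D \<Longrightarrow> continuous_on D \<psi>"
  using continuous_on_Pair[of D "\<lambda>t. fst (\<psi> t)" "\<lambda>t. (fst (snd (\<psi> t)), snd (snd (\<psi> t)))"]
    continuous_on_Pair[of D "\<lambda>t. fst (snd (\<psi> t))" "\<lambda>t. snd (snd (\<psi> t))"]
  unfolding holo3_def by (simp add: holomorphic_on_imp_continuous_on)

lemma holo3_subset: "holo3 \<psi> D \<Longrightarrow> D' \<subseteq> D \<Longrightarrow> holo3 \<psi> D'"
  unfolding holo3_def using holomorphic_on_subset by blast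

lemma holo3_small_ball:
  assumes "holo3 \<psi> D" "open D" "\<tau> \<in> D" "e > 0"
  shows "\<exists>\<rho>>0. ball \<tau> \<rho> \<subseteq> D \<and> \<psi> ` ball \<tau> \<rho> \<subseteq> ball (\<psi> \<tau>) e"
  by (rule small_ball_in_open_vimage[OF holo3_imp_continuous_on[OF assms(1)] assms(2) open_ball])
     (use assms in auto)

text \<open>Along \<psi> the function is its expression in the given chart composed with the
  holomorphic parameter \<open>T (\<psi> t)\<close>. Thus one good chart suffices for every curve
  through the point.\<close>

lemma holo_at_along_curve:
  assumes f: "holo_at n f (ppt (\<psi> \<tau>))" and \<psi>: "holo3 \<psi> D" "open D" "\<tau> \<in> D"
    and on: "\<And>t. t \<in> D \<Longrightarrow> on_fermat n (\<psi> t)" and n: "n \<ge> 1"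
  shows "\<exists>\<rho>>0. ball \<tau> \<rho> \<subseteq> D \<and> (\<lambda>t. f (ppt (\<psi> t))) holomorphic_on ball \<tau> \<rho>"
proof -
  obtain \<phi> r where ch: "fchart n (ppt (\<psi> \<tau>)) \<phi> r"
    and hol: "(\<lambda>t. f (ppt (\<phi> t))) holomorphic_on ball 0 r"
    using f unfolding holo_at_def by blast
  have r: "r > 0" using ch unfolding fchart_def by blast
  obtain T e where T: "chart_inverse n \<phi> (\<psi> \<tau>) r T e"
    using fchart_inverse[OF ch on[OF \<psi>(3)] n r] by blast
  then have e: "e > 0" unfolding chart_inverse_def by blast
  obtain \<rho> where \<rho>: "\<rho> > 0" "ball \<tau> \<rho> \<subseteq> D" "\<psi> ` ball \<tau> \<rho> \<subseteq> ball (\<psi> \<tau>) e"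
    using holo3_small_ball[OF \<psi> e] by blast
  have T1: "T (\<psi> t) \<in> ball 0 r" "ppt (\<phi> (T (\<psi> t))) = ppt (\<psi> t)" if "t \<in> ball \<tau> \<rho>" for t
  proof -
    have "\<psi> t \<in> ball (\<psi> \<tau>) e" "on_fermat n (\<psi> t)" using \<rho>(2,3) that on by blast+
    then show "T (\<psi> t) \<in> ball 0 r" "ppt (\<phi> (T (\<psi> t))) = ppt (\<psi> t)"
      using T unfolding chart_inverse_def by blast+
  qed
  have "(\<lambda>t. T (\<psi> t)) holomorphic_on ball \<tau> \<rho>"
    using T holo3_subset[OF \<psi>(1) \<rho>(2)] \<rho>(3) unfolding chart_inverse_def by blast
  then have "((\<lambda>t. f (ppt (\<phi> t))) \<circ> (\<lambda>t. T (\<psi> t))) holomorphic_on ball \<tau> \<rho>"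
    using hol T1(1) by (intro holomorphic_on_compose_gen) auto
  moreover have "((\<lambda>t. f (ppt (\<phi> t))) \<circ> (\<lambda>t. T (\<psi> t))) t = f (ppt (\<psi> t))" if "t \<in> ball \<tau> \<rho>" for t
    using T1(2)[OF that] by simp
  ultimately have "(\<lambda>t. f (ppt (\<psi> t))) holomorphic_on ball \<tau> \<rho>"
    by (rule holomorphic_transform)
  then show ?thesis using \<rho> by blast
qed

lemma holo_along_curve:
  assumes f: "\<And>t. t \<in> D \<Longrightarrow> holo_at n f (ppt (\<psi> t))" and \<psi>: "holo3 \<psi> D" "open D"
    and on: "\<And>t. t \<in> D \<Longrightarrow> on_fermat n (\<psi> t)" and n: "n \<ge> 1"
  shows "(\<lambda>t. f (ppt (\<psi> t))) holomorphic_on D"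
  unfolding holomorphic_on_open[OF \<psi>(2)]
proof
  fix t assume t: "t \<in> D"
  obtain \<rho> where "\<rho> > 0" "(\<lambda>t. f (ppt (\<psi> t))) holomorphic_on ball t \<rho>"
    using holo_at_along_curve[OF f[OF t] \<psi> t on n] by blast
  then show "\<exists>f'. ((\<lambda>t. f (ppt (\<psi> t))) has_field_derivative f') (at t)"
    using holomorphic_on_open[OF open_ball] centre_in_ball by blast
qed

lemma holomorphic_slope:
  fixes g :: "complex \<Rightarrow> complex"
  assumes "g holomorphic_on ball 0 r" "r > 0"
  shows "(\<lambda>t. if t = 0 then deriv g 0 else (g t - g 0) / t) holomorphic_on ball 0 r"
proof -
  have "(0::complex) \<in> interior (ball 0 r)" using assms(2) by simp
  from pole_lemma[OF assms(1) this] show ?thesis unfolding diff_zero .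
qed

text \<open>The change of parameter g fixes 0 and is injective, so g(t) = t times a zero-free
  function. The k-th power of that unit is absorbed into the numerator and the pole order stays
  k.\<close>

lemma pole_order_along_curve:
  assumes f: "pole_order n f (ppt (\<psi> 0)) k" and \<psi>: "holo3 \<psi> (ball 0 s)" "s > 0"
    and on: "\<And>t. t \<in> ball 0 s \<Longrightarrow> on_fermat n (\<psi> t)" and n: "n \<ge> 1"
    and inj: "inj_on (\<lambda>t. ppt (\<psi> t)) (ball 0 s)"
  shows "\<exists>s' h. 0 < s' \<and> s' \<le> s \<and> h holomorphic_on ball 0 s' \<and> h 0 \<noteq> 0 \<and>
    (\<forall>t\<in>ball 0 s' - {0}. f (ppt (\<psi> t)) = h t / t ^ k)"
proof -
  obtain \<phi> r h where ch: "fchart n (ppt (\<psi> 0)) \<phi> r" and h: "h holomorphic_on ball 0 r" "h 0 \<noteq> 0"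
    and fh: "\<And>t. t \<in> ball 0 r - {0} \<Longrightarrow> f (ppt (\<phi> t)) = h t / t ^ k"
    using f unfolding pole_order_def by blast
  obtain d where d: "0 < d" "d \<le> r" "inj_on (\<lambda>t. ppt (\<phi> t)) (ball 0 d)"
    using fchart_locally_injective[OF ch n] by blast
  have on0: "on_fermat n (\<psi> 0)" using on \<psi>(2) by simp
  obtain T e where T: "chart_inverse n \<phi> (\<psi> 0) d T e"
    using fchart_inverse[OF ch on0 n d(1)] by blast
  then have e: "e > 0" unfolding chart_inverse_def by blast
  have s0: "0 \<in> ball (0::complex) s" using \<psi>(2) by simp
  obtain \<rho> where \<rho>: "\<rho> > 0" "ball 0 \<rho> \<subseteq> ball (0::complex) s" "\<psi> ` ball 0 \<rho> \<subseteq> ball (\<psi> 0) e"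
    using holo3_small_ball[OF \<psi>(1) open_ball s0 e] by blast
  define s' where "s' = min \<rho> s"
  have s': "0 < s'" "s' \<le> s" "ball 0 s' \<subseteq> ball (0::complex) s" "ball 0 s' \<subseteq> ball (0::complex) \<rho>"
    using \<rho>(1) \<psi>(2) by (auto simp: s'_def)
  define g where "g = (\<lambda>t. T (\<psi> t))"
  have g1: "g t \<in> ball 0 d" "ppt (\<phi> (g t)) = ppt (\<psi> t)" if "t \<in> ball 0 s'" for t
  proof -
    have "\<psi> t \<in> ball (\<psi> 0) e" using \<rho>(3) s'(4) that by blast
    moreover have "on_fermat n (\<psi> t)" using that s'(3) on by blast
    ultimately show "g t \<in> ball 0 d" "ppt (\<phi> (g t)) = ppt (\<psi> t)"
      using T unfolding chart_inverse_def g_def by blast+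
  qed
  have sub: "\<psi> ` ball 0 s' \<subseteq> ball (\<psi> 0) e" using \<rho>(3) s'(4) by blast
  have hg: "g holomorphic_on ball 0 s'"
    using T holo3_subset[OF \<psi>(1) s'(3)] sub unfolding chart_inverse_def g_def by blast
  have gi: "inj_on g (ball 0 s')"
  proof (rule inj_onI)
    fix x y assume xy: "x \<in> ball 0 s'" "y \<in> ball 0 s'" "g x = g y"
    then have "ppt (\<psi> x) = ppt (\<psi> y)" using g1(2) by metis
    then show "x = y" using inj_onD[OF inj] xy s'(3) by blast
  qed
  have z0: "(0::complex) \<in> ball 0 s'" using s'(1) by simp
  have "ppt (\<phi> (g 0)) = ppt (\<phi> 0)" using g1(2)[OF z0] ch unfolding fchart_def by simp
  then have g0: "g 0 = 0" using inj_onD[OF d(3) _ g1(1)[OF z0]] d(1) by simp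
  have gnz: "g t \<noteq> 0" if "t \<in> ball 0 s'" "t \<noteq> 0" for t
    using inj_onD[OF gi _ that(1) z0] that(2) g0 by auto
  have dg: "deriv g 0 \<noteq> 0" using holomorphic_injective_imp_regular[OF hg open_ball gi z0] .
  \<comment> \<open>The unit in \<open>g t = t * g' t\<close>, a difference quotient; it agrees with
    the derivative of g only at 0.\<close>
  define g' where "g' = (\<lambda>t. if t = 0 then deriv g 0 else (g t - g 0) / t)"
  have hg': "g' holomorphic_on ball 0 s'" unfolding g'_def by (rule holomorphic_slope[OF hg s'(1)])
  have g'nz: "g' t \<noteq> 0" if "t \<in> ball 0 s'" for t using dg gnz[OF that] by (auto simp: g'_def g0)
  have gg': "g t = t * g' t" for t by (simp add: g'_def g0)
  have "(\<lambda>t. h (g t)) holomorphic_on ball 0 s'"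
  proof -
    have "g ` ball 0 s' \<subseteq> ball 0 r" using g1(1) d(2) by force
    then have "(h \<circ> g) holomorphic_on ball 0 s'" using holomorphic_on_compose_gen[OF hg h(1)] by blast
    then show ?thesis by (simp add: o_def)
  qed
  then have "(\<lambda>t. h (g t) / g' t ^ k) holomorphic_on ball 0 s'"
    using hg' g'nz by (intro holomorphic_intros) auto
  moreover have "h (g 0) / g' 0 ^ k \<noteq> 0" using h(2) g0 g'nz[OF z0] by simp
  moreover have "f (ppt (\<psi> t)) = (h (g t) / g' t ^ k) / t ^ k" if "t \<in> ball 0 s' - {0}" for t
  proof -
    have "g t \<in> ball 0 r - {0}" using g1(1)[of t] gnz[of t] that d(2) by auto
    then have "f (ppt (\<phi> (g t))) = h (g t) / g t ^ k" by (rule fh)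
    then show ?thesis using g1(2)[of t] that gg'[of t] by (simp add: power_mult_distrib mult.commute)
  qed
  ultimately show ?thesis using s' by (intro exI[of _ s'] exI[of _ "\<lambda>t. h (g t) / g' t ^ k"]) auto
qed

lemma holo_at_bounded_near:
  assumes f: "holo_at n f (ppt v)" and on: "on_fermat n v" and n: "n \<ge> 1"
  shows "\<exists>e B. e > 0 \<and> (\<forall>w\<in>ball v e. on_fermat n w \<longrightarrow> norm (f (ppt w)) \<le> B)"
proof -
  obtain \<phi> r where ch: "fchart n (ppt v) \<phi> r"
    and hol: "(\<lambda>t. f (ppt (\<phi> t))) holomorphic_on ball 0 r"
    using f unfolding holo_at_def by blast
  have r: "r > 0" using ch unfolding fchart_def by blast
  have sub: "cball 0 (r / 2) \<subseteq> ball (0::complex) r" using r by auto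
  have "continuous_on (cball 0 (r / 2)) (\<lambda>t. f (ppt (\<phi> t)))"
    using holomorphic_on_imp_continuous_on[OF hol] sub continuous_on_subset by blast
  then have "bounded ((\<lambda>t. f (ppt (\<phi> t))) ` cball 0 (r / 2))"
    using compact_imp_bounded compact_continuous_image compact_cball by blast
  then obtain B where "\<forall>x\<in>(\<lambda>t. f (ppt (\<phi> t))) ` cball 0 (r / 2). norm x \<le> B"
    unfolding bounded_iff by blast
  then have B: "norm (f (ppt (\<phi> t))) \<le> B" if "t \<in> cball 0 (r / 2)" for t
    using that by blast
  have r2: "r / 2 > 0" using r by simp
  obtain T e where T: "chart_inverse n \<phi> v (r / 2) T e"
    using fchart_inverse[OF ch on n r2] by blast
  have "norm (f (ppt w)) \<le> B" if "w \<in> ball v e" "on_fermat n w" for w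
  proof -
    have T: "T w \<in> ball 0 (r / 2)" "ppt (\<phi> (T w)) = ppt w"
      using T that unfolding chart_inverse_def by blast+
    show ?thesis using B[of "T w"] T by simp
  qed
  moreover have "e > 0" using T unfolding chart_inverse_def by blast
  ultimately show ?thesis by blast
qed

text \<open>The covering argument runs over vectors in C^3, so that the set of lines needs no
  topology.\<close>

lemma holo_at_bounded_on_compact:
  assumes K: "compact K" and f: "\<And>v. v \<in> K \<Longrightarrow> on_fermat n v \<and> holo_at n f (ppt v)" and n: "n \<ge> 1"
  shows "\<exists>B. \<forall>v\<in>K. norm (f (ppt v)) \<le> B"
proof -
  have "\<forall>v\<in>K. \<exists>e B. e > 0 \<and> (\<forall>w\<in>ball v e. on_fermat n w \<longrightarrow> norm (f (ppt w)) \<le> B)"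
    using holo_at_bounded_near f n by blast
  then obtain e B where eB: "\<And>v. v \<in> K \<Longrightarrow> e v > 0"
    "\<And>v w. v \<in> K \<Longrightarrow> w \<in> ball v (e v) \<Longrightarrow> on_fermat n w \<Longrightarrow> norm (f (ppt w)) \<le> B v"
    by metis
  have "K \<subseteq> (\<Union>v\<in>K. ball v (e v))" using eB(1) by fastforce
  then obtain C where C: "C \<subseteq> K" "finite C" "K \<subseteq> (\<Union>v\<in>C. ball v (e v))"
    using compactE_image[OF K, of K "\<lambda>v. ball v (e v)"] by (metis open_ball)
  have "norm (f (ppt w)) \<le> (\<Sum>v\<in>C. \<bar>B v\<bar>)" if w: "w \<in> K" for w
  proof -
    obtain v where v: "v \<in> C" "w \<in> ball v (e v)" using C(3) w by blast
    have "norm (f (ppt w)) \<le> B v" using eB(2)[of v w] v C(1) f[OF w] by blast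
    also have "\<dots> \<le> \<bar>B v\<bar>" by simp
    also have "\<dots> \<le> (\<Sum>v\<in>C. \<bar>B v\<bar>)" using v(1) C(2) by (intro member_le_sum) auto
    finally show ?thesis .
  qed
  then show ?thesis by blast
qed

section \<open>Invariance of gaps under automorphisms\<close>

text \<open>Compose the function that witnesses the nongap with \<sigma>. Injectivity of \<sigma>
  makes the lifted image curve injective, which is what preserves the pole order.\<close>

lemma nongap_pullback:
  assumes bij: "bij_betw \<sigma> (fermat n) (fermat n)" and \<sigma>: "holo_map n \<sigma>" and n: "n \<ge> 1"
    and p: "p \<in> fermat n" and k: "k \<ge> 1" "k \<notin> gaps n (\<sigma> p)"
  shows "k \<notin> gaps n p"
proof -
  obtain f where f: "\<And>q. q \<in> fermat n - {\<sigma> p} \<Longrightarrow> holo_at n f q" and fp: "pole_order n f (\<sigma> p) k"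
    using k unfolding gaps_def by blast
  \<comment> \<open>The chart and the lift from \<open>holo_map\<close> live on different balls; on
    a common smaller one the chart is injective, and so is the lift of its image.\<close>
  have lift: "\<exists>\<phi> \<psi> s. fchart n q \<phi> s \<and> s > 0 \<and> holo3 \<psi> (ball 0 s) \<and>
     (\<forall>t\<in>ball 0 s. on_fermat n (\<psi> t) \<and> ppt (\<psi> t) = \<sigma> (ppt (\<phi> t))) \<and> ppt (\<psi> 0) = \<sigma> q \<and>
     inj_on (\<lambda>t. ppt (\<psi> t)) (ball 0 s)"
    if q: "q \<in> fermat n" for q
  proof -
    obtain \<phi> r \<psi> s where ch: "fchart n q \<phi> r" and s: "0 < s" "s \<le> r" and h: "holo3 \<psi> (ball 0 s)"
      and \<psi>: "\<And>t. t \<in> ball 0 s \<Longrightarrow> \<psi> t \<noteq> (0,0,0) \<and> ppt (\<psi> t) = \<sigma> (ppt (\<phi> t))"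
      using \<sigma> q unfolding holo_map_def by meson
    obtain d where d: "0 < d" "d \<le> r" "inj_on (\<lambda>t. ppt (\<phi> t)) (ball 0 d)"
      using fchart_locally_injective[OF ch n] by blast
    define m where "m = min s d"
    have m: "0 < m" "m \<le> r" "ball 0 m \<subseteq> ball (0::complex) s" "ball 0 m \<subseteq> ball (0::complex) d"
      "ball 0 m \<subseteq> ball (0::complex) r"
      using s d by (auto simp: m_def)
    have onr: "on_fermat n (\<phi> t)" if "t \<in> ball 0 r" for t using ch that unfolding fchart_def by blast
    have inf: "ppt (\<phi> t) \<in> fermat n" if "t \<in> ball 0 m" for t
      using onr[of t] m(5) that ppt_in_fermat_iff[OF on_fermat_nonzero] by blast
    have ch': "fchart n q \<phi> m"
      using ch m holo3_subset[OF _ m(5)] unfolding fchart_def by blast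
    have hm: "holo3 \<psi> (ball 0 m)" using holo3_subset[OF h m(3)] .
    have onm: "on_fermat n (\<psi> t) \<and> ppt (\<psi> t) = \<sigma> (ppt (\<phi> t))" if t: "t \<in> ball 0 m" for t
    proof -
      have *: "\<psi> t \<noteq> (0,0,0)" "ppt (\<psi> t) = \<sigma> (ppt (\<phi> t))" using \<psi> m(3) t by blast+
      have "\<sigma> (ppt (\<phi> t)) \<in> fermat n" using bij inf[OF t] bij_betwE by blast
      then show ?thesis using * ppt_in_fermat_iff[OF *(1)] by simp
    qed
    have "ppt (\<psi> 0) = \<sigma> q" using onm[of 0] m(1) ch unfolding fchart_def by simp
    moreover have "inj_on (\<lambda>t. ppt (\<psi> t)) (ball 0 m)"
    proof (rule inj_onI)
      fix x y assume xy: "x \<in> ball 0 m" "y \<in> ball 0 m" "ppt (\<psi> x) = ppt (\<psi> y)"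
      then have "\<sigma> (ppt (\<phi> x)) = \<sigma> (ppt (\<phi> y))" using onm by simp
      then have "ppt (\<phi> x) = ppt (\<phi> y)"
        using bij_betw_imp_inj_on[OF bij] inf[OF xy(1)] inf[OF xy(2)] by (meson inj_onD)
      then show "x = y" using inj_onD[OF d(3)] xy m(4) by blast
    qed
    ultimately show ?thesis using ch' m(1) hm onm by blast
  qed
  define f' where "f' = (\<lambda>q. f (\<sigma> q))"
  have "holo_at n f' q" if q: "q \<in> fermat n - {p}" for q
  proof -
    obtain \<phi> \<psi> s where ch: "fchart n q \<phi> s" and s: "s > 0" and h: "holo3 \<psi> (ball 0 s)"
      and \<psi>: "\<And>t. t \<in> ball 0 s \<Longrightarrow> on_fermat n (\<psi> t) \<and> ppt (\<psi> t) = \<sigma> (ppt (\<phi> t))"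
      and \<psi>0: "ppt (\<psi> 0) = \<sigma> q"
      using lift[of q] q by blast
    have "\<sigma> q \<in> fermat n" "\<sigma> q \<noteq> \<sigma> p"
      using bij q p bij_betwE bij_betw_imp_inj_on[OF bij] by (blast dest: inj_onD)+
    then have fq: "holo_at n f (ppt (\<psi> 0))" using f \<psi>0 by simp
    have s0: "(0::complex) \<in> ball 0 s" using s by simp
    obtain \<rho> where \<rho>: "\<rho> > 0" "ball 0 \<rho> \<subseteq> ball (0::complex) s" "(\<lambda>t. f (ppt (\<psi> t))) holomorphic_on ball 0 \<rho>"
      using holo_at_along_curve[OF fq h open_ball s0 _ n] \<psi> by blast
    have "(\<lambda>t. f' (ppt (\<phi> t))) holomorphic_on ball 0 \<rho>"
      by (rule holomorphic_transform[OF \<rho>(3)]) (use \<psi> \<rho>(2) in \<open>auto simp: f'_def\<close>)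
    moreover have "fchart n q \<phi> \<rho>"
      using ch \<rho>(1,2) holo3_subset[OF _ \<rho>(2)] unfolding fchart_def by blast
    ultimately show ?thesis unfolding holo_at_def by blast
  qed
  moreover have "pole_order n f' p k"
  proof -
    obtain \<phi> \<psi> s where ch: "fchart n p \<phi> s" and s: "s > 0" and h: "holo3 \<psi> (ball 0 s)"
      and \<psi>: "\<And>t. t \<in> ball 0 s \<Longrightarrow> on_fermat n (\<psi> t) \<and> ppt (\<psi> t) = \<sigma> (ppt (\<phi> t))"
      and \<psi>0: "ppt (\<psi> 0) = \<sigma> p" and inj: "inj_on (\<lambda>t. ppt (\<psi> t)) (ball 0 s)"
      using lift[of p] p by blast
    have fp': "pole_order n f (ppt (\<psi> 0)) k" using fp \<psi>0 by simp
    obtain s' g where s': "0 < s'" "s' \<le> s" "g holomorphic_on ball 0 s'" "g 0 \<noteq> 0"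
      "\<forall>t\<in>ball 0 s' - {0}. f (ppt (\<psi> t)) = g t / t ^ k"
      using pole_order_along_curve[OF fp' h s _ n inj] \<psi> by blast
    have sub: "ball 0 s' \<subseteq> ball (0::complex) s" using s'(2) by auto
    have "fchart n p \<phi> s'"
      using ch s'(1) sub holo3_subset[OF _ sub] unfolding fchart_def by blast
    moreover have "\<forall>t\<in>ball 0 s' - {0}. f' (ppt (\<phi> t)) = g t / t ^ k"
      using s'(5) \<psi> sub unfolding f'_def by (metis DiffD1 subsetD)
    ultimately show ?thesis using s'(3,4) unfolding pole_order_def by blast
  qed
  ultimately show ?thesis using k(1) unfolding gaps_def by blast
qed


subsection \<open>Bounded-degree polynomials in the affine coordinates\<close>

text \<open>The index bounds the total degree. A predicate on functions is enough, since only
  holomorphy after substitution and growth of order d are extracted; the slack in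
  \<open>mult\<close> lets degree bounds be raised.\<close>

inductive bipoly :: "nat \<Rightarrow> (complex \<Rightarrow> complex \<Rightarrow> complex) \<Rightarrow> bool" where
  const: "bipoly d (\<lambda>u s. c)"
| fst: "bipoly (Suc d) (\<lambda>u s. u)"
| snd: "bipoly (Suc d) (\<lambda>u s. s)"
| add: "bipoly d P \<Longrightarrow> bipoly d Q \<Longrightarrow> bipoly d (\<lambda>u s. P u s + Q u s)"
| mult: "bipoly d P \<Longrightarrow> bipoly e Q \<Longrightarrow> d + e \<le> m \<Longrightarrow> bipoly m (\<lambda>u s. P u s * Q u s)"

lemma bipoly_sum:
  assumes "\<And>i. i \<in> I \<Longrightarrow> bipoly d (P i)"
  shows "bipoly d (\<lambda>u s. \<Sum>i\<in>I. P i u s)"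
  using assms
proof (induction I rule: infinite_finite_induct)
  case (insert i I)
  then show ?case using bipoly.add[of d "P i"] by simp
qed (auto intro: bipoly.const)

lemma bipoly_power:
  assumes "bipoly d P" "j * d \<le> m"
  shows "bipoly m (\<lambda>u s. P u s ^ j)"
  using assms(2)
proof (induction j arbitrary: m)
  case 0
  then show ?case using bipoly.const[of m 1] by simp
next
  case (Suc j)
  have "bipoly m (\<lambda>u s. P u s * P u s ^ j)"
    using bipoly.mult[OF assms(1) Suc.IH[OF order_refl]] Suc.prems by simp
  then show ?case by simp
qed

lemma bipoly_holomorphic:
  assumes "bipoly d P" "f holomorphic_on S" "g holomorphic_on S"
  shows "(\<lambda>t. P (f t) (g t)) holomorphic_on S"
  using assms by induction (auto intro!: holomorphic_intros)

lemma bipoly_growth: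
  assumes "bipoly d P"
  shows "\<exists>C\<ge>0. \<forall>u s. norm (P u s) \<le> C * (1 + norm u + norm s) ^ d"
  using assms
proof induction
  case (const d c)
  have "norm c \<le> norm c * (1 + norm u + norm s) ^ d" for u s :: complex
    using mult_left_mono[of 1 "(1 + norm u + norm s) ^ d" "norm c"] by (simp add: one_le_power)
  then show ?case by (intro exI[of _ "norm c"]) auto
next
  case (fst d)
  have "norm u \<le> 1 * (1 + norm u + norm s) ^ Suc d" for u s :: complex
    using self_le_power[of "1 + norm u + norm s" "Suc d"] by (smt (verit) norm_ge_zero zero_less_Suc)
  then show ?case by (metis zero_le_one)
next
  case (snd d)
  have "norm s \<le> 1 * (1 + norm u + norm s) ^ Suc d" for u s :: complex
    using self_le_power[of "1 + norm u + norm s" "Suc d"] by (smt (verit) norm_ge_zero zero_less_Suc)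
  then show ?case by (metis zero_le_one)
next
  case (add d P Q)
  then obtain C D where CD: "C \<ge> 0" "D \<ge> 0" "\<And>u s. norm (P u s) \<le> C * (1 + norm u + norm s) ^ d"
    "\<And>u s. norm (Q u s) \<le> D * (1 + norm u + norm s) ^ d" by auto
  have "norm (P u s + Q u s) \<le> (C + D) * (1 + norm u + norm s) ^ d" for u s
    using norm_triangle_ineq[of "P u s" "Q u s"] CD(3,4)[of u s] by (simp add: algebra_simps)
  then show ?case using CD(1,2) by (intro exI[of _ "C + D"]) auto
next
  case (mult d P e Q m)
  then obtain C D where CD: "C \<ge> 0" "D \<ge> 0" "\<And>u s. norm (P u s) \<le> C * (1 + norm u + norm s) ^ d"
    "\<And>u s. norm (Q u s) \<le> D * (1 + norm u + norm s) ^ e" by auto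
  have "norm (P u s * Q u s) \<le> C * D * (1 + norm u + norm s) ^ m" for u s
  proof -
    have "norm (P u s * Q u s) \<le> (C * (1 + norm u + norm s) ^ d) * (D * (1 + norm u + norm s) ^ e)"
      unfolding norm_mult using CD by (intro mult_mono) auto
    also have "\<dots> = C * D * (1 + norm u + norm s) ^ (d + e)" by (simp add: power_add)
    also have "\<dots> \<le> C * D * (1 + norm u + norm s) ^ m"
      using CD(1,2) mult.hyps by (intro mult_left_mono power_increasing) auto
    finally show ?thesis .
  qed
  then show ?case using CD(1,2) by (intro exI[of _ "C * D"]) auto
qed

subsection \<open>Holomorphic differentials produce gaps\<close>

text \<open>Riemann's removable singularity theorem, one point at a time. Near each remaining point
  the extension agrees with the old function, so the limit condition is inherited.\<close>

lemma holomorphic_extend_finite: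
  fixes f :: "complex \<Rightarrow> complex"
  assumes "finite B" "f holomorphic_on - B" "\<And>b. b \<in> B \<Longrightarrow> ((\<lambda>z. (z - b) * f z) \<longlongrightarrow> 0) (at b)"
  shows "\<exists>g. g holomorphic_on UNIV \<and> (\<forall>z. z \<notin> B \<longrightarrow> g z = f z)"
  using assms
proof (induction B arbitrary: f rule: finite_induct)
  case empty
  then show ?case by auto
next
  case (insert b B)
  have "f holomorphic_on (- B) - {b}"
    using insert.prems(1) by (rule back_subst[of "\<lambda>S. f holomorphic_on S"]) auto
  moreover have opn: "open (- B)" using insert.hyps(1) by (simp add: finite_imp_closed open_Compl)
  then have "b \<in> interior (- B)" using insert.hyps(2) by (simp add: interior_open)
  ultimately obtain g where g: "g holomorphic_on - B" "\<And>z. z \<in> - B - {b} \<Longrightarrow> g z = f z"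
    using holomorphic_on_extend_lim[of f "- B" b] insert.prems(2)[of b] by blast
  have "((\<lambda>z. (z - c) * g z) \<longlongrightarrow> 0) (at c)" if c: "c \<in> B" for c
  proof (rule Lim_transform_eventually[OF insert.prems(2)[of c]])
    have "finite (insert b B - {c})" using insert.hyps by simp
    then have "open (- (insert b B - {c}))" using finite_imp_closed open_Compl by blast
    moreover have "c \<in> - (insert b B - {c})" by simp
    ultimately have "\<forall>\<^sub>F z in at c. z \<in> - (insert b B - {c})"
      by (rule eventually_at_in_open')
    moreover have "\<forall>\<^sub>F z in at c. z \<noteq> c" by (simp add: eventually_at_filter)
    ultimately show "\<forall>\<^sub>F z in at c. (z - c) * f z = (z - c) * g z"
      by eventually_elim (use g(2) in auto)
  qed (use c in auto)
  from insert.IH[OF g(1) this] obtain h where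
    "h holomorphic_on UNIV" "\<And>z. z \<notin> B \<Longrightarrow> h z = g z" by blast
  then show ?case using g(2) by (intro exI[of _ h]) auto
qed

lemma power_add_one_le:
  fixes x :: real
  assumes "x \<ge> 0" "n \<ge> 1"
  shows "1 + x ^ n \<le> (1 + x) ^ n"
  using assms(2)
proof (induction n rule: nat_induct_at_least)
  case (Suc n)
  have "1 + x ^ Suc n \<le> (1 + x) * (1 + x ^ n)" using assms(1) by (simp add: algebra_simps)
  also have "\<dots> \<le> (1 + x) * (1 + x) ^ n" using Suc.IH assms(1) by (intro mult_left_mono) auto
  finally show ?case by simp
qed simp

lemma fermat_root_upper:
  fixes u s :: complex
  assumes "s ^ n = - (1 + u ^ n)" "n \<ge> 1"
  shows "norm s \<le> 1 + norm u"
proof -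
  have "norm s ^ n = norm (1 + u ^ n)"
    using assms(1) by (metis norm_minus_cancel norm_power)
  also have "\<dots> \<le> 1 + norm u ^ n"
    using norm_triangle_ineq[of 1 "u ^ n"] by (simp add: norm_power)
  also have "\<dots> \<le> (1 + norm u) ^ n"
    using assms(2) by (intro power_add_one_le) auto
  finally show ?thesis using power_le_imp_le_base[of "norm s" "n - 1" "1 + norm u"] assms(2) by simp
qed

text \<open>The equation is symmetric in u and s. This direction makes the denominator s^(n-1) grow
  at infinity.\<close>

lemma fermat_root_lower:
  fixes u s :: complex
  assumes "s ^ n = - (1 + u ^ n)" "n \<ge> 1"
  shows "norm u \<le> 1 + norm s"
proof -
  have "u ^ n = - (1 + s ^ n)" using assms(1) by simp
  then show ?thesis using fermat_root_upper assms(2) by blast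
qed

lemma compact_fermat_affine:
  assumes "compact U" "n \<ge> 1"
  shows "compact {(u, 1, s) :: c3 | u s. u \<in> U \<and> s ^ n = - (1 + u ^ n)}" (is "compact ?K")
proof -
  obtain B where B: "\<And>u. u \<in> U \<Longrightarrow> norm u \<le> B"
    using compact_imp_bounded[OF assms(1)] unfolding bounded_iff by blast
  have eq: "?K = (U \<times> {1} \<times> cball 0 (1 + B)) \<inter> {v. snd (snd v) ^ n = - (1 + fst v ^ n)}"
    (is "_ = ?L")
  proof (intro set_eqI iffI)
    fix v :: c3 assume "v \<in> ?K"
    then obtain u s where v: "v = (u, 1, s)" "u \<in> U" "s ^ n = - (1 + u ^ n)" by blast
    then have "norm s \<le> 1 + B" using fermat_root_upper[OF v(3) assms(2)] B[OF v(2)] by simp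
    then show "v \<in> ?L" using v by simp
  next
    fix v :: c3 assume v: "v \<in> ?L"
    have "v = (fst v, 1, snd (snd v))" using v by (cases v) simp
    moreover have "fst v \<in> U" "snd (snd v) ^ n = - (1 + fst v ^ n)" using v by auto
    ultimately show "v \<in> ?K" by blast
  qed
  have "compact (U \<times> {1 :: complex} \<times> cball (0 :: complex) (1 + B))"
    using assms(1) by (intro compact_Times) auto
  moreover have "closed {v :: c3. snd (snd v) ^ n = - (1 + fst v ^ n)}"
    by (intro closed_Collect_eq continuous_intros)
  ultimately show ?thesis unfolding eq by (rule compact_Int_closed)
qed

definition roots_of_unity :: "nat \<Rightarrow> complex set" where
  "roots_of_unity n = {\<omega>. \<omega> ^ n = 1}"

lemma finite_roots_of_unity: "n \<ge> 1 \<Longrightarrow> finite (roots_of_unity n)"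
  unfolding roots_of_unity_def using finite_roots_unity[of n] by simp

lemma fermat_branch_rotate:
  assumes "fermat_branch n u S r" "\<omega> \<in> roots_of_unity n" "n \<ge> 1"
  shows "fermat_branch n u (\<lambda>t. \<omega> * S t) r"
proof -
  have "\<omega> ^ n = 1" using assms(2) by (simp add: roots_of_unity_def)
  moreover have "\<omega> \<noteq> 0" using calculation assms(3) by (auto simp: power_0_left)
  ultimately show ?thesis
    using assms(1) unfolding fermat_branch_def by (auto simp: power_mult_distrib intro!: holomorphic_intros)
qed

text \<open>Roots of unity permute the sheets simply transitively, so a sum over a set moving with t
  becomes a sum over a fixed finite index set.\<close>

lemma fermat_sum_over_fibre:
  assumes "fermat_branch n u S r" "t \<in> ball 0 r" "n \<ge> 1"
  shows "(\<Sum>s | s ^ n = - (1 + (u + t) ^ n). F s) = (\<Sum>\<omega>\<in>roots_of_unity n. F (\<omega> * S t))"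
proof -
  have S: "S t ^ n = - (1 + (u + t) ^ n)" "S t \<noteq> 0"
    using assms(1,2) unfolding fermat_branch_def by blast+
  have "bij_betw (\<lambda>\<omega>. \<omega> * S t) (roots_of_unity n) {s. s ^ n = - (1 + (u + t) ^ n)}"
  proof (rule bij_betwI[of _ _ _ "\<lambda>s. s / S t"])
    show "(\<lambda>\<omega>. \<omega> * S t) \<in> roots_of_unity n \<rightarrow> {s. s ^ n = - (1 + (u + t) ^ n)}"
      using S by (auto simp: roots_of_unity_def power_mult_distrib)
    show "(\<lambda>s. s / S t) \<in> {s. s ^ n = - (1 + (u + t) ^ n)} \<rightarrow> roots_of_unity n"
    proof
      fix s assume "s \<in> {s. s ^ n = - (1 + (u + t) ^ n)}"
      then have "s ^ n = S t ^ n" using S(1) by simp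
      then show "s / S t \<in> roots_of_unity n" using S(2) by (simp add: roots_of_unity_def power_divide)
    qed
  qed (use S in auto)
  from sum.reindex_bij_betw[OF this, of F] show ?thesis by (rule sym)
qed


text \<open>The trace to the line with coordinate \<open>x / y\<close> of the function \<open>f\<close> times the holomorphic
  differential \<open>P du / s^(n - 1)\<close>.\<close>

definition fibre_sum ::
  "nat \<Rightarrow> (c3 set \<Rightarrow> complex) \<Rightarrow> (complex \<Rightarrow> complex \<Rightarrow> complex) \<Rightarrow> complex \<Rightarrow> complex" where
  "fibre_sum n f P u = (\<Sum>s | s ^ n = - (1 + u ^ n). f (ppt (u, 1, s)) * P u s / s ^ (n - 1))"

lemma fibre_sum_branch:
  assumes "fermat_branch n u S r" "t \<in> ball 0 r" "n \<ge> 1"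
  shows "fibre_sum n f P (u + t) =
    (\<Sum>\<omega>\<in>roots_of_unity n. f (ppt (u + t, 1, \<omega> * S t)) * P (u + t) (\<omega> * S t) / (\<omega> * S t) ^ (n - 1))"
  unfolding fibre_sum_def using fermat_sum_over_fibre[OF assms] .

lemma fermat_branch_at:
  assumes "1 + u ^ n \<noteq> 0" "n \<ge> 1"
  shows "\<exists>r S. fermat_branch n u S r"
proof -
  obtain s where s: "- (1 + u ^ n) = s ^ n"
    using exists_complex_root[of n "- (1 + u ^ n)"] assms(2) by auto
  have "s \<noteq> 0"
  proof
    assume "s = 0"
    then have "- (1 + u ^ n) = 0" using s assms(2) by (simp only: power_0_left) simp
    then show False using assms(1) by (simp only: neg_equal_0_iff_equal) 
  qed
  then show ?thesis using fermat_branch_exists[OF s[symmetric] _ assms(2)] by blast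
qed

lemma fibre_sum_term_holomorphic:
  assumes br: "fermat_branch n u S r" and n: "n \<ge> 1" and P: "bipoly d P"
    and f: "\<And>t. t \<in> ball 0 r \<Longrightarrow> holo_at n f (ppt (u + t, 1, S t))"
  shows "(\<lambda>t. f (ppt (u + t, 1, S t)) * P (u + t) (S t) / S t ^ (n - 1)) holomorphic_on ball 0 r"
proof -
  have S: "S holomorphic_on ball 0 r" "\<And>t. t \<in> ball 0 r \<Longrightarrow> S t \<noteq> 0"
    using br unfolding fermat_branch_def by blast+
  have "(\<lambda>t. f (ppt (u + t, 1, S t))) holomorphic_on ball 0 r"
    using holo_along_curve[OF f fermat_branch_holo3[OF br] open_ball fermat_branch_on_fermat[OF br] n] .
  moreover have "(\<lambda>t. P (u + t) (S t)) holomorphic_on ball 0 r"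
    by (rule bipoly_holomorphic[OF P _ S(1)]) (intro holomorphic_intros)
  ultimately show ?thesis using S by (intro holomorphic_intros) auto
qed

text \<open>Branches exist only locally, but the sum over a whole fibre does not depend on their
  labelling; near each point it is a finite sum of holomorphic terms.\<close>

lemma fibre_sum_holomorphic:
  assumes D: "open D" "\<And>u. u \<in> D \<Longrightarrow> 1 + u ^ n \<noteq> 0" and n: "n \<ge> 1" and P: "bipoly d P"
    and f: "\<And>u s. u \<in> D \<Longrightarrow> s ^ n = - (1 + u ^ n) \<Longrightarrow> holo_at n f (ppt (u, 1, s))"
  shows "fibre_sum n f P holomorphic_on D"
  unfolding holomorphic_on_open[OF D(1)]
proof
  fix u assume u: "u \<in> D"
  obtain r0 S where br0: "fermat_branch n u S r0"
    using fermat_branch_at[OF D(2)[OF u] n] by blast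
  obtain r1 where r1: "r1 > 0" "ball u r1 \<subseteq> D" using D(1) u by (meson openE)
  have r0: "r0 > 0" using br0 unfolding fermat_branch_def by blast
  define r where "r = min r0 r1"
  have r: "0 < r" "r \<le> r0" "r \<le> r1" using r0 r1 by (auto simp: r_def)
  have br: "fermat_branch n u S r" using fermat_branch_subset[OF br0 r(1,2)] .
  have inD: "u + t \<in> D" if "t \<in> ball 0 r" for t
    using that r(3) by (intro subsetD[OF r1(2)]) (auto simp: dist_norm)
  have "(\<lambda>t. fibre_sum n f P (u + t)) holomorphic_on ball 0 r"
  proof (rule holomorphic_transform)
    show "(\<lambda>t. \<Sum>\<omega>\<in>roots_of_unity n. f (ppt (u + t, 1, \<omega> * S t)) * P (u + t) (\<omega> * S t)
        / (\<omega> * S t) ^ (n - 1)) holomorphic_on ball 0 r"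
    proof (intro holomorphic_on_sum)
      fix \<omega> assume \<omega>: "\<omega> \<in> roots_of_unity n"
      have br\<omega>: "fermat_branch n u (\<lambda>t. \<omega> * S t) r" using fermat_branch_rotate[OF br \<omega> n] .
      show "(\<lambda>t. f (ppt (u + t, 1, \<omega> * S t)) * P (u + t) (\<omega> * S t) / (\<omega> * S t) ^ (n - 1))
          holomorphic_on ball 0 r"
      proof (rule fibre_sum_term_holomorphic[OF br\<omega> n P])
        fix t :: complex assume t: "t \<in> ball 0 r"
        have "(\<omega> * S t) ^ n = - (1 + (u + t) ^ n)"
          using br\<omega> t unfolding fermat_branch_def by blast
        then show "holo_at n f (ppt (u + t, 1, \<omega> * S t))" using f inD[OF t] by blast
      qed
    qed
    show "(\<Sum>\<omega>\<in>roots_of_unity n. f (ppt (u + t, 1, \<omega> * S t)) * P (u + t) (\<omega> * S t)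
        / (\<omega> * S t) ^ (n - 1)) = fibre_sum n f P (u + t)" if "t \<in> ball 0 r" for t
      using fibre_sum_branch[OF br that n, of f P] by (rule sym)
  qed
  then have "(\<lambda>t. fibre_sum n f P (u + t)) field_differentiable at 0"
    using r(1) by (simp add: holomorphic_on_imp_differentiable_at)
  then obtain f' where "((\<lambda>t. fibre_sum n f P (u + t)) has_field_derivative f') (at 0)"
    unfolding field_differentiable_def by blast
  then have "(fibre_sum n f P has_field_derivative f') (at (u + 0))"
    using DERIV_at_within_shift[of "fibre_sum n f P" f' u 0 UNIV] by simp
  then show "\<exists>f'. (fibre_sum n f P has_field_derivative f') (at u)" by auto
qed

lemma bounded_on_compact_affine:
  assumes "compact U" "n \<ge> 1"
    and f: "\<And>u s. u \<in> U \<Longrightarrow> s ^ n = - (1 + u ^ n) \<Longrightarrow> holo_at n f (ppt (u, 1, s))"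
  shows "\<exists>B\<ge>0. \<forall>u\<in>U. \<forall>s. s ^ n = - (1 + u ^ n) \<longrightarrow> norm (f (ppt (u, 1, s))) \<le> B"
proof -
  define K where "K = {(u, 1, s) :: c3 | u s. u \<in> U \<and> s ^ n = - (1 + u ^ n)}"
  have K: "compact K" unfolding K_def by (rule compact_fermat_affine[OF assms(1,2)])
  have "on_fermat n v \<and> holo_at n f (ppt v)" if "v \<in> K" for v
    using that f unfolding K_def by (auto simp: on_fermat_affine simp del: minus_add_distrib)
  then obtain B where B: "\<And>v. v \<in> K \<Longrightarrow> norm (f (ppt v)) \<le> B"
    using holo_at_bounded_on_compact[OF K _ assms(2)] by metis
  have "norm (f (ppt (u, 1, s))) \<le> \<bar>B\<bar>" if "u \<in> U" "s ^ n = - (1 + u ^ n)" for u s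
  proof -
    have "(u, 1, s) \<in> K" using that unfolding K_def by blast
    from B[OF this] show ?thesis by simp
  qed
  then show ?thesis by (intro exI[of _ "\<bar>B\<bar>"]) auto
qed

text \<open>On a fibre all |s| equal the n-th root of |1 + u^n|. The estimate serves two regimes:
  this root tends to 0 at ramification points and grows like |u| at infinity.\<close>

lemma fibre_sum_bound:
  assumes B: "\<And>s. s ^ n = - (1 + u ^ n) \<Longrightarrow> norm (f (ppt (u, 1, s))) \<le> B" "B \<ge> 0"
    and P: "\<And>s. norm (P u s) \<le> C * (1 + norm u + norm s) ^ d" "C \<ge> 0" and n: "n \<ge> 1"
    and u: "1 + u ^ n \<noteq> 0"
  shows "norm (fibre_sum n f P u) \<le>
    card (roots_of_unity n) * (B * (C * (2 + 2 * norm u) ^ d)) / root n (norm (1 + u ^ n)) ^ (n - 1)"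
proof -
  obtain r S where br: "fermat_branch n u S r" using fermat_branch_at[OF u n] by blast
  have r0: "(0::complex) \<in> ball 0 r" using br unfolding fermat_branch_def by simp
  have eq: "fibre_sum n f P u = (\<Sum>\<omega>\<in>roots_of_unity n.
     f (ppt (u, 1, \<omega> * S 0)) * P u (\<omega> * S 0) / (\<omega> * S 0) ^ (n - 1))"
    using fibre_sum_branch[OF br r0 n, of f P] by simp
  have "norm (f (ppt (u, 1, \<omega> * S 0)) * P u (\<omega> * S 0) / (\<omega> * S 0) ^ (n - 1)) \<le>
     B * (C * (2 + 2 * norm u) ^ d) / root n (norm (1 + u ^ n)) ^ (n - 1)"
    if \<omega>: "\<omega> \<in> roots_of_unity n" for \<omega>
  proof -
    define s where "s = \<omega> * S 0"
    have s: "s ^ n = - (1 + u ^ n)"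
      using fermat_branch_rotate[OF br \<omega> n] r0 unfolding fermat_branch_def s_def by force
    then have "norm s ^ n = norm (1 + u ^ n)" by (metis norm_minus_cancel norm_power)
    then have ns: "norm s = root n (norm (1 + u ^ n))" using n real_root_pos_unique[of n "norm s"] by simp
    have "norm (P u s) \<le> C * (1 + norm u + norm s) ^ d" by (rule P)
    also have "\<dots> \<le> C * (2 + 2 * norm u) ^ d"
      using fermat_root_upper[OF s n] P(2) by (intro mult_left_mono power_mono) auto
    finally have "norm (f (ppt (u, 1, s)) * P u s) \<le> B * (C * (2 + 2 * norm u) ^ d)"
      unfolding norm_mult using B(1)[OF s] B(2) by (intro mult_mono) auto
    then show ?thesis unfolding s_def[symmetric] norm_divide norm_power ns
      using n by (intro divide_right_mono) auto
  qed
  then have "norm (fibre_sum n f P u) \<le> (\<Sum>\<omega>\<in>roots_of_unity n.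
      B * (C * (2 + 2 * norm u) ^ d) / root n (norm (1 + u ^ n)) ^ (n - 1))"
    unfolding eq by (intro sum_norm_le) 
  then show ?thesis by simp
qed

text \<open>Put h = 1 + u^n, which has a simple zero at e. The trace is O(|h|^(-(n-1)/n)), so its
  product with u - e is O(|h|^(1/n)) and tends to 0: the singularity is removable although the
  differential is divided by s^(n-1).\<close>

lemma fibre_sum_at_branch_point:
  assumes e: "e ^ n = -1" and n: "n \<ge> 1" and \<delta>: "\<delta> > 0" and P: "bipoly d P"
    and f: "\<And>u s. u \<in> cball e \<delta> \<Longrightarrow> s ^ n = - (1 + u ^ n) \<Longrightarrow> holo_at n f (ppt (u, 1, s))"
  shows "((\<lambda>u. (u - e) * fibre_sum n f P u) \<longlongrightarrow> 0) (at e)"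
proof -
  obtain B where B: "B \<ge> 0"
    "\<And>u s. u \<in> cball e \<delta> \<Longrightarrow> s ^ n = - (1 + u ^ n) \<Longrightarrow> norm (f (ppt (u, 1, s))) \<le> B"
    using bounded_on_compact_affine[OF compact_cball n f] by metis
  obtain C where C: "C \<ge> 0" "\<And>u s. norm (P u s) \<le> C * (1 + norm u + norm s) ^ d"
    using bipoly_growth[OF P] by blast
  have e0: "e \<noteq> 0" using e n by (auto simp: power_0_left)
  define h where "h = (\<lambda>u :: complex. 1 + u ^ n)"
  define D where "D = of_nat n * e ^ (n - 1)"
  have D: "(h has_field_derivative D) (at e)" "D \<noteq> 0"
    unfolding h_def D_def using e0 n by (auto intro!: derivative_eq_intros)
  have he: "h e = 0" using e by (simp add: h_def)
  have slope: "((\<lambda>u. h u / (u - e)) \<longlongrightarrow> D) (at e)"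
    using D(1) he unfolding has_field_derivative_iff by simp
  then have ne: "\<forall>\<^sub>F u in at e. h u / (u - e) \<noteq> 0"
    using D(2) by (rule tendsto_imp_eventually_ne)
  define N where "N = (\<lambda>u :: complex. card (roots_of_unity n) * (B * (C * (2 + 2 * norm u) ^ d)))"
  have hc: "(h \<longlongrightarrow> 0) (at e)"
  proof -
    have "isCont h e" unfolding h_def by (intro continuous_intros)
    then show ?thesis using he by (simp add: isCont_def)
  qed
  have "((\<lambda>u. N u * root n (norm (h u)) / norm (h u / (u - e))) \<longlongrightarrow> N e * root n (norm (0::complex)) / norm D) (at e)"
    unfolding N_def using D(2) by (intro tendsto_intros slope hc) auto
  then have "((\<lambda>u. N u * root n (norm (h u)) / norm (h u / (u - e))) \<longlongrightarrow> 0) (at e)" by simp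
  moreover have "\<forall>\<^sub>F u in at e. norm ((u - e) * fibre_sum n f P u)
     \<le> N u * root n (norm (h u)) / norm (h u / (u - e))"
  proof -
    have "\<forall>\<^sub>F u in at e. u \<in> ball e \<delta>" using \<delta> by (intro eventually_at_in_open') auto
    then show ?thesis using ne
    proof eventually_elim
      case (elim u)
      then have hu: "h u \<noteq> 0" "u \<noteq> e" by auto
      have "norm (fibre_sum n f P u) \<le> N u / root n (norm (h u)) ^ (n - 1)"
        unfolding N_def h_def
      proof (rule fibre_sum_bound[OF _ B(1) C(2,1) n])
        show "norm (f (ppt (u, 1, s))) \<le> B" if "s ^ n = - (1 + u ^ n)" for s
          using B(2)[OF _ that] elim(1) by simp
        show "1 + u ^ n \<noteq> 0" using hu(1) by (simp add: h_def)
      qed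
      moreover have "root n (norm (h u)) ^ (n - 1) = norm (h u) / root n (norm (h u))"
      proof -
        have "root n (norm (h u)) * root n (norm (h u)) ^ (n - 1) = root n (norm (h u)) ^ n"
          using n by (cases n) auto
        also have "\<dots> = norm (h u)" using n by (simp add: real_root_pow_pos2)
        finally show ?thesis using hu n by (simp add: field_simps)
      qed
      ultimately have "norm (fibre_sum n f P u) \<le> N u * root n (norm (h u)) / norm (h u)" by simp
      then have "norm (u - e) * norm (fibre_sum n f P u)
          \<le> norm (u - e) * (N u * root n (norm (h u)) / norm (h u))"
        by (intro mult_left_mono) auto
      then show ?case by (simp add: norm_mult norm_divide mult_ac)
    qed
  qed
  ultimately show ?thesis by (rule Lim_null_comparison[rotated])
qed

text \<open>In the chart (1 : y : z) the points over large u are those with small y = 1/u, a compact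
  set on which f is bounded. The numerator contributes degree n - 3 and the denominator n - 1,
  leaving quadratic decay.\<close>

lemma fibre_sum_at_infinity:
  assumes n: "n \<ge> 3" and P: "bipoly (n - 3) P" and \<delta>: "\<delta> > 0"
    and f: "\<And>y z. norm y \<le> \<delta> \<Longrightarrow> z ^ n = - (1 + y ^ n) \<Longrightarrow> holo_at n f (ppt (1, y, z))"
  shows "\<exists>K R. R > 0 \<and> (\<forall>u. norm u \<ge> R \<longrightarrow> norm (fibre_sum n f P u) \<le> K / (1 + norm u) ^ 2)"
proof -
  have n1: "n \<ge> 1" using n by simp
  define L where "L = {(u, 1, s) :: c3 | u s. u \<in> cball 0 \<delta> \<and> s ^ n = - (1 + u ^ n)}"
  define L' where "L' = swap12 ` L"
  have sym: "fermat_sym n swap12" by (rule fermat_sym_swap12)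
  have "compact L" unfolding L_def by (rule compact_fermat_affine[OF compact_cball n1])
  moreover have "continuous_on UNIV swap12" using sym unfolding fermat_sym_def by (elim conjE)
  then have "continuous_on L swap12" using continuous_on_subset by blast
  ultimately have "compact L'" unfolding L'_def using compact_continuous_image by blast
  moreover have "on_fermat n v \<and> holo_at n f (ppt v)" if v: "v \<in> L'" for v
  proof -
    obtain w where w: "w \<in> L" "v = swap12 w" using v unfolding L'_def by blast
    obtain y z where w': "w = (y, 1, z)" "y \<in> cball 0 \<delta>" "z ^ n = - (1 + y ^ n)"
      using w(1) unfolding L_def by (elim CollectE exE conjE) (rule that)
    have yz: "v = swap12 (y, 1, z)" "norm y \<le> \<delta>" "z ^ n = - (1 + y ^ n)"
      using w(2) w' by simp_all
    have "on_fermat n (swap12 (y, 1, z)) = on_fermat n (y, 1, z)" using sym unfolding fermat_sym_def by blast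
    moreover have "on_fermat n (y, 1, z)" unfolding on_fermat_affine by (rule yz)
    moreover have "holo_at n f (ppt (1, y, z))" using f yz(2,3) by blast
    ultimately show ?thesis unfolding yz(1) by (simp add: swap12_def)
  qed
  ultimately obtain B where B: "\<And>v. v \<in> L' \<Longrightarrow> norm (f (ppt v)) \<le> B"
    using holo_at_bounded_on_compact[OF _ _ n1] by metis
  obtain C where C: "C \<ge> 0" "\<And>u s. norm (P u s) \<le> C * (1 + norm u + norm s) ^ (n - 3)"
    using bipoly_growth[OF P] by blast
  \<comment> \<open>The bound 1 / \<delta> puts 1/u into the disc where f is controlled; 3 makes |s|
    >= |u| - 1 at least (1 + |u|) / 2.\<close>
  define R where "R = max 3 (1 / \<delta>)"
  define K where "K = card (roots_of_unity n) * (\<bar>B\<bar> * (C * (2 ^ (n - 3) * 2 ^ (n - 1))))"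
  have "norm (fibre_sum n f P u) \<le> K / (1 + norm u) ^ 2" if "norm u \<ge> R" for u
  proof -
    have u: "norm u \<ge> 3" "norm u \<ge> 1 / \<delta>" using that by (auto simp: R_def)
    define a where "a = 1 + norm u"
    have a: "a \<ge> 4" using u by (simp add: a_def)
    have un: "1 + u ^ n \<noteq> 0"
    proof
      assume "1 + u ^ n = 0"
      then have "(0::complex) ^ n = - (1 + u ^ n)" using n by (simp add: power_0_left)
      then show False using fermat_root_lower[of 0 n u] n u(1) by simp
    qed
    have "norm (f (ppt (u, 1, s))) \<le> \<bar>B\<bar>" if s: "s ^ n = - (1 + u ^ n)" for s
    proof -
      have u0: "u \<noteq> 0" using u by auto
      have "(s / u) ^ n = - (1 + (1 / u) ^ n)"
        using s u0 by (simp add: power_divide field_simps)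
      moreover have "norm (1 / u) \<le> \<delta>" using u(2) \<delta> u0 by (simp add: norm_divide field_simps)
      ultimately have "(1 / u, 1, s / u) \<in> L" unfolding L_def by auto
      then have "swap12 (1 / u, 1, s / u) \<in> L'" unfolding L'_def by (rule imageI)
      from B[OF this] have "norm (f (ppt (1, 1 / u, s / u))) \<le> B" by (simp add: swap12_def)
      moreover have "ppt (smul3 (1 / u) (u, 1, s)) = ppt (u, 1, s)"
        using u0 by (intro ppt_smul3) auto
      ultimately show ?thesis using u0 by simp
    qed
    then have "norm (fibre_sum n f P u) \<le> card (roots_of_unity n) * (\<bar>B\<bar> * (C * (2 + 2 * norm u) ^ (n - 3)))
        / root n (norm (1 + u ^ n)) ^ (n - 1)"
      using fibre_sum_bound[of n u f "\<bar>B\<bar>" P C "n - 3"] C n1 un by simp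
    also have "\<dots> \<le> card (roots_of_unity n) * (\<bar>B\<bar> * (C * (2 + 2 * norm u) ^ (n - 3))) / (a / 2) ^ (n - 1)"
    proof -
      obtain s where s: "- (1 + u ^ n) = s ^ n"
        using exists_complex_root[of n "- (1 + u ^ n)"] n1 by auto
      then have "norm s ^ n = norm (1 + u ^ n)" by (metis norm_minus_cancel norm_power)
      then have "norm s = root n (norm (1 + u ^ n))" using n real_root_pos_unique[of n "norm s"] by simp
      moreover have "norm u \<le> 1 + norm s" using fermat_root_lower[OF s[symmetric] n1] .
      ultimately have "a / 2 \<le> root n (norm (1 + u ^ n))" using a by (simp add: a_def)
      then have "(a / 2) ^ (n - 1) \<le> root n (norm (1 + u ^ n)) ^ (n - 1)" using a by (intro power_mono) auto
      moreover have "(a / 2) ^ (n - 1) > 0" using a by simp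
      ultimately show ?thesis using C(1) by (intro divide_left_mono) auto
    qed
    also have "\<dots> = K / a ^ 2"
    proof -
      have "n - 1 = (n - 3) + 2" using n by simp
      then have "a ^ (n - 1) = a ^ (n - 3) * a ^ 2" by (simp only: power_add)
      moreover have "(2 + 2 * norm u) ^ (n - 3) = 2 ^ (n - 3) * a ^ (n - 3)"
        by (simp add: a_def distrib_left flip: power_mult_distrib)
      ultimately show ?thesis using a by (simp add: K_def power_divide)
    qed
    finally show ?thesis unfolding a_def .
  qed
  then show ?thesis by (intro exI[of _ K] exI[of _ R]) (auto simp: R_def)
qed

text \<open>Only the sheet with \<omega> = 1 passes through the pole. There a pole of order k meets
  a zero of order k - 1, so the trace has exactly a simple pole; the other sheets stay
  holomorphic.\<close>

lemma fibre_sum_at_pole: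
  assumes br: "fermat_branch n u S r" and n: "n \<ge> 1" and P: "bipoly d P" and k: "k \<ge> 1"
    and f: "\<And>q. q \<in> fermat n - {ppt (u, 1, S 0)} \<Longrightarrow> holo_at n f q"
    and pole: "pole_order n f (ppt (u, 1, S 0)) k"
    and l: "((\<lambda>t. P (u + t) (S t) / t ^ (k - 1)) \<longlongrightarrow> l) (at 0)" "l \<noteq> 0"
  shows "\<exists>c. c \<noteq> 0 \<and> ((\<lambda>v. (v - u) * fibre_sum n f P v) \<longlongrightarrow> c) (at u)"
proof -
  have r: "r > 0" and S: "S holomorphic_on ball 0 r" "\<And>t. t \<in> ball 0 r \<Longrightarrow> S t \<noteq> 0"
    using br unfolding fermat_branch_def by blast+
  have r0: "(0::complex) \<in> ball 0 r" using r by simp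
  have Sc: "(S \<longlongrightarrow> S 0) (at 0)"
    using holomorphic_on_imp_continuous_on[OF S(1)] r0
    by (metis continuous_on_eq_continuous_at isContD open_ball)
  let ?\<Omega> = "roots_of_unity n"
  define summand where "summand = (\<lambda>\<omega> t. f (ppt (u + t, 1, \<omega> * S t)) * P (u + t) (\<omega> * S t) / (\<omega> * S t) ^ (n - 1))"
  have one: "1 \<in> ?\<Omega>" by (simp add: roots_of_unity_def)
  obtain s' h where h: "0 < s'" "s' \<le> r" "h holomorphic_on ball 0 s'" "h 0 \<noteq> 0"
    "\<And>t. t \<in> ball 0 s' - {0} \<Longrightarrow> f (ppt (u + t, 1, S t)) = h t / t ^ k"
  proof -
    have "pole_order n f (ppt ((\<lambda>t. (u + t, 1, S t)) 0)) k" using pole by simp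
    moreover have "inj_on (\<lambda>t. ppt (u + t, 1, S t)) (ball 0 r)"
      by (auto simp: inj_on_def ppt_affine_eq_iff)
    ultimately have "\<exists>s' h. 0 < s' \<and> s' \<le> r \<and> h holomorphic_on ball 0 s' \<and> h 0 \<noteq> 0 \<and>
      (\<forall>t\<in>ball 0 s' - {0}. f (ppt (u + t, 1, S t)) = h t / t ^ k)"
      using pole_order_along_curve[OF _ fermat_branch_holo3[OF br] r fermat_branch_on_fermat[OF br] n]
      by blast
    then show ?thesis using that by blast
  qed
  have hc: "(h \<longlongrightarrow> h 0) (at 0)"
  proof -
    have "(0::complex) \<in> ball 0 s'" using h(1) by simp
    then show ?thesis
      using holomorphic_on_imp_continuous_on[OF h(3)]
      by (metis continuous_on_eq_continuous_at isContD open_ball)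
  qed
  define c where "c = h 0 * l / S 0 ^ (n - 1)"
  have c: "c \<noteq> 0" using h(4) l(2) S(2)[OF r0] by (simp add: c_def)
  have lim1: "((\<lambda>t. t * summand 1 t) \<longlongrightarrow> c) (at 0)"
  proof (rule Lim_transform_eventually)
    show "((\<lambda>t. h t * (P (u + t) (S t) / t ^ (k - 1)) / S t ^ (n - 1)) \<longlongrightarrow> c) (at 0)"
      unfolding c_def using S(2)[OF r0] by (intro tendsto_intros hc l Sc) auto
    have "\<forall>\<^sub>F t in at (0::complex). t \<in> ball 0 s' - {0}"
      using h(1) by (intro eventually_at_in_open) auto
    then show "\<forall>\<^sub>F t in at 0. h t * (P (u + t) (S t) / t ^ (k - 1)) / S t ^ (n - 1) = t * summand 1 t"
    proof eventually_elim
      case (elim t)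
      have "t ^ k = t * t ^ (k - 1)" using k by (cases k) auto
      then show ?case using h(5)[OF elim] elim by (simp add: summand_def)
    qed
  qed
  have lim0: "((\<lambda>t. t * summand \<omega> t) \<longlongrightarrow> 0) (at 0)" if \<omega>: "\<omega> \<in> ?\<Omega> - {1}" for \<omega>
  proof -
    have br\<omega>: "fermat_branch n u (\<lambda>t. \<omega> * S t) r" using fermat_branch_rotate[OF br _ n] \<omega> by blast
    have "summand \<omega> holomorphic_on ball 0 r"
      unfolding summand_def
    proof (rule fibre_sum_term_holomorphic[OF br\<omega> n P])
      fix t :: complex assume t: "t \<in> ball 0 r"
      have on: "on_fermat n (u + t, 1, \<omega> * S t)" by (rule fermat_branch_on_fermat[OF br\<omega> t])
      have "ppt (u + t, 1, \<omega> * S t) \<noteq> ppt (u, 1, S 0)"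
        unfolding ppt_affine_eq_iff using \<omega> S(2)[OF r0] by auto
      then show "holo_at n f (ppt (u + t, 1, \<omega> * S t))"
        using f on ppt_in_fermat_iff[OF on_fermat_nonzero[OF on]] by blast
    qed
    then have "(summand \<omega> \<longlongrightarrow> summand \<omega> 0) (at 0)"
      using holomorphic_on_imp_continuous_on r0
      by (metis continuous_on_eq_continuous_at isContD open_ball)
    then have "((\<lambda>t. t * summand \<omega> t) \<longlongrightarrow> 0 * summand \<omega> 0) (at 0)" by (intro tendsto_intros)
    then show ?thesis by simp
  qed
  have fin: "finite ?\<Omega>" using finite_roots_of_unity n by blast
  have "((\<lambda>t. t * summand 1 t + (\<Sum>\<omega>\<in>?\<Omega> - {1}. t * summand \<omega> t)) \<longlongrightarrow> c + (\<Sum>\<omega>\<in>?\<Omega> - {1}. 0)) (at 0)"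
    by (intro tendsto_add tendsto_sum lim1 lim0)
  then have lim: "((\<lambda>t. t * summand 1 t + (\<Sum>\<omega>\<in>?\<Omega> - {1}. t * summand \<omega> t)) \<longlongrightarrow> c) (at 0)" by simp
  have "((\<lambda>t. (u + t - u) * fibre_sum n f P (u + t)) \<longlongrightarrow> c) (at 0)"
  proof (rule Lim_transform_eventually[OF lim])
    have "\<forall>\<^sub>F t in at (0::complex). t \<in> ball 0 r" using r by (intro eventually_at_in_open') auto
    then show "\<forall>\<^sub>F t in at 0. t * summand 1 t + (\<Sum>\<omega>\<in>?\<Omega> - {1}. t * summand \<omega> t)
      = (u + t - u) * fibre_sum n f P (u + t)"
    proof eventually_elim
      case (elim t)
      have "fibre_sum n f P (u + t) = (\<Sum>\<omega>\<in>?\<Omega>. summand \<omega> t)"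
        unfolding summand_def by (rule fibre_sum_branch[OF br elim n])
      also have "\<dots> = summand 1 t + (\<Sum>\<omega>\<in>?\<Omega> - {1}. summand \<omega> t)" using fin one by (rule sum.remove)
      finally show ?case by (simp add: sum_distrib_left distrib_left)
    qed
  qed
  then have "((\<lambda>v. (v - u) * fibre_sum n f P v) \<longlongrightarrow> c) (at u)"
    using LIM_offset_zero_cancel[of "\<lambda>v. (v - u) * fibre_sum n f P v" u c] by simp
  then show ?thesis using c by blast
qed

text \<open>The residue theorem for the product of a function with a pole only at one point and a
  holomorphic differential, in the form of Liouville's theorem for the trace to the projective line.\<close>

theorem gap_criterion:
  assumes br: "fermat_branch n u S r" and n: "n \<ge> 3" and P: "bipoly (n - 3) P" and k: "k \<ge> 1"
    and l: "((\<lambda>t. P (u + t) (S t) / t ^ (k - 1)) \<longlongrightarrow> l) (at 0)" "l \<noteq> 0"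
  shows "k \<in> gaps n (ppt (u, 1, S 0))"
proof (rule ccontr)
  let ?p = "ppt (u, 1, S 0)"
  assume "k \<notin> gaps n ?p"
  then obtain f where f: "\<And>q. q \<in> fermat n - {?p} \<Longrightarrow> holo_at n f q" and pole: "pole_order n f ?p k"
    using k unfolding gaps_def by blast
  have n1: "n \<ge> 1" using n by simp
  have r0: "(0::complex) \<in> ball 0 r" using br unfolding fermat_branch_def by simp
  have S0: "S 0 ^ n = - (1 + u ^ n)" "S 0 \<noteq> 0"
    using br r0 unfolding fermat_branch_def by force+
  have holo: "holo_at n f (ppt (v, 1, s))" if s: "s ^ n = - (1 + v ^ n)" "v \<noteq> u" for v s
  proof -
    have on: "on_fermat n (v, 1, s)" unfolding on_fermat_affine by (rule s)
    have "ppt (v, 1, s) \<noteq> ?p" using s(2) unfolding ppt_affine_eq_iff by simp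
    then show ?thesis using f ppt_in_fermat_iff[OF on_fermat_nonzero[OF on]] on by blast
  qed
  \<comment> \<open>The factor v - u cancels the only pole; what remains is removable at u and at
    the ramification points collected in Z.\<close>
  define E where "E = (\<lambda>v. (v - u) * fibre_sum n f P v)"
  define Z where "Z = {e :: complex. e ^ n = -1}"
  have uZ: "u \<notin> Z" using S0 n1 by (auto simp: Z_def power_0_left)
  have finZ: "finite Z"
    unfolding Z_def using n1 by (intro finite_nth_roots) auto
  define B where "B = insert u Z"
  have finB: "finite B" using finZ by (simp add: B_def)
  have opnB: "open (- B)" using finite_imp_closed[OF finB] by (rule open_Compl)
  have "fibre_sum n f P holomorphic_on - B"
  proof (rule fibre_sum_holomorphic[OF opnB _ n1 P])
    show "1 + v ^ n \<noteq> 0" if "v \<in> - B" for v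
      using that eq_neg_iff_add_eq_0[of "v ^ n" 1] by (simp add: B_def Z_def add.commute)
    show "holo_at n f (ppt (v, 1, s))" if "v \<in> - B" "s ^ n = - (1 + v ^ n)" for v s
      using holo[OF that(2)] that(1) by (auto simp: B_def)
  qed
  then have EB: "E holomorphic_on - B"
    unfolding E_def by (intro holomorphic_intros)
  obtain c where c: "c \<noteq> 0" "(E \<longlongrightarrow> c) (at u)"
    using fibre_sum_at_pole[OF br n1 P k f pole l] unfolding E_def by blast
  have "((\<lambda>z. (z - b) * E z) \<longlongrightarrow> 0) (at b)" if b: "b \<in> B" for b
  proof (cases "b = u")
    case True
    have "((\<lambda>z. (z - u) * E z) \<longlongrightarrow> (u - u) * c) (at u)" by (intro tendsto_intros c)
    then show ?thesis using True by simp
  next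
    case False
    then have bZ: "b ^ n = -1" using b by (simp add: B_def Z_def)
    define \<delta> where "\<delta> = dist b u / 2"
    have \<delta>: "\<delta> > 0" using False by (simp add: \<delta>_def)
    have "u \<notin> cball b \<delta>" using False by (simp add: \<delta>_def)
    then have "((\<lambda>z. (z - b) * fibre_sum n f P z) \<longlongrightarrow> 0) (at b)"
      using fibre_sum_at_branch_point[OF bZ n1 \<delta> P] holo by blast
    then have "((\<lambda>z. (z - u) * ((z - b) * fibre_sum n f P z)) \<longlongrightarrow> (b - u) * 0) (at b)"
      by (intro tendsto_intros)
    then show ?thesis by (simp add: E_def mult_ac)
  qed
  then obtain g where g: "g holomorphic_on UNIV" "\<And>z. z \<notin> B \<Longrightarrow> g z = E z"
    using holomorphic_extend_finite[OF finB EB] by blast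
  have "(g \<longlongrightarrow> 0) at_infinity"
  proof -
    \<comment> \<open>Coincidence of (1 : y : z) with the pole (u : 1 : \<open>S 0\<close>) would
      give u y = 1, impossible for |y| <= 1 / (|u| + 1).\<close>
    define \<delta> where "\<delta> = 1 / (norm u + 1)"
    have \<delta>: "\<delta> > 0" by (simp add: \<delta>_def add_nonneg_pos)
    have "holo_at n f (ppt (1, y, z))" if yz: "norm y \<le> \<delta>" "z ^ n = - (1 + y ^ n)" for y z
    proof -
      have on: "on_fermat n (1, y, z)"
        using yz(2) by (simp add: on_fermat_def)
      have "ppt (1, y, z) \<noteq> ?p"
      proof
        assume "ppt (1, y, z) = ?p"
        then obtain d where "d \<noteq> 0" "(u, 1, S 0) = smul3 d (1, y, z)"
          using ppt_eq_iff[OF on_fermat_nonzero[OF on]] by blast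
        then have "u * y = 1" by simp
        then have "norm u * norm y = 1" by (metis norm_mult norm_one)
        moreover have "norm u * norm y \<le> norm u * \<delta>" using yz(1) by (intro mult_left_mono) auto
        moreover have "norm u * \<delta> < 1" by (simp add: \<delta>_def divide_less_eq add_nonneg_pos)
        ultimately show False by simp
      qed
      then show ?thesis using f ppt_in_fermat_iff[OF on_fermat_nonzero[OF on]] on by blast
    qed
    from fibre_sum_at_infinity[OF n P \<delta> this] obtain K R
      where KR: "\<And>v. norm v \<ge> R \<Longrightarrow> norm (fibre_sum n f P v) \<le> K / (1 + norm v) ^ 2"
      by blast
    obtain R' where R': "\<And>b. b \<in> B \<Longrightarrow> norm b \<le> R'"
      using finite_imp_bounded[OF finB] unfolding bounded_iff by blast
    have "\<forall>\<^sub>F v in at_infinity. norm (g v) \<le> (1 + norm u) * \<bar>K\<bar> / (1 + norm v)"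
      unfolding eventually_at_infinity
    proof (intro exI[of _ "max R (R' + 1)"] allI impI)
      fix v :: complex assume v: "max R (R' + 1) \<le> norm v"
      then have "v \<notin> B" using R'[of v] by auto
      then have "norm (g v) = norm (v - u) * norm (fibre_sum n f P v)"
        using g(2) by (simp add: E_def norm_mult)
      also have "\<dots> \<le> ((1 + norm u) * (1 + norm v)) * (\<bar>K\<bar> / (1 + norm v) ^ 2)"
      proof (intro mult_mono)
        have "norm (v - u) \<le> norm v + norm u" by (rule norm_triangle_ineq4)
        also have "\<dots> \<le> (1 + norm u) * (1 + norm v)" by (simp add: algebra_simps)
        finally show "norm (v - u) \<le> (1 + norm u) * (1 + norm v)" .
        have "norm (fibre_sum n f P v) \<le> K / (1 + norm v) ^ 2" using KR v by simp
        also have "\<dots> \<le> \<bar>K\<bar> / (1 + norm v) ^ 2" by (intro divide_right_mono) auto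
        finally show "norm (fibre_sum n f P v) \<le> \<bar>K\<bar> / (1 + norm v) ^ 2" .
      qed auto
      also have "\<dots> = (1 + norm u) * \<bar>K\<bar> / (1 + norm v)"
      proof -
        have "1 + norm v \<noteq> 0" by (smt (verit) norm_ge_zero)
        then show ?thesis by (simp add: power2_eq_square)
      qed
      finally show "norm (g v) \<le> (1 + norm u) * \<bar>K\<bar> / (1 + norm v)" .
    qed
    moreover have "((\<lambda>v. (1 + norm u) * \<bar>K\<bar> / (1 + norm v)) \<longlongrightarrow> 0) at_infinity"
      by (intro real_tendsto_divide_at_top[OF tendsto_const] filterlim_tendsto_add_at_top[OF tendsto_const]
        filterlim_norm_at_top)
    ultimately show ?thesis by (rule Lim_null_comparison)
  qed
  then have g0: "g z = 0" for z using Liouville_weak_0[OF g(1)] by blast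
  \<comment> \<open>E vanishes on a punctured neighbourhood of u by Liouville, yet its limit there
    is the nonzero residue c.\<close>
  have "((\<lambda>_. 0) \<longlongrightarrow> c) (at u)"
  proof (rule Lim_transform_eventually[OF c(2)])
    have "open (- Z)" using finite_imp_closed[OF finZ] by (rule open_Compl)
    then have "\<forall>\<^sub>F z in at u. z \<in> - Z - {u}" using uZ by (intro eventually_at_in_open) auto
    then show "\<forall>\<^sub>F z in at u. E z = 0"
      by eventually_elim (use g(2) g0 in \<open>auto simp: B_def\<close>)
  qed
  then show False using c(1) tendsto_unique[of "at u" "\<lambda>_. 0" 0 c] by auto
qed


subsection \<open>Counting gaps\<close>

text \<open>Iterating the difference quotient at 0 yields exact remainders that are holomorphic on
  the same ball for every m, with coefficients independent of m and without convergence
  questions.\<close>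

lemma holomorphic_taylor_remainders:
  fixes g :: "complex \<Rightarrow> complex"
  assumes "g holomorphic_on ball 0 r" "r > 0"
  shows "\<exists>c R. \<forall>m. R m holomorphic_on ball 0 r \<and> R m 0 = c m \<and>
    (\<forall>t\<in>ball 0 r. g t = (\<Sum>j<m. c j * t ^ j) + t ^ m * R m t)"
proof -
  define D where "D = (\<lambda>g :: complex \<Rightarrow> complex. \<lambda>t. if t = 0 then deriv g 0 else (g t - g 0) / t)"
  have D: "g t = g 0 + t * D g t" for g t by (simp add: D_def)
  have hol: "(D ^^ m) g holomorphic_on ball 0 r" for m
    by (induction m) (use assms in \<open>auto simp: D_def intro: holomorphic_slope\<close>)
  have "g t = (\<Sum>j<m. (D ^^ j) g 0 * t ^ j) + t ^ m * (D ^^ m) g t" for m t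
  proof (induction m)
    case (Suc m)
    have "(D ^^ m) g t = (D ^^ m) g 0 + t * (D ^^ Suc m) g t"
      using D[of "(D ^^ m) g" t] by simp
    then show ?case using Suc.IH by (simp add: algebra_simps)
  qed simp
  then show ?thesis using hol by (intro exI[of _ "\<lambda>j. (D ^^ j) g 0"] exI[of _ "\<lambda>m. (D ^^ m) g"]) blast
qed

text \<open>Gaussian elimination, one equation per induction step: a pivot variable is eliminated
  from the other rows and recovered at the end by back substitution.\<close>

lemma homogeneous_system_solution:
  fixes a :: "'e \<Rightarrow> 'i \<Rightarrow> 'a :: field"
  assumes "finite E" "finite I" "card E < card I"
  shows "\<exists>x. (\<exists>i\<in>I. x i \<noteq> 0) \<and> (\<forall>e\<in>E. (\<Sum>i\<in>I. x i * a e i) = 0)"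
  using assms
proof (induction E arbitrary: I a rule: finite_induct)
  case empty
  then show ?case by (intro exI[of _ "\<lambda>_. 1"]) (auto simp: card_gt_0_iff)
next
  case (insert e E)
  have cE: "card E < card I" using insert.prems insert.hyps by simp
  show ?case
  proof (cases "\<forall>i\<in>I. a e i = 0")
    case True
    obtain x where "\<exists>i\<in>I. x i \<noteq> 0" "\<forall>e\<in>E. (\<Sum>i\<in>I. x i * a e i) = 0"
      using insert.IH[OF insert.prems(1) cE, of a] by blast
    then show ?thesis using True by (intro exI[of _ x]) auto
  next
    case False
    then obtain k where k: "k \<in> I" "a e k \<noteq> 0" by blast
    define J where "J = I - {k}"
    have J: "finite J" "card E < card J" "k \<notin> J" "I = insert k J"
      using insert.prems insert.hyps k(1) by (auto simp: J_def)
    \<comment> \<open>Each remaining row minus the multiple of row e that clears its entry in the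
      pivot column k.\<close>
    define b where "b = (\<lambda>e' i. a e' i - a e' k * a e i / a e k)"
    obtain y where y: "\<exists>i\<in>J. y i \<noteq> 0" "\<And>e'. e' \<in> E \<Longrightarrow> (\<Sum>i\<in>J. y i * b e' i) = 0"
      using insert.IH[OF J(1,2), of b] by blast
    define w where "w = - (\<Sum>i\<in>J. y i * a e i) / a e k"
    define x where "x = y(k := w)"
    have sum: "(\<Sum>i\<in>I. x i * a e' i) = w * a e' k + (\<Sum>i\<in>J. y i * a e' i)" for e'
    proof -
      have "(\<Sum>i\<in>J. x i * a e' i) = (\<Sum>i\<in>J. y i * a e' i)"
        using J(3) by (intro sum.cong) (auto simp: x_def)
      then show ?thesis using J by (simp add: x_def)
    qed
    have "(\<Sum>i\<in>I. x i * a e' i) = 0" if "e' \<in> insert e E" for e'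
    proof (cases "e' = e")
      case True
      then show ?thesis using k(2) sum[of e] by (simp add: w_def)
    next
      case False
      then have "(\<Sum>i\<in>J. y i * b e' i) = 0" using that y(2) by blast
      also have "(\<Sum>i\<in>J. y i * b e' i) = (\<Sum>i\<in>J. y i * a e' i) - (\<Sum>i\<in>J. y i * a e i) * (a e' k / a e k)"
      proof -
        have "y i * b e' i = y i * a e' i - y i * a e i * (a e' k / a e k)" for i
          by (simp add: b_def algebra_simps)
        then show ?thesis by (simp only: sum_subtractf sum_distrib_right)
      qed
      finally show ?thesis using sum[of e'] by (simp add: w_def)
    qed
    moreover have "\<exists>i\<in>I. x i \<noteq> 0" using y(1) J(3,4) by (auto simp: x_def)
    ultimately show ?thesis by blast
  qed
qed

text \<open>Functions on the curve take lines as arguments. This turns a formula in homogeneous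
  coordinates that is invariant under scaling into such a function.\<close>

definition point_rep :: "c3 set \<Rightarrow> c3" where
  "point_rep L = (SOME v. v \<noteq> (0,0,0) \<and> ppt v = L)"

lemma point_rep_ppt:
  assumes F: "\<And>c v. c \<noteq> 0 \<Longrightarrow> F (smul3 c v) = F v" and v: "v \<noteq> (0,0,0)"
  shows "F (point_rep (ppt v)) = F v"
proof -
  have "point_rep (ppt v) \<noteq> (0,0,0) \<and> ppt (point_rep (ppt v)) = ppt v"
    unfolding point_rep_def by (rule someI[of _ v]) (use v in simp)
  then obtain c where "c \<noteq> 0" "point_rep (ppt v) = smul3 c v"
    using ppt_eq_iff[OF v] by metis
  then show ?thesis using F by simp
qed

text \<open>Exponents of the holomorphic differentials u^i s^j du / s^(n-1); for n >= 3 there are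
  (n-1)(n-2)/2 of them, the genus.\<close>

definition gap_indices :: "nat \<Rightarrow> (nat \<times> nat) set" where
  "gap_indices n = {(i, j). i + j \<le> n - 3}"

lemma finite_gap_indices: "finite (gap_indices n)"
  by (rule finite_subset[of _ "{..n - 3} \<times> {..n - 3}"]) (auto simp: gap_indices_def)

text \<open>For functions whose denominator is a power of a linear form: if the form is nonzero on
  one spanning vector of q, it is nonzero along a whole chart near q. It is applied to x - u y and
  to the tangent form at a flex.\<close>

lemma holo_at_quotient:
  assumes q: "q \<in> fermat n" and n: "n \<ge> 1" and v: "ppt v = q" and F: "\<And>w. f (ppt w) = F w \<or> \<not> on_fermat n w"
    and ab: "a * fst v + b * fst (snd v) + c * snd (snd v) \<noteq> 0"
    and hol: "\<And>\<phi> D. open D \<Longrightarrow> holo3 \<phi> D \<Longrightarrow>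
      (\<And>t. t \<in> D \<Longrightarrow> a * fst (\<phi> t) + b * fst (snd (\<phi> t)) + c * snd (snd (\<phi> t)) \<noteq> 0) \<Longrightarrow>
      (\<lambda>t. F (\<phi> t)) holomorphic_on D"
  shows "holo_at n f q"
proof -
  obtain \<phi> r where ch: "fchart n q \<phi> r" using fchart_exists[OF q n] by blast
  then have r: "r > 0" and h: "holo3 \<phi> (ball 0 r)" and on: "\<And>t. t \<in> ball 0 r \<Longrightarrow> on_fermat n (\<phi> t)"
    and p0: "ppt (\<phi> 0) = q"
    unfolding fchart_def by blast+
  let ?L = "\<lambda>t. a * fst (\<phi> t) + b * fst (snd (\<phi> t)) + c * snd (snd (\<phi> t))"
  have on0: "on_fermat n (\<phi> 0)" using on r by simp
  obtain d where d: "d \<noteq> 0" "v = smul3 d (\<phi> 0)"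
    using v p0 ppt_eq_iff[OF on_fermat_nonzero[OF on0]] by metis
  then have "d * ?L 0 \<noteq> 0" using ab by (simp add: smul3_def algebra_simps)
  then have L0: "?L 0 \<in> - {0}" by simp
  have "?L holomorphic_on ball 0 r" using h unfolding holo3_def by (intro holomorphic_intros) auto
  then have cont: "continuous_on (ball 0 r) ?L" by (rule holomorphic_on_imp_continuous_on)
  have "\<exists>e>0. ball 0 e \<subseteq> ball (0::complex) r \<and> ?L ` ball 0 e \<subseteq> - {0}"
    by (rule small_ball_in_open_vimage[OF cont open_ball _ _ L0]) (use r in auto)
  then obtain e where e: "e > 0" "ball 0 e \<subseteq> ball (0::complex) r" "?L ` ball 0 e \<subseteq> - {0}" by blast
  have he: "holo3 \<phi> (ball 0 e)" by (rule holo3_subset[OF h e(2)])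
  have "(\<lambda>t. F (\<phi> t)) holomorphic_on ball 0 e"
    by (rule hol[OF open_ball he]) (use e(3) in blast)
  then have "(\<lambda>t. f (ppt (\<phi> t))) holomorphic_on ball 0 e"
  proof (rule holomorphic_transform)
    show "F (\<phi> t) = f (ppt (\<phi> t))" if "t \<in> ball 0 e" for t
      using F[of "\<phi> t"] on[OF subsetD[OF e(2) that]] by simp
  qed
  moreover have "fchart n q \<phi> e"
    using ch e(1,2) he unfolding fchart_def by blast
  ultimately show ?thesis unfolding holo_at_def by blast
qed

text \<open>Orthogonality of characters; it confines the poles to a single sheet.\<close>

lemma root_of_unity_sum:
  assumes "\<omega> \<in> roots_of_unity n"
  shows "(\<Sum>k<n. \<omega> ^ k) = (if \<omega> = 1 then of_nat n else 0)"
proof (cases "\<omega> = 1")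
  case False
  then show ?thesis
    using assms geometric_sum[of \<omega> n] by (simp add: roots_of_unity_def)
qed simp

text \<open>The sum of the \<open>x m / t^m\<close> is the principal part of a function
  \<open>\<Sum> \<gamma> k l * z^k * y^(l - k) / (x - u y)^l\<close> without other poles as soon as it is orthogonal, for
  the residue pairing, to the differentials \<open>t^i S^(- (i + j + 2)) dt\<close> with \<open>i + j \<le> n - 3\<close>.\<close>

lemma nongap_in_large_set:
  assumes br: "fermat_branch n u S r" and n: "n \<ge> 3"
    and K: "finite K" "0 \<notin> K" "card (gap_indices n) < card K"
  shows "\<exists>m\<in>K. m \<notin> gaps n (ppt (u, 1, S 0))"
proof -
  let ?p = "ppt (u, 1, S 0)"
  have n1: "n \<ge> 1" using n by simp
  have r: "r > 0" and S: "S holomorphic_on ball 0 r" "\<And>t. t \<in> ball 0 r \<Longrightarrow> S t \<noteq> 0"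
    using br unfolding fermat_branch_def by blast+
  have r0: "(0::complex) \<in> ball 0 r" using r by simp
  have "\<exists>c R. \<forall>m. R m holomorphic_on ball 0 r \<and> R m 0 = c m \<and>
     (\<forall>t\<in>ball 0 r. inverse (S t) ^ k = (\<Sum>j<m. c j * t ^ j) + t ^ m * R m t)" for k
    by (rule holomorphic_taylor_remainders[OF _ r]) (use S in \<open>auto intro!: holomorphic_intros\<close>)
  then obtain c R where R: "\<And>k m. R k m holomorphic_on ball 0 r"
    and c: "\<And>k m t. t \<in> ball 0 r \<Longrightarrow> inverse (S t) ^ k = (\<Sum>j<m. c k j * t ^ j) + t ^ m * R k m t"
    by metis
  \<comment> \<open>The entry is the residue of t^(-m) t^i S^(-(i+j+2)) dt, that is the coefficient
    of t^(m-1-i) in S^(-(i+j+2)).\<close>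
  define a where "a = (\<lambda>(i, j) m. if i + 1 \<le> m then c (i + j + 2) (m - (i + 1)) else 0)"
  obtain x where x: "\<exists>m\<in>K. x m \<noteq> 0" "\<And>e. e \<in> gap_indices n \<Longrightarrow> (\<Sum>m\<in>K. x m * a e m) = 0"
    using homogeneous_system_solution[OF finite_gap_indices K(1,3), of a] by blast
  define K' where "K' = {m \<in> K. x m \<noteq> 0}"
  have K': "finite K'" "K' \<noteq> {}" "K' \<subseteq> K" using x(1) K(1) by (auto simp: K'_def)
  \<comment> \<open>The largest exponent that actually occurs in the principal part; it will be the
    pole order.\<close>
  define M where "M = Max K'"
  have M: "M \<in> K'" "\<And>m. m \<in> K' \<Longrightarrow> m \<le> M" using K' by (auto simp: M_def)
  have M1: "M \<ge> 1" "x M \<noteq> 0" using M(1) K(2) by (auto simp: K'_def intro: Suc_leI gr0I)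
  \<comment> \<open>The coefficient of t^(-l) in (sum of \<open>x m / t ^ m\<close>) times
    S^(-k).\<close>
  define \<gamma> where "\<gamma> = (\<lambda>k l. \<Sum>m\<in>K'. if l \<le> m then x m * c k (m - l) else 0)"
  \<comment> \<open>A term with l < k would need a negative power of y. Its coefficient is the
    residue pairing for i = l - 1 and j = k - l - 1, where i + j = k - 2 <= n - 3, so it
    vanishes.\<close>
  have \<gamma>0: "\<gamma> k l = 0" if "1 \<le> l" "l < k" "k < n" for k l
  proof -
    have "(l - 1, k - l - 1) \<in> gap_indices n" using that by (simp add: gap_indices_def)
    then have "0 = (\<Sum>m\<in>K. x m * a (l - 1, k - l - 1) m)" using x(2) by simp
    also have "\<dots> = (\<Sum>m\<in>K'. x m * a (l - 1, k - l - 1) m)"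
      using K(1) by (intro sum.mono_neutral_right) (auto simp: K'_def)
    also have "\<dots> = \<gamma> k l"
    proof -
      have "Suc (Suc (k - 2)) = k" using that by simp
      then show ?thesis unfolding \<gamma>_def a_def using that by (intro sum.cong) auto
    qed
    finally show ?thesis by simp
  qed
  \<comment> \<open>Thus the sum over l is the principal part of the product with S^(-k); no term is
    lost by starting at l = k.\<close>
  have key: "(\<Sum>l\<in>{max 1 k..M}. \<gamma> k l / t ^ l) =
      (\<Sum>m\<in>K'. x m / t ^ m) * inverse (S t) ^ k - (\<Sum>m\<in>K'. x m * R k m t)"
    if k: "k < n" and t: "t \<in> ball 0 r" "t \<noteq> 0" for k t
  proof -
    have "(\<Sum>l\<in>{max 1 k..M}. \<gamma> k l / t ^ l) = (\<Sum>l\<in>{1..M}. \<gamma> k l / t ^ l)"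
      by (rule sum.mono_neutral_left) (use \<gamma>0 k in auto)
    also have "\<dots> = (\<Sum>l\<in>{1..M}. \<Sum>m\<in>K'. if l \<le> m then x m * c k (m - l) / t ^ l else 0)"
      unfolding \<gamma>_def sum_divide_distrib by (intro sum.cong) auto
    also have "\<dots> = (\<Sum>m\<in>K'. \<Sum>l\<in>{1..M}. if l \<le> m then x m * c k (m - l) / t ^ l else 0)"
      by (rule sum.swap)
    also have "\<dots> = (\<Sum>m\<in>K'. x m / t ^ m * inverse (S t) ^ k - x m * R k m t)"
    proof (rule sum.cong[OF refl])
      fix m assume m: "m \<in> K'"
      have "(\<Sum>l\<in>{1..M}. if l \<le> m then x m * c k (m - l) / t ^ l else 0)
          = (\<Sum>l\<in>{1..m}. x m * c k (m - l) / t ^ l)"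
        using M(2)[OF m] by (intro sum.mono_neutral_cong_right) auto
      also have "\<dots> = (\<Sum>j<m. x m * c k j / t ^ (m - j))"
        by (rule sum.reindex_bij_witness[of _ "\<lambda>j. m - j" "\<lambda>l. m - l"]) auto
      also have "\<dots> = x m / t ^ m * (\<Sum>j<m. c k j * t ^ j)"
        unfolding sum_distrib_left using t(2) by (intro sum.cong) (auto simp: power_diff)
      also have "(\<Sum>j<m. c k j * t ^ j) = inverse (S t) ^ k - t ^ m * R k m t"
        using c[OF t(1), of k m] by simp
      finally show "(\<Sum>l\<in>{1..M}. if l \<le> m then x m * c k (m - l) / t ^ l else 0)
          = x m / t ^ m * inverse (S t) ^ k - x m * R k m t"
        using t(2) by (simp add: right_diff_distrib)
    qed
    finally show ?thesis by (simp add: sum_subtractf sum_distrib_right)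
  qed
  \<comment> \<open>the second branch is the value at the removable singularities on the line \<open>x = u y\<close>\<close>
  define F where "F = (\<lambda>v :: c3. if fst v \<noteq> u * fst (snd v)
     then (\<Sum>k<n. \<Sum>l\<in>{max 1 k..M}. \<gamma> k l * (snd (snd v) ^ k * fst (snd v) ^ (l - k))
            / (fst v - u * fst (snd v)) ^ l)
     else - (\<Sum>k<n. (snd (snd v) / fst (snd v)) ^ k * (\<Sum>m\<in>K'. x m * R k m 0)))"
  have Fhom: "F (smul3 d v) = F v" if "d \<noteq> 0" for d v
  proof (cases "fst v = u * fst (snd v)")
    case True
    then show ?thesis using that by (simp add: F_def smul3_def)
  next
    case False
    have "(d * z) ^ k * (d * y) ^ (l - k) / (d * w) ^ l = z ^ k * y ^ (l - k) / w ^ l"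
      if "k \<le> l" for k l y z w
    proof -
      have "d ^ l = d ^ k * d ^ (l - k)" using that by (simp flip: power_add)
      then show ?thesis using \<open>d \<noteq> 0\<close> by (simp add: power_mult_distrib)
    qed
    then have *: "\<gamma> k l * ((d * z) ^ k * (d * y) ^ (l - k)) / (d * w) ^ l = \<gamma> k l * (z ^ k * y ^ (l - k)) / w ^ l"
      if "k \<le> l" for k l y z w
      using that by (simp only: times_divide_eq_right[symmetric])
    have "d * fst v - u * (d * fst (snd v)) = d * (fst v - u * fst (snd v))" by (simp add: algebra_simps)
    then show ?thesis
      using False that unfolding F_def smul3_def by (simp add: * del: power_mult_distrib) 
  qed
  define f where "f = (\<lambda>L. F (point_rep L))"
  have fF: "f (ppt v) = F v" if "on_fermat n v" for v
    unfolding f_def by (rule point_rep_ppt[OF Fhom on_fermat_nonzero[OF that]])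
  \<comment> \<open>Multiplying by (\<omega> S)^k undoes S^(-k) and leaves \<omega>^k times the same
    principal part for each k. Summed over k it is multiplied by n on the sheet \<omega> = 1 and
    cancels on all others.\<close>
  have along: "f (ppt (u + t, 1, \<omega> * S t)) = (\<Sum>k<n. \<omega> ^ k) * (\<Sum>m\<in>K'. x m / t ^ m)
      - (\<Sum>k<n. (\<omega> * S t) ^ k * (\<Sum>m\<in>K'. x m * R k m t))"
    if \<omega>: "\<omega> \<in> roots_of_unity n" and t: "t \<in> ball 0 r" "t \<noteq> 0" for \<omega> t
  proof -
    have "on_fermat n (u + t, 1, \<omega> * S t)"
      using fermat_branch_on_fermat[OF fermat_branch_rotate[OF br \<omega> n1] t(1)] .
    then have "f (ppt (u + t, 1, \<omega> * S t)) = (\<Sum>k<n. \<Sum>l\<in>{max 1 k..M}. \<gamma> k l * (\<omega> * S t) ^ k / t ^ l)"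
      using t(2) by (simp add: fF F_def)
    also have "\<dots> = (\<Sum>k<n. (\<omega> * S t) ^ k * (\<Sum>l\<in>{max 1 k..M}. \<gamma> k l / t ^ l))"
      by (simp add: sum_distrib_left mult.commute)
    also have "\<dots> = (\<Sum>k<n. \<omega> ^ k * (\<Sum>m\<in>K'. x m / t ^ m) - (\<omega> * S t) ^ k * (\<Sum>m\<in>K'. x m * R k m t))"
    proof (rule sum.cong[OF refl])
      fix k assume "k \<in> {..<n}"
      then have "(\<Sum>l\<in>{max 1 k..M}. \<gamma> k l / t ^ l) =
          (\<Sum>m\<in>K'. x m / t ^ m) * inverse (S t) ^ k - (\<Sum>m\<in>K'. x m * R k m t)"
        using key t by simp
      moreover have "(\<omega> * S t) ^ k * inverse (S t) ^ k = \<omega> ^ k"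
        using S(2)[OF t(1)] by (simp add: power_mult_distrib flip: power_mult_distrib[of "S t" "inverse (S t)"])
      ultimately show "(\<omega> * S t) ^ k * (\<Sum>l\<in>{max 1 k..M}. \<gamma> k l / t ^ l)
        = \<omega> ^ k * (\<Sum>m\<in>K'. x m / t ^ m) - (\<omega> * S t) ^ k * (\<Sum>m\<in>K'. x m * R k m t)"
        by (simp add: right_diff_distrib)
    qed
    finally show ?thesis by (simp add: sum_subtractf sum_distrib_right)
  qed
  have "holo_at n f q" if q: "q \<in> fermat n - {?p}" for q
  proof -
    obtain v where v: "q = ppt v" "on_fermat n v" using fermatE q by blast
    show ?thesis
    proof (cases "fst v = u * fst (snd v)")
      case False
      show ?thesis
      proof (rule holo_at_quotient[where v = v and F = F and a = 1 and b = "- u" and c = 0])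
        fix \<phi> D
        assume D: "holo3 \<phi> D" "\<And>t. t \<in> D \<Longrightarrow> 1 * fst (\<phi> t) + - u * fst (snd (\<phi> t)) + 0 * snd (snd (\<phi> t)) \<noteq> 0"
        have nz: "fst (\<phi> t) - u * fst (snd (\<phi> t)) \<noteq> 0" if "t \<in> D" for t using D(2)[OF that] by simp
        show "(\<lambda>t. F (\<phi> t)) holomorphic_on D"
        proof (rule holomorphic_transform)
          show "(\<lambda>t. \<Sum>k<n. \<Sum>l\<in>{max 1 k..M}. \<gamma> k l * (snd (snd (\<phi> t)) ^ k * fst (snd (\<phi> t)) ^ (l - k))
            / (fst (\<phi> t) - u * fst (snd (\<phi> t))) ^ l) holomorphic_on D"
            using D(1) nz unfolding holo3_def by (intro holomorphic_intros) auto
          show "(\<Sum>k<n. \<Sum>l\<in>{max 1 k..M}. \<gamma> k l * (snd (snd (\<phi> t)) ^ k * fst (snd (\<phi> t)) ^ (l - k))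
            / (fst (\<phi> t) - u * fst (snd (\<phi> t))) ^ l) = F (\<phi> t)" if "t \<in> D" for t
            using nz[OF that] by (simp add: F_def)
        qed
      qed (use q n1 v False fF in auto)
    next
      case True
      obtain y z where yz: "v = (u * y, y, z)" using True by (cases v) auto
      have eq: "(u * y) ^ n + y ^ n + z ^ n = 0" using v(2) by (simp add: yz on_fermat_def)
      have y: "y \<noteq> 0"
      proof
        assume "y = 0"
        then have "z = 0" using eq n1 by (simp add: power_0_left)
        then show False using v(2) \<open>y = 0\<close> yz by (simp add: on_fermat_def)
      qed
      \<comment> \<open>Identifies the sheet of another point over the same u; the formula along
        that branch has no principal part.\<close>
      define \<omega> where "\<omega> = z / y / S 0"
      have "smul3 (1 / y) v = (u, 1, \<omega> * S 0)" using y S(2)[OF r0] by (simp add: yz \<omega>_def)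
      then have q': "q = ppt (u, 1, \<omega> * S 0)"
        using ppt_smul3[of "1 / y" v] y on_fermat_nonzero[OF v(2)] v(1) by simp
      have "on_fermat n (u, 1, \<omega> * S 0)"
        using q q' ppt_in_fermat_iff[of "(u, 1, \<omega> * S 0)"] by simp
      then have "(\<omega> * S 0) ^ n = - (1 + u ^ n)" by (simp only: on_fermat_affine)
      moreover have "S 0 ^ n = - (1 + u ^ n)" using br r0 unfolding fermat_branch_def by force
      ultimately have "\<omega> ^ n * S 0 ^ n = S 0 ^ n" by (simp add: power_mult_distrib)
      then have \<omega>: "\<omega> \<in> roots_of_unity n" using S(2)[OF r0] by (simp add: roots_of_unity_def)
      have \<omega>1: "\<omega> \<noteq> 1" using q q' by auto
      have br\<omega>: "fermat_branch n u (\<lambda>t. \<omega> * S t) r" by (rule fermat_branch_rotate[OF br \<omega> n1])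
      have "(\<lambda>t. f (ppt (u + t, 1, \<omega> * S t))) holomorphic_on ball 0 r"
      proof (rule holomorphic_transform)
        show "(\<lambda>t. - (\<Sum>k<n. (\<omega> * S t) ^ k * (\<Sum>m\<in>K'. x m * R k m t))) holomorphic_on ball 0 r"
          by (intro holomorphic_intros S R)
        show "- (\<Sum>k<n. (\<omega> * S t) ^ k * (\<Sum>m\<in>K'. x m * R k m t)) = f (ppt (u + t, 1, \<omega> * S t))"
          if t: "t \<in> ball 0 r" for t
        proof (cases "t = 0")
          case True
          then show ?thesis using fF[OF \<open>on_fermat n (u, 1, \<omega> * S 0)\<close>] by (simp add: F_def)
        next
          case False
          then show ?thesis using along[OF \<omega> t] root_of_unity_sum[OF \<omega>] \<omega>1 by simp
        qed
      qed
      then show ?thesis unfolding holo_at_def using fchart_affine[OF br\<omega>] q' by metis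
    qed
  qed
  moreover have "pole_order n f ?p M"
  proof -
    have one: "1 \<in> roots_of_unity n" by (simp add: roots_of_unity_def)
    \<comment> \<open>The expression on the sheet \<omega> = 1 multiplied by t^M. At 0 only the top
      term survives, with value n times \<open>x M\<close>.\<close>
    define h where "h = (\<lambda>t. of_nat n * (\<Sum>m\<in>K'. x m * t ^ (M - m))
      - t ^ M * (\<Sum>k<n. S t ^ k * (\<Sum>m\<in>K'. x m * R k m t)))"
    have "h holomorphic_on ball 0 r" unfolding h_def by (intro holomorphic_intros S R)
    moreover have "h 0 \<noteq> 0"
    proof -
      have "(\<Sum>m\<in>K'. x m * 0 ^ (M - m)) = (\<Sum>m\<in>K'. if m = M then x m else 0)"
      proof (rule sum.cong[OF refl])
        show "x m * 0 ^ (M - m) = (if m = M then x m else 0)" if "m \<in> K'" for m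
          using M(2)[OF that] by (cases "m = M") (auto simp: power_0_left)
      qed
      also have "\<dots> = x M" using K'(1) M(1) by simp
      finally show ?thesis using M1 n by (simp add: h_def power_0_left)
    qed
    moreover have "f (ppt (u + t, 1, S t)) = h t / t ^ M" if t: "t \<in> ball 0 r - {0}" for t
    proof -
      have "(\<Sum>m\<in>K'. x m * t ^ (M - m)) = t ^ M * (\<Sum>m\<in>K'. x m / t ^ m)"
        unfolding sum_distrib_left using M(2) t by (intro sum.cong) (auto simp: power_diff)
      then have "h t = t ^ M * (of_nat n * (\<Sum>m\<in>K'. x m / t ^ m)
          - (\<Sum>k<n. S t ^ k * (\<Sum>m\<in>K'. x m * R k m t)))"
        by (simp add: h_def right_diff_distrib)
      then show ?thesis using along[OF one, of t] t by simp
    qed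
    ultimately show ?thesis unfolding pole_order_def using fchart_affine[OF br] by blast
  qed
  ultimately have "M \<notin> gaps n ?p" unfolding gaps_def by blast
  then show ?thesis using M(1) K'(3) by blast
qed

text \<open>A set of more than g positive integers always contains a nongap, which excludes both
  infinitely many gaps and more than g of them.\<close>

lemma card_gaps:
  assumes "fermat_branch n u S r" "n \<ge> 3"
  shows "finite (gaps n (ppt (u, 1, S 0)))" "card (gaps n (ppt (u, 1, S 0))) \<le> card (gap_indices n)"
proof -
  let ?G = "gaps n (ppt (u, 1, S 0))"
  have le: "card K \<le> card (gap_indices n)" if "K \<subseteq> ?G" "finite K" for K
  proof (rule ccontr)
    assume "\<not> card K \<le> card (gap_indices n)"
    moreover have "0 \<notin> K" using that(1) by (auto simp: gaps_def)
    ultimately show False using nongap_in_large_set[OF assms that(2)] that(1) by auto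
  qed
  show fin: "finite ?G"
  proof (rule ccontr)
    assume "infinite ?G"
    then obtain K where "K \<subseteq> ?G" "finite K" "card K = Suc (card (gap_indices n))"
      using infinite_arbitrarily_large by blast
    then show False using le[of K] by simp
  qed
  show "card ?G \<le> card (gap_indices n)" using le fin by blast
qed


subsection \<open>Low order contact\<close>

text \<open>Among sets of g positive integers the interval {1..g} alone has minimal sum: every
  element outside it is at least g + 1 and replaces one that is at most g. Here g is the number of
  gaps itself.\<close>

lemma weight_zero_imp_interval:
  assumes fin: "finite (gaps n p)" and w: "weight n p = 0"
  shows "gaps n p = {1..card (gaps n p)}"
proof -
  define G where "G = gaps n p"
  define I where "I = {1..card G}"
  have G: "finite G" "0 \<notin> G" using fin by (auto simp: G_def gaps_def)
  have cI: "finite I" "card I = card G" by (simp_all add: I_def)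
  have "\<Sum>G = \<Sum>I" using w unfolding weight_def G_def I_def by linarith
  moreover have "\<Sum>G = \<Sum>(G \<inter> I) + \<Sum>(G - I)" "\<Sum>I = \<Sum>(I \<inter> G) + \<Sum>(I - G)"
    using G(1) cI(1) by (simp_all add: sum.Int_Diff)
  ultimately have sums: "\<Sum>(G - I) = \<Sum>(I - G)" by (simp add: Int_commute)
  have cards: "card (G - I) = card (I - G)"
    using G(1) cI card_Diff_subset_Int[of G I] card_Diff_subset_Int[of I G] by (simp add: Int_commute)
  have "Suc (card G) \<le> i" if "i \<in> G - I" for i
  proof -
    have "i \<noteq> 0" using that G(2) by (metis DiffD1)
    then show ?thesis using that by (auto simp: I_def)
  qed
  then have "Suc (card G) * card (G - I) \<le> \<Sum>(G - I)"
    using sum_bounded_below[of "G - I" "Suc (card G)" "\<lambda>i. i"] by (simp add: mult.commute)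
  moreover have "i \<le> card G" if "i \<in> I - G" for i using that by (simp add: I_def)
  then have "\<Sum>(I - G) \<le> card (I - G) * card G"
    using sum_bounded_above[of "I - G" "\<lambda>i. i" "card G"] by simp
  ultimately have "Suc (card G) * card (G - I) \<le> card G * card (G - I)"
    using sums cards by (simp add: mult.commute)
  then have "card (G - I) = 0" by simp
  then have "G - I = {}" using G(1) by simp
  then have "G \<subseteq> I" by blast
  then have "G = I" using card_subset_eq[OF cI(1)] cI(2) by simp
  then show ?thesis unfolding G_def I_def .
qed

text \<open>The quotient (x^n - a^n) / (x - a), written as a polynomial so that it also makes sense
  at x = a.\<close>

definition power_slope :: "nat \<Rightarrow> complex \<Rightarrow> complex \<Rightarrow> complex" where
  "power_slope n a x = (\<Sum>i<n. x ^ i * a ^ (n - Suc i))"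

lemma power_slope: "x ^ n - a ^ n = (x - a) * power_slope n a x"
  unfolding power_slope_def by (subst power_diff_sumr2) (simp add: mult.commute)

lemma power_slope_same: "power_slope n a a = of_nat n * a ^ (n - 1)"
proof -
  have "power_slope n a a = (\<Sum>i<n. a ^ (n - 1))"
    unfolding power_slope_def by (intro sum.cong) (auto simp flip: power_add)
  then show ?thesis by simp
qed

text \<open>The sum is n choose 2, so this is half the second derivative of x^n; it provides the
  curvature term for tangent lines.\<close>

lemma power_slope_derivative:
  "((power_slope n a) has_field_derivative of_nat (\<Sum>i<n. i) * a ^ (n - 2)) (at a)"
proof -
  have "((\<lambda>x. \<Sum>i<n. x ^ i * a ^ (n - Suc i)) has_field_derivative
      (\<Sum>i<n. of_nat i * a ^ (i - 1) * a ^ (n - Suc i))) (at a)"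
    by (auto intro!: derivative_eq_intros)
  moreover have "(\<Sum>i<n. of_nat i * a ^ (i - 1) * a ^ (n - Suc i)) = (\<Sum>i<n. of_nat i * a ^ (n - 2))"
  proof (rule sum.cong[OF refl])
    fix i assume "i \<in> {..<n}"
    then show "of_nat i * a ^ (i - 1) * a ^ (n - Suc i) = of_nat i * a ^ (n - 2)"
      by (cases i) (simp_all add: mult.assoc flip: power_add)
  qed
  ultimately show ?thesis by (simp add: power_slope_def[abs_def] sum_distrib_right)
qed

lemma fermat_branch_slope_eq:
  assumes "fermat_branch n u S r" "t \<in> ball 0 r"
  shows "t * power_slope n u (u + t) + (S t - S 0) * power_slope n (S 0) (S t) = 0"
proof -
  have "(0::complex) \<in> ball 0 r" using assms(1) unfolding fermat_branch_def by simp
  then have "S t ^ n = - (1 + (u + t) ^ n)" "S 0 ^ n = - (1 + (u + 0) ^ n)"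
    using assms unfolding fermat_branch_def by blast+
  then have "((u + t) ^ n - u ^ n) + (S t ^ n - S 0 ^ n) = 0" by simp
  then show ?thesis by (simp add: power_slope)
qed

lemma fermat_branch_derivative:
  assumes br: "fermat_branch n u S r" and n: "n \<ge> 1"
  shows "(S has_field_derivative - (u ^ (n - 1) / S 0 ^ (n - 1))) (at 0)"
proof -
  have r0: "(0::complex) \<in> ball 0 r" and S: "S holomorphic_on ball 0 r" "S 0 \<noteq> 0"
    using br unfolding fermat_branch_def by auto
  obtain s where s: "(S has_field_derivative s) (at 0)"
    using S(1) r0 holomorphic_on_open[OF open_ball] by blast
  have "((\<lambda>t. S t ^ n) has_field_derivative of_nat n * S 0 ^ (n - 1) * s) (at 0)"
    by (rule derivative_eq_intros s refl | simp)+
  moreover have "((\<lambda>t. S t ^ n) has_field_derivative - (of_nat n * u ^ (n - 1))) (at 0)"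
  proof (rule has_field_derivative_transform_within_open)
    show "((\<lambda>t. - (1 + (u + t) ^ n)) has_field_derivative - (of_nat n * u ^ (n - 1))) (at 0)"
      by (auto intro!: derivative_eq_intros)
    show "- (1 + (u + t) ^ n) = S t ^ n" if "t \<in> ball 0 r" for t
      using br that unfolding fermat_branch_def by simp
  qed (use r0 in auto)
  ultimately have "of_nat n * S 0 ^ (n - 1) * s = - (of_nat n * u ^ (n - 1))" by (rule DERIV_unique)
  then have "of_nat n * (S 0 ^ (n - 1) * s + u ^ (n - 1)) = 0" by (simp add: algebra_simps)
  then have "S 0 ^ (n - 1) * s + u ^ (n - 1) = 0" using n by simp
  then have "s = - (u ^ (n - 1) / S 0 ^ (n - 1))"
    using S(2) by (simp add: field_simps add_eq_0_iff)
  then show ?thesis using s by simp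
qed

lemma fermat_branch_tendsto:
  assumes "fermat_branch n u S r"
  shows "(S \<longlongrightarrow> S 0) (at 0)"
proof -
  have "(0::complex) \<in> ball 0 r" "continuous_on (ball 0 r) S"
    using assms holomorphic_on_imp_continuous_on unfolding fermat_branch_def by auto
  then show ?thesis by (metis continuous_on_eq_continuous_at isContD open_ball)
qed

text \<open>The numerator is the equation of the tangent line at (u, \<open>S 0\<close>). Contact is
  exactly 2 because the second order term, multiplied by the nonzero \<open>S 0 ^ n\<close>, reduces
  by the curve equation to a nonzero multiple of u^(n-2).\<close>

lemma tangent_contact:
  assumes br: "fermat_branch n u S r" and n: "n \<ge> 2" and u: "u \<noteq> 0"
  shows "\<exists>l. l \<noteq> 0 \<and>
    ((\<lambda>t. (u ^ (n - 1) * t + S 0 ^ (n - 1) * (S t - S 0)) / t ^ 2) \<longlongrightarrow> l) (at 0)"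
proof -
  have n1: "n \<ge> 1" using n by simp
  have r0: "(0::complex) \<in> ball 0 r" and r: "r > 0" and S0: "S 0 \<noteq> 0" "S 0 ^ n = - (1 + u ^ n)"
    using br unfolding fermat_branch_def by force+
  define s where "s = - (u ^ (n - 1) / S 0 ^ (n - 1))"
  have dS: "(S has_field_derivative s) (at 0)"
    unfolding s_def by (rule fermat_branch_derivative[OF br n1])
  define N :: complex where "N = of_nat (\<Sum>i<n. i)"
  have N: "N \<noteq> 0"
  proof -
    have "(1::nat) \<le> (\<Sum>i<n. i)" using n member_le_sum[of 1 "{..<n}" "\<lambda>i. i"] by simp
    then show ?thesis unfolding N_def by (metis not_one_le_zero of_nat_eq_0_iff)
  qed
  have q1: "((\<lambda>t. (power_slope n u (u + t) - power_slope n u u) / t) \<longlongrightarrow> N * u ^ (n - 2)) (at 0)"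
    using power_slope_derivative[of n u] unfolding N_def DERIV_def .
  have "((\<lambda>t. power_slope n (S 0) (S t)) has_field_derivative N * S 0 ^ (n - 2) * s) (at 0)"
    unfolding N_def by (rule DERIV_chain2[OF power_slope_derivative dS])
  then have q2: "((\<lambda>t. (power_slope n (S 0) (S t) - power_slope n (S 0) (S 0)) / t)
      \<longlongrightarrow> N * S 0 ^ (n - 2) * s) (at 0)"
    by (simp add: has_field_derivative_iff)
  have q3: "((\<lambda>t. (S t - S 0) / t) \<longlongrightarrow> s) (at 0)"
    using dS by (simp add: has_field_derivative_iff)
  \<comment> \<open>Expand the slopes in \<open>t * A + \<Delta> * B = 0\<close> to first order:
    their base values give n times the tangent form, their variations give
    \<open>N * u ^ (n - 2)\<close> and \<open>N * S 0 ^ (n - 2) * s * s\<close>.\<close>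
  define l where "l = - (N * u ^ (n - 2) + N * S 0 ^ (n - 2) * s * s) / of_nat n"
  have lim: "((\<lambda>t. - ((power_slope n u (u + t) - power_slope n u u) / t
      + (power_slope n (S 0) (S t) - power_slope n (S 0) (S 0)) / t * ((S t - S 0) / t)) / of_nat n) \<longlongrightarrow> l) (at 0)"
    unfolding l_def using n by (intro tendsto_intros q1 q2 q3) auto
  have "((\<lambda>t. (u ^ (n - 1) * t + S 0 ^ (n - 1) * (S t - S 0)) / t ^ 2) \<longlongrightarrow> l) (at 0)"
  proof (rule Lim_transform_eventually[OF lim])
    have "\<forall>\<^sub>F t in at (0::complex). t \<in> ball 0 r - {0}"
      using r by (intro eventually_at_in_open) auto
    then show "\<forall>\<^sub>F t in at 0. - ((power_slope n u (u + t) - power_slope n u u) / t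
      + (power_slope n (S 0) (S t) - power_slope n (S 0) (S 0)) / t * ((S t - S 0) / t)) / of_nat n
      = (u ^ (n - 1) * t + S 0 ^ (n - 1) * (S t - S 0)) / t ^ 2"
    proof eventually_elim
      case (elim t)
      define A where "A = power_slope n u (u + t)"
      define B where "B = power_slope n (S 0) (S t)"
      define \<Delta> where "\<Delta> = S t - S 0"
      have eq: "t * A + \<Delta> * B = 0"
        using fermat_branch_slope_eq[OF br, of t] elim by (simp add: A_def B_def \<Delta>_def)
      have "- ((A - of_nat n * u ^ (n - 1)) / t + (B - of_nat n * S 0 ^ (n - 1)) / t * (\<Delta> / t)) / of_nat n
        = - ((t * A + \<Delta> * B) - of_nat n * (u ^ (n - 1) * t + S 0 ^ (n - 1) * \<Delta>)) / (of_nat n * t ^ 2)"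
        using elim n by (simp add: field_simps power2_eq_square)
      also have "\<dots> = (u ^ (n - 1) * t + S 0 ^ (n - 1) * \<Delta>) / t ^ 2"
        unfolding eq using n by simp
      finally show ?case unfolding A_def B_def \<Delta>_def power_slope_same .
    qed
  qed
  moreover have "l \<noteq> 0"
  proof
    assume "l = 0"
    then have "N * u ^ (n - 2) + N * S 0 ^ (n - 2) * s * s = 0"
      unfolding l_def divide_eq_0_iff neg_equal_0_iff_equal of_nat_eq_0_iff using n by auto
    then have "N * (u ^ (n - 2) + S 0 ^ (n - 2) * s * s) = 0"
      by (simp add: distrib_left mult.assoc)
    then have 0: "u ^ (n - 2) + S 0 ^ (n - 2) * s * s = 0" using N by simp
    \<comment> \<open>Writing n = m + 2 allows multiplication by \<open>S 0 ^ (m + 2)\<close>, after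
      which both factors s pair with \<open>S 0 ^ (m + 1)\<close> to give - u^(m+1).\<close>
    obtain m where m: "n = m + 2" using n by (metis add.commute le_Suc_ex)
    have ss: "S 0 ^ (m + 1) * s = - (u ^ (m + 1))" using S0(1) by (simp add: s_def m)
    have "0 = S 0 ^ (m + 2) * (u ^ m + S 0 ^ m * s * s)" using 0 by (simp add: m)
    also have "\<dots> = S 0 ^ n * u ^ m + (S 0 ^ (m + 1) * s) * (S 0 ^ (m + 1) * s)"
      by (simp add: m algebra_simps)
    also have "\<dots> = u ^ m * (S 0 ^ n + u ^ n)"
      unfolding ss by (simp add: m algebra_simps)
    also have "\<dots> = - (u ^ m)" using S0(2) by simp
    finally show False using u by simp
  qed
  ultimately show ?thesis by blast
qed

lemma bipoly_shifted_power: "j \<le> d \<Longrightarrow> bipoly d (\<lambda>v s. (v - a) ^ j)"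
  using bipoly_power[OF bipoly.add[OF bipoly.fst[of 0] bipoly.const[of "Suc 0" "- a"]], of j d] by simp

text \<open>On the branch v - u is the parameter itself, so its j-th power vanishes to order exactly
  j.\<close>

lemma linear_gap:
  assumes br: "fermat_branch n u S r" and n: "n \<ge> 3" and j: "j \<le> n - 3"
  shows "Suc j \<in> gaps n (ppt (u, 1, S 0))"
proof (rule gap_criterion[OF br n bipoly_shifted_power[OF j, of u]])
  show "((\<lambda>t. (u + t - u) ^ j / t ^ (Suc j - 1)) \<longlongrightarrow> 1) (at 0)"
    by (rule Lim_transform_eventually[OF tendsto_const[of 1]])
       (auto simp: eventually_at_filter)
qed auto

text \<open>The tangent form times (v - u)^j has degree j + 1 and vanishes to order j + 2.\<close>

lemma tangent_gap:
  assumes br: "fermat_branch n u S r" and n: "n \<ge> 3" and u: "u \<noteq> 0" and j: "j + 1 \<le> n - 3"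
  shows "j + 3 \<in> gaps n (ppt (u, 1, S 0))"
proof -
  have n2: "n \<ge> 2" using n by simp
  obtain l where l: "l \<noteq> 0"
    "((\<lambda>t. (u ^ (n - 1) * t + S 0 ^ (n - 1) * (S t - S 0)) / t ^ 2) \<longlongrightarrow> l) (at 0)"
    using tangent_contact[OF br n2 u] by blast
  let ?T = "\<lambda>v s. u ^ (n - 1) * (v - u) + S 0 ^ (n - 1) * (s - S 0)"
  have "bipoly 1 (\<lambda>v s. u ^ (n - 1) * v + S 0 ^ (n - 1) * s + (- (u ^ (n - 1) * u) - S 0 ^ (n - 1) * S 0))"
    using bipoly.add[OF bipoly.add[OF bipoly.mult[OF bipoly.const[of 0] bipoly.fst[of 0], of 1]
      bipoly.mult[OF bipoly.const[of 0] bipoly.snd[of 0], of 1]] bipoly.const] by simp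
  also have "(\<lambda>v s. u ^ (n - 1) * v + S 0 ^ (n - 1) * s + (- (u ^ (n - 1) * u) - S 0 ^ (n - 1) * S 0)) = ?T"
    by (simp add: fun_eq_iff algebra_simps)
  finally have T: "bipoly 1 ?T" .
  have P: "bipoly (n - 3) (\<lambda>v s. (v - u) ^ j * ?T v s)"
    by (rule bipoly.mult[OF bipoly_shifted_power[OF order_refl] T j])
  show ?thesis
  proof (rule gap_criterion[OF br n P _ _ l(1)])
    show "((\<lambda>t. (u + t - u) ^ j * ?T (u + t) (S t) / t ^ (j + 3 - 1)) \<longlongrightarrow> l) (at 0)"
    proof (rule Lim_transform_eventually[OF l(2)])
      have "\<forall>\<^sub>F t in at (0::complex). t \<noteq> 0" by (simp add: eventually_at_filter)
      then show "\<forall>\<^sub>F t in at 0. (u ^ (n - 1) * t + S 0 ^ (n - 1) * (S t - S 0)) / t ^ 2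
         = (u + t - u) ^ j * ?T (u + t) (S t) / t ^ (j + 3 - 1)"
      proof eventually_elim
        case (elim t)
        have "t ^ (j + 3 - 1) = t ^ j * t ^ 2" by (simp flip: power_add)
        then show ?case using elim by simp
      qed
    qed
  qed simp
qed

text \<open>At u = 0 the tangent line is z = \<open>S 0\<close> y, and the slope equation shows that
  it meets the curve to order n there.\<close>

lemma flex_contact:
  assumes br: "fermat_branch n 0 S r" and n: "n \<ge> 1" and t: "t \<in> ball 0 r" "t \<noteq> 0"
  shows "(S t - S 0) * power_slope n (S 0) (S t) = - (t ^ n)" "S t \<noteq> S 0" "power_slope n (S 0) (S t) \<noteq> 0"
proof -
  have "power_slope n 0 t = t ^ (n - 1)"
    using power_slope[of t n 0] t(2) n by (cases n) auto
  moreover have "t * t ^ (n - 1) = t ^ n" using n by (cases n) auto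
  ultimately show *: "(S t - S 0) * power_slope n (S 0) (S t) = - (t ^ n)"
    using fermat_branch_slope_eq[OF br t(1)] by (simp add: add_eq_0_iff)
  then show "S t \<noteq> S 0" "power_slope n (S 0) (S t) \<noteq> 0" using t(2) by auto
qed

lemma power_slope_tendsto:
  assumes "fermat_branch n u S r"
  shows "((\<lambda>t. power_slope n (S 0) (S t)) \<longlongrightarrow> of_nat n * S 0 ^ (n - 1)) (at 0)"
  unfolding power_slope_same[symmetric] power_slope_def
  by (intro tendsto_intros fermat_branch_tendsto[OF assms])

lemma flex_gap:
  assumes br: "fermat_branch n 0 S r" and n: "n \<ge> 4"
  shows "n + 1 \<in> gaps n (ppt (0, 1, S 0))"
proof -
  have r: "r > 0" and S0: "S 0 \<noteq> 0" using br unfolding fermat_branch_def by force+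
  \<comment> \<open>The factor 1 makes the polynomial a product, so that the rule
    \<open>mult\<close> can raise the degree bound from 1 to n - 3.\<close>
  have P: "bipoly (n - 3) (\<lambda>v s. 1 * (s + - S 0))"
    by (rule bipoly.mult[OF bipoly.const[of 0] bipoly.add[OF bipoly.snd[of 0] bipoly.const]]) (use n in simp)
  define l where "l = - 1 / (of_nat n * S 0 ^ (n - 1))"
  have l: "l \<noteq> 0" using S0 n by (simp add: l_def)
  show ?thesis
  proof (rule gap_criterion[OF br _ P _ _ l])
    have "((\<lambda>t. - 1 / power_slope n (S 0) (S t)) \<longlongrightarrow> l) (at 0)"
      unfolding l_def using S0 n by (intro tendsto_intros power_slope_tendsto[OF br]) auto
    then show "((\<lambda>t. 1 * (S t + - S 0) / t ^ (n + 1 - 1)) \<longlongrightarrow> l) (at 0)"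
    proof (rule Lim_transform_eventually)
      have "\<forall>\<^sub>F t in at (0::complex). t \<in> ball 0 r - {0}"
        using r by (intro eventually_at_in_open) auto
      then show "\<forall>\<^sub>F t in at 0. - 1 / power_slope n (S 0) (S t) = 1 * (S t + - S 0) / t ^ (n + 1 - 1)"
      proof eventually_elim
        case (elim t)
        have n1: "n \<ge> 1" using n by simp
        have t: "t \<in> ball 0 r" "t \<noteq> 0" using elim by auto
        note fc = flex_contact[OF br n1 t]
        have "t ^ n = - ((S t - S 0) * power_slope n (S 0) (S t))" using fc(1) by simp
        then show ?case using fc(2,3) by simp
      qed
    qed
  qed (use n in auto)
qed

text \<open>The function x / (z - \<open>S 0\<close> y) has a simple zero upstairs and a zero of
  order n downstairs at the flex. The tangent meets the curve nowhere else, so the only pole has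
  order n - 1.\<close>

lemma flex_nongap:
  assumes br: "fermat_branch n 0 S r" and n: "n \<ge> 2"
  shows "n - 1 \<notin> gaps n (ppt (0, 1, S 0))"
proof -
  have n1: "n \<ge> 1" using n by simp
  have r0: "(0::complex) \<in> ball 0 r" and r: "r > 0" and hS: "S holomorphic_on ball 0 r"
    and S0: "S 0 \<noteq> 0" "S 0 ^ n = - 1"
    using br n1 unfolding fermat_branch_def by (force simp: power_0_left)+
  define F where "F = (\<lambda>v :: c3. fst v / (snd (snd v) - S 0 * fst (snd v)))"
  have Fhom: "F (smul3 d v) = F v" if "d \<noteq> 0" for d v
  proof -
    have "d * snd (snd v) - S 0 * (d * fst (snd v)) = d * (snd (snd v) - S 0 * fst (snd v))"
      by (simp add: algebra_simps)
    then show ?thesis using that by (simp add: F_def smul3_def)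
  qed
  define f where "f = (\<lambda>L. F (point_rep L))"
  have fF: "f (ppt v) = F v" if "on_fermat n v" for v
    unfolding f_def by (rule point_rep_ppt[OF Fhom on_fermat_nonzero[OF that]])
  have "holo_at n f q" if q: "q \<in> fermat n - {ppt (0, 1, S 0)}" for q
  proof -
    obtain v where v: "q = ppt v" "on_fermat n v" using fermatE q by blast
    obtain x y z where xyz: "v = (x, y, z)" by (cases v)
    have "z \<noteq> S 0 * y"
    proof
      \<comment> \<open>Since \<open>S 0 ^ n\<close> is -1, the curve equation on this line reduces
        to x^n = 0, leaving only the flex.\<close>
      assume z: "z = S 0 * y"
      have "x ^ n + y ^ n + z ^ n = 0" using v(2) by (simp add: xyz on_fermat_def)
      then have x: "x = 0" using S0(2) by (simp add: z power_mult_distrib)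
      then have "y \<noteq> 0" using v(2) by (auto simp: xyz z on_fermat_def)
      moreover have "v = smul3 y (0, 1, S 0)" by (simp add: xyz x z)
      ultimately have "q = ppt (0, 1, S 0)" using v(1) ppt_smul3[of y "(0, 1, S 0)"] by simp
      then show False using q by blast
    qed
    then have nz: "0 * fst v + - S 0 * fst (snd v) + 1 * snd (snd v) \<noteq> 0" by (simp add: xyz)
    show ?thesis
    proof (rule holo_at_quotient[where v = v and F = F and a = 0 and b = "- S 0" and c = 1])
      fix \<phi> D
      assume D: "holo3 \<phi> D" "\<And>t. t \<in> D \<Longrightarrow> 0 * fst (\<phi> t) + - S 0 * fst (snd (\<phi> t)) + 1 * snd (snd (\<phi> t)) \<noteq> 0"
      have "snd (snd (\<phi> t)) - S 0 * fst (snd (\<phi> t)) \<noteq> 0" if "t \<in> D" for t using D(2)[OF that] by simp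
      then show "(\<lambda>t. F (\<phi> t)) holomorphic_on D"
        using D(1) unfolding holo3_def F_def by (intro holomorphic_intros) auto
    qed (use q n1 v nz fF in auto)
  qed
  moreover have "pole_order n f (ppt (0, 1, S 0)) (n - 1)"
  proof -
    define h where "h = (\<lambda>t. - power_slope n (S 0) (S t))"
    have "h holomorphic_on ball 0 r"
      unfolding h_def power_slope_def by (intro holomorphic_intros hS)
    moreover have "h 0 \<noteq> 0" using S0(1) n by (simp add: h_def power_slope_same)
    moreover have "f (ppt (0 + t, 1, S t)) = h t / t ^ (n - 1)" if t: "t \<in> ball 0 r - {0}" for t
    proof -
      have t': "t \<in> ball 0 r" "t \<noteq> 0" using t by auto
      have "t * t ^ (n - 1) = t ^ n" using n by (cases n) auto
      also have "\<dots> = (S t - S 0) * h t" using flex_contact(1)[OF br n1 t'] by (simp add: h_def)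
      finally have "t / (S t - S 0) = h t / t ^ (n - 1)"
        using t'(2) flex_contact(2)[OF br n1 t'] by (simp add: frac_eq_eq mult.commute)
      moreover have "f (ppt (0 + t, 1, S t)) = F (0 + t, 1, S t)"
        by (rule fF[OF fermat_branch_on_fermat[OF br t'(1)]])
      ultimately show ?thesis by (simp add: F_def)
    qed
    ultimately show ?thesis unfolding pole_order_def using fchart_affine[OF br] by blast
  qed
  ultimately show ?thesis unfolding gaps_def by blast
qed


subsection \<open>Independence of powers of a branch\<close>

text \<open>The identity says that n times the logarithmic derivative of p/q is m times that of H.
  At a simple zero of H, comparing residues gives the claim; splitting off the powers of X makes
  this a polynomial evaluation.\<close>

lemma order_relation_at_simple_zero:
  fixes p q H :: "complex poly"
  assumes p: "p \<noteq> 0" and q: "q \<noteq> 0" and H: "poly H e = 0" "poly (pderiv H) e \<noteq> 0"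
    and eq: "smult (of_nat n) (H * (pderiv p * q - p * pderiv q)) = smult m (pderiv H * p * q)"
  shows "of_nat n * (of_nat (order e p) - of_nat (order e q)) = m"
proof -
  define X where "X = [:- e, 1:]"
  have Xe: "poly X e = 0" and dX: "pderiv X = 1" and X0: "X \<noteq> 0" by (simp_all add: X_def pderiv_pCons)
  have X_power: "X * pderiv (X ^ k) = smult (of_nat k) (X ^ k)" for k
    by (cases k) (simp_all add: pderiv_power_Suc dX pderiv_1 mult_ac del: power_Suc of_nat_Suc, simp)
  define \<alpha> \<beta> where "\<alpha> = order e p" and "\<beta> = order e q"
  obtain p1 where p1: "p = X ^ \<alpha> * p1" "\<not> X dvd p1"
    using order_decomp[OF p, of e] unfolding X_def \<alpha>_def by blast
  obtain q1 where q1: "q = X ^ \<beta> * q1" "\<not> X dvd q1"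
    using order_decomp[OF q, of e] unfolding X_def \<beta>_def by blast
  have nz: "poly p1 e \<noteq> 0" "poly q1 e \<noteq> 0"
    using p1(2) q1(2) unfolding X_def by (simp_all add: poly_eq_0_iff_dvd)
  obtain H1 where H1: "H = X * H1" using H(1) unfolding X_def poly_eq_0_iff_dvd by (elim dvdE)
  have dH: "poly (pderiv H) e = poly H1 e" by (simp add: H1 pderiv_mult dX Xe)
  have Xp: "X * pderiv p = X ^ \<alpha> * (smult (of_nat \<alpha>) p1 + X * pderiv p1)"
  proof -
    have "X * pderiv p = (X * pderiv (X ^ \<alpha>)) * p1 + X ^ \<alpha> * (X * pderiv p1)"
      unfolding p1(1) pderiv_mult by (simp add: algebra_simps)
    then show ?thesis unfolding X_power by (simp add: algebra_simps)
  qed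
  have Xq: "X * pderiv q = X ^ \<beta> * (smult (of_nat \<beta>) q1 + X * pderiv q1)"
  proof -
    have "X * pderiv q = (X * pderiv (X ^ \<beta>)) * q1 + X ^ \<beta> * (X * pderiv q1)"
      unfolding q1(1) pderiv_mult by (simp add: algebra_simps)
    then show ?thesis unfolding X_power by (simp add: algebra_simps)
  qed
  define L where "L = smult (of_nat n) (H1 * ((smult (of_nat \<alpha>) p1 + X * pderiv p1) * q1
    - p1 * (smult (of_nat \<beta>) q1 + X * pderiv q1)))"
  define Rr where "Rr = smult m (pderiv H * p1 * q1)"
  have "X ^ \<alpha> * X ^ \<beta> * L = smult (of_nat n) (H1 * ((X * pderiv p) * q - p * (X * pderiv q)))"
    unfolding Xp Xq L_def unfolding p1(1) q1(1) by (simp add: algebra_simps)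
  also have "\<dots> = smult (of_nat n) (H * (pderiv p * q - p * pderiv q))"
    unfolding H1 by (simp add: algebra_simps)
  also have "\<dots> = smult m (pderiv H * p * q)" by (rule eq)
  also have "\<dots> = X ^ \<alpha> * X ^ \<beta> * Rr"
    unfolding Rr_def p1(1) q1(1) by (simp add: algebra_simps)
  finally have "L = Rr" using X0 by simp
  then have "poly L e = poly Rr e" by simp
  then have "poly H1 e * poly p1 e * poly q1 e * (of_nat n * (of_nat \<alpha> - of_nat \<beta>))
      = poly H1 e * poly p1 e * poly q1 e * m"
    unfolding L_def Rr_def by (simp add: Xe dH algebra_simps)
  moreover have "poly H1 e * poly p1 e * poly q1 e \<noteq> 0" using nz H(2) dH by simp
  ultimately show ?thesis unfolding \<alpha>_def \<beta>_def by simp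
qed

lemma poly_zero_on_ball:
  fixes p :: "complex poly"
  assumes "r > 0" "\<And>t. t \<in> ball 0 r \<Longrightarrow> poly p t = 0"
  shows "p = 0"
proof (rule ccontr)
  assume "p \<noteq> 0"
  then have "finite {t. poly p t = 0}" by (rule poly_roots_finite)
  moreover have "ball 0 r \<subseteq> {t. poly p t = 0}" using assms(2) by blast
  ultimately have "finite (ball (0::complex) r)" by (rule finite_subset[rotated])
  then show False using assms(1) uncountable_ball[of r "0::complex"] countable_finite by blast
qed

text \<open>A shortest relation is differentiated; eliminating one term gives a shorter one, and the
  resulting identity between coefficients contradicts the orders at a ramification point.\<close>

lemma fermat_branch_independent:
  fixes a :: "nat \<Rightarrow> complex poly"
  assumes br: "fermat_branch n u S r" and n: "n \<ge> 1"
    and rel: "\<And>t. t \<in> ball 0 r \<Longrightarrow> (\<Sum>k<n. poly (a k) t * S t ^ k) = 0"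
  shows "\<forall>k<n. a k = 0"
proof -
  have r: "r > 0" and S: "S holomorphic_on ball 0 r"
    and S1: "\<And>t. t \<in> ball 0 r \<Longrightarrow> S t ^ n = - (1 + (u + t) ^ n)" "\<And>t. t \<in> ball 0 r \<Longrightarrow> S t \<noteq> 0"
    using br unfolding fermat_branch_def by blast+
  \<comment> \<open>S^n as a polynomial in t, whose zeros are the ramification points.\<close>
  define H where "H = - (1 + [:u, 1:] ^ n)"
  have HS: "poly H t = S t ^ n" if "t \<in> ball 0 r" for t
    using S1(1)[OF that] by (simp add: H_def)
  have dH: "pderiv H = - smult (of_nat n) ([:u, 1:] ^ (n - 1))"
  proof -
    obtain m where "n = Suc m" using n by (cases n) auto
    then show ?thesis by (simp add: H_def pderiv_minus pderiv_diff pderiv_power_Suc pderiv_pCons pderiv_1 del: power_Suc of_nat_Suc)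
  qed
  obtain z where z: "(-1 :: complex) = z ^ n" using exists_complex_root[of n "-1"] n by auto
  have z0: "z \<noteq> 0" using z n by (auto simp: power_0_left)
  have He: "poly H (z - u) = 0" "poly (pderiv H) (z - u) \<noteq> 0"
    using z z0 n by (simp_all add: dH) (simp add: H_def flip: z)
  \<comment> \<open>The logarithmic derivative of S^n = H; it expresses S' through S with polynomial
    coefficients.\<close>
  have dS: "of_nat n * poly H t * deriv S t = poly (pderiv H) t * S t" if t: "t \<in> ball 0 r" for t
  proof -
    have d: "(S has_field_derivative deriv S t) (at t)" using S t by (simp add: holomorphic_derivI)
    have "((\<lambda>t. S t ^ n) has_field_derivative of_nat n * S t ^ (n - 1) * deriv S t) (at t)"
      by (rule derivative_eq_intros d refl | simp)+
    moreover have "((\<lambda>t. S t ^ n) has_field_derivative poly (pderiv H) t) (at t)"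
      by (rule has_field_derivative_transform_within_open[OF poly_DERIV open_ball t HS])
    ultimately have "of_nat n * S t ^ (n - 1) * deriv S t = poly (pderiv H) t" by (rule DERIV_unique)
    moreover have "S t ^ n = S t ^ (n - 1) * S t" using n by (cases n) auto
    ultimately show ?thesis using HS[OF t] by (simp add: mult_ac)
  qed
  show ?thesis
    using rel
  proof (induction "card {k. k < n \<and> a k \<noteq> 0}" arbitrary: a rule: less_induct)
    case less
    show ?case
    proof (rule ccontr)
      assume "\<not> (\<forall>k<n. a k = 0)"
      then obtain l where l: "l < n" "a l \<noteq> 0" by blast
      \<comment> \<open>Coefficients of n H a_l times the differentiated relation minus (n H a_l' +
        l H' a_l) times the relation itself, chosen so that the term with index l cancels.\<close>
      define b where "b = (\<lambda>k. smult (of_nat n) (H * (pderiv (a k) * a l - a k * pderiv (a l)))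
        - smult (of_nat l - of_nat k) (pderiv H * a k * a l))"
      have bl: "b l = 0" by (simp add: b_def mult.commute)
      have "{k. k < n \<and> b k \<noteq> 0} \<subseteq> {k. k < n \<and> a k \<noteq> 0} - {l}"
      proof
        fix k assume k: "k \<in> {k. k < n \<and> b k \<noteq> 0}"
        moreover have "a k \<noteq> 0" using k by (auto simp: b_def)
        moreover have "k \<noteq> l" using k bl by auto
        ultimately show "k \<in> {k. k < n \<and> a k \<noteq> 0} - {l}" by simp
      qed
      then have "{k. k < n \<and> b k \<noteq> 0} \<subset> {k. k < n \<and> a k \<noteq> 0}" using l by blast
      then have "card {k. k < n \<and> b k \<noteq> 0} < card {k. k < n \<and> a k \<noteq> 0}"
        by (intro psubset_card_mono) auto
      moreover have "(\<Sum>k<n. poly (b k) t * S t ^ k) = 0" if t: "t \<in> ball 0 r" for t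
      proof -
        have d: "(S has_field_derivative deriv S t) (at t)" using S t by (simp add: holomorphic_derivI)
        have "((\<lambda>t. \<Sum>k<n. poly (a k) t * S t ^ k) has_field_derivative
           (\<Sum>k<n. poly (pderiv (a k)) t * S t ^ k + of_nat k * S t ^ (k - 1) * deriv S t * poly (a k) t)) (at t)"
          by (intro DERIV_sum DERIV_mult poly_DERIV) (auto intro!: derivative_eq_intros d)
        moreover have "((\<lambda>t. \<Sum>k<n. poly (a k) t * S t ^ k) has_field_derivative 0) (at t)"
          by (rule has_field_derivative_transform_within_open[OF DERIV_const open_ball t])
             (use less.prems in simp)
        ultimately have D: "(\<Sum>k<n. poly (pderiv (a k)) t * S t ^ k
             + of_nat k * S t ^ (k - 1) * deriv S t * poly (a k) t) = 0"
          by (rule DERIV_unique)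
        have "poly (b k) t * S t ^ k = of_nat n * poly H t * poly (a l) t *
            (poly (pderiv (a k)) t * S t ^ k + of_nat k * S t ^ (k - 1) * deriv S t * poly (a k) t)
          - (of_nat n * poly H t * poly (pderiv (a l)) t + of_nat l * poly (pderiv H) t * poly (a l) t)
            * (poly (a k) t * S t ^ k)" for k
        proof -
          have "of_nat n * poly H t * (of_nat k * S t ^ (k - 1) * deriv S t)
             = of_nat k * S t ^ (k - 1) * (of_nat n * poly H t * deriv S t)" by (simp add: mult_ac)
          also have "\<dots> = of_nat k * poly (pderiv H) t * S t ^ k"
            unfolding dS[OF t] by (cases k) (simp_all add: mult_ac)
          finally have *: "of_nat n * poly H t * (of_nat k * S t ^ (k - 1) * deriv S t)
             = of_nat k * poly (pderiv H) t * S t ^ k" .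
          have ** : "of_nat n * poly H t * poly (a l) t *
            (poly (pderiv (a k)) t * S t ^ k + of_nat k * S t ^ (k - 1) * deriv S t * poly (a k) t)
            = of_nat n * poly H t * poly (a l) t * poly (pderiv (a k)) t * S t ^ k
              + (of_nat n * poly H t * (of_nat k * S t ^ (k - 1) * deriv S t)) * poly (a l) t * poly (a k) t"
            by (simp add: algebra_simps)
          have pb: "poly (b k) t = of_nat n * (poly H t * (poly (pderiv (a k)) t * poly (a l) t
              - poly (a k) t * poly (pderiv (a l)) t))
            - (of_nat l - of_nat k) * (poly (pderiv H) t * poly (a k) t * poly (a l) t)"
            by (simp add: b_def)
          show ?thesis unfolding ** * pb by (simp only: algebra_simps)
        qed
        then have "(\<Sum>k<n. poly (b k) t * S t ^ k) = of_nat n * poly H t * poly (a l) t *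
            (\<Sum>k<n. poly (pderiv (a k)) t * S t ^ k + of_nat k * S t ^ (k - 1) * deriv S t * poly (a k) t)
          - (of_nat n * poly H t * poly (pderiv (a l)) t + of_nat l * poly (pderiv H) t * poly (a l) t)
            * (\<Sum>k<n. poly (a k) t * S t ^ k)"
          by (simp only: sum_subtractf sum_distrib_left)
        then show ?thesis using D less.prems[OF t] by simp
      qed
      ultimately have b0: "\<forall>k<n. b k = 0" by (rule less.hyps)
      have a0: "a k = 0" if k: "k < n" "k \<noteq> l" for k
      proof (rule ccontr)
        assume ak: "a k \<noteq> 0"
        have "b k = 0" using b0 k(1) by blast
        then have "smult (of_nat n) (H * (pderiv (a k) * a l - a k * pderiv (a l)))
            = smult (of_nat l - of_nat k) (pderiv H * a k * a l)" by (simp add: b_def)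
        from order_relation_at_simple_zero[OF ak l(2) He this]
        have "(of_int (int n * (int (order (z - u) (a k)) - int (order (z - u) (a l)))) :: complex)
            = of_int (int l - int k)" by simp
        then have "int n * (int (order (z - u) (a k)) - int (order (z - u) (a l))) = int l - int k"
          by (simp only: of_int_eq_iff)
        \<comment> \<open>The order relation would make n divide l - k, although 0 < |l - k| <
          n.\<close>
        then have "int n dvd int l - int k" by (metis dvd_triv_left)
        moreover have "\<bar>int l - int k\<bar> < int n" using k l by linarith
        moreover have "int l - int k \<noteq> 0" using k(2) by simp
        ultimately show False using dvd_imp_le_int[of "int l - int k" "int n"] by simp
      qed
      have "poly (a l) t = 0" if t: "t \<in> ball 0 r" for t
      proof -
        have "(\<Sum>k<n. poly (a k) t * S t ^ k) = (\<Sum>k<n. if k = l then poly (a l) t * S t ^ l else 0)"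
          by (intro sum.cong) (auto simp: a0)
        also have "\<dots> = poly (a l) t * S t ^ l" using l(1) by simp
        finally show ?thesis using less.prems[OF t] S1(2)[OF t] by simp
      qed
      then show False using poly_zero_on_ball[OF r] l(2) by blast
    qed
  qed
qed

text \<open>If g were not constant, it would factor as w^N G with G zero-free near 0; the remainder
  formula with m = N + 1 forces G to vanish at 0.\<close>

lemma holomorphic_infinite_order_zero:
  assumes g: "g holomorphic_on ball 0 r" and r: "r > 0"
    and R: "\<And>m. R m holomorphic_on ball 0 r" "\<And>m t. t \<in> ball 0 r \<Longrightarrow> g t = t ^ m * R m t"
    and t: "t \<in> ball 0 r"
  shows "g t = 0"
proof (rule ccontr)
  assume gt: "g t \<noteq> 0"
  have r0: "(0::complex) \<in> ball 0 r" using r by simp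
  have g0: "g 0 = 0" using R(2)[OF r0, of 1] by simp
  have "\<not> g constant_on ball 0 r" using gt g0 t r0 unfolding constant_on_def by metis
  then show False
  proof (rule holomorphic_factor_zero_nonconstant[OF g open_ball connected_ball r0 g0])
    fix G :: "complex \<Rightarrow> complex" and d :: real and N :: nat
    assume N: "0 < N" "0 < d" "ball 0 d \<subseteq> ball (0::complex) r" "G holomorphic_on ball 0 d"
      "\<And>w. w \<in> ball 0 d \<Longrightarrow> g w = (w - 0) ^ N * G w" "\<And>w. w \<in> ball 0 d \<Longrightarrow> G w \<noteq> 0"
    have d0: "(0::complex) \<in> ball 0 d" using N(2) by simp
    have "(G \<longlongrightarrow> G 0) (at 0)"
      using holomorphic_on_imp_continuous_on[OF N(4)] d0
      by (metis continuous_on_eq_continuous_at isContD open_ball)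
    moreover have "(R (Suc N) \<longlongrightarrow> R (Suc N) 0) (at 0)"
      using holomorphic_on_imp_continuous_on[OF R(1)] r0
      by (metis continuous_on_eq_continuous_at isContD open_ball)
    then have "((\<lambda>w. w * R (Suc N) w) \<longlongrightarrow> 0 * R (Suc N) 0) (at 0)" by (intro tendsto_intros)
    moreover have "\<forall>\<^sub>F w in at 0. w * R (Suc N) w = G w"
    proof -
      have "\<forall>\<^sub>F w in at (0::complex). w \<in> ball 0 d - {0}" using N(2) by (intro eventually_at_in_open) auto
      then show ?thesis
      proof eventually_elim
        case (elim w)
        then have w: "w \<in> ball 0 d" "w \<noteq> 0" by auto
        have "w ^ N * G w = g w" using N(5)[OF w(1)] by simp
        also have "\<dots> = w ^ Suc N * R (Suc N) w" by (rule R(2)[OF subsetD[OF N(3) w(1)]])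
        finally have e: "w ^ N * G w = w ^ Suc N * R (Suc N) w" .
        have "w ^ Suc N * R (Suc N) w = w ^ N * (w * R (Suc N) w)" by (simp add: mult_ac)
        from trans[OF e this] have "G w = w * R (Suc N) w" using w(2) by simp
        then show ?case by (rule sym)
      qed
    qed
    ultimately have "(G \<longlongrightarrow> 0) (at 0)" by (auto elim: Lim_transform_eventually)
    then have "G 0 = 0" using \<open>(G \<longlongrightarrow> G 0) (at 0)\<close> tendsto_unique[of "at 0" G] by simp
    then show False using N(6)[OF d0] by simp
  qed
qed

subsection \<open>Fixed points of the involution\<close>

text \<open>The exponents of the forms \<open>(x + y)^(n - 3 - i - k) (x - y)^i z^k\<close> that are invariant under
  exchanging \<open>x\<close> and \<open>y\<close>.\<close>

definition even_gap_indices :: "nat \<Rightarrow> (nat \<times> nat) set" where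
  "even_gap_indices n = {(i, k). even i \<and> i + k \<le> n - 3}"

text \<open>Lowering i by 1 embeds the odd exponents into the even ones. It misses (0, n - 3) and
  (2, n - 5), whose preimages would have sum n - 2; the second pair exists from n = 5 on.\<close>

lemma card_even_gap_indices:
  assumes "n \<ge> 5"
  shows "card (gap_indices n) + 2 \<le> 2 * card (even_gap_indices n)"
proof -
  define E where "E = even_gap_indices n"
  define Od where "Od = {(i, k). odd i \<and> i + k \<le> n - 3}"
  have sub: "E \<subseteq> gap_indices n" "Od \<subseteq> gap_indices n"
    by (auto simp: E_def Od_def even_gap_indices_def gap_indices_def)
  have fin: "finite E" "finite Od" using finite_subset[OF _ finite_gap_indices] sub by blast+
  have "gap_indices n = E \<union> Od" "E \<inter> Od = {}"
    by (auto simp: E_def Od_def even_gap_indices_def gap_indices_def)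
  then have card: "card (gap_indices n) = card E + card Od" using card_Un_disjoint fin by metis
  define h where "h = (\<lambda>(i :: nat, k :: nat). (i - 1, k))"
  have inj: "inj_on h Od"
    by (auto simp: inj_on_def h_def Od_def) (metis Suc_pred odd_pos)+
  have "h ` Od \<subseteq> E - {(0, n - 3), (2, n - 5)}"
    using assms by (auto simp: h_def Od_def E_def even_gap_indices_def elim!: oddE)
  then have "card Od \<le> card (E - {(0, n - 3), (2, n - 5)})"
    using card_inj_on_le[OF inj] fin(1) by blast
  moreover have "{(0, n - 3), (2, n - 5)} \<subseteq> E"
    using assms by (auto simp: E_def even_gap_indices_def)
  then have "card (E - {(0, n - 3), (2, n - 5)}) = card E - 2 \<and> 2 \<le> card E"
    using card_mono[OF fin(1), of "{(0, n - 3), (2, n - 5)}"] by (subst card_Diff_subset) auto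
  ultimately show ?thesis using card unfolding E_def by linarith
qed


text \<open>The substitution - t / (1 + t) has derivative -1 at 0 and the factor (1 + t)^d tends to
  1. Comparing leading coefficients gives (-1)^\<rho> = 1.\<close>

lemma even_order_of_symmetric:
  assumes W: "W holomorphic_on ball 0 r" "r > 0" "W 0 \<noteq> 0"
    and F: "\<And>t. t \<in> ball 0 r \<Longrightarrow> F t = t ^ \<rho> * W t"
    and sym: "\<forall>\<^sub>F t in at 0. F (- t / (1 + t)) = F t / (1 + t) ^ d"
  shows "even \<rho>"
proof -
  have r0: "(0::complex) \<in> ball 0 r" using W(2) by simp
  have cW: "isCont W 0"
    using holomorphic_on_imp_continuous_on[OF W(1)] r0
    by (metis continuous_on_eq_continuous_at open_ball)
  have "((\<lambda>t::complex. - t / (1 + t)) \<longlongrightarrow> - 0 / (1 + 0)) (at 0)" by (intro tendsto_intros) auto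
  then have \<tau>: "((\<lambda>t::complex. - t / (1 + t)) \<longlongrightarrow> 0) (at 0)" by simp
  have lim1: "((\<lambda>t. (- 1) ^ \<rho> * W (- t / (1 + t)) / (1 + t) ^ \<rho>) \<longlongrightarrow> (- 1) ^ \<rho> * W 0 / (1 + 0) ^ \<rho>) (at 0)"
    by (intro tendsto_intros isCont_tendsto_compose[OF cW \<tau>]) auto
  have lim2: "((\<lambda>t. W t / (1 + t) ^ d) \<longlongrightarrow> W 0 / (1 + 0) ^ d) (at 0)"
    using cW unfolding isCont_def by (intro tendsto_intros) auto
  have ev: "\<forall>\<^sub>F t in at 0. W t / (1 + t) ^ d = (- 1) ^ \<rho> * W (- t / (1 + t)) / (1 + t) ^ \<rho>"
  proof -
    have "\<forall>\<^sub>F t in at (0::complex). t \<in> ball 0 r - {0}" using W(2) by (intro eventually_at_in_open) auto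
    moreover have "\<forall>\<^sub>F t in at (0::complex). t \<in> ball 0 1" by (intro eventually_at_in_open') auto
    moreover have "\<forall>\<^sub>F t in at (0::complex). - t / (1 + t) \<in> ball 0 r"
      using tendstoD[OF \<tau> W(2)] by (simp add: dist_commute)
    ultimately show ?thesis using sym
    proof eventually_elim
      case (elim t)
      have t: "t \<noteq> 0" "t \<in> ball 0 r" using elim(1) by auto
      have t1: "1 + t \<noteq> 0"
      proof
        assume "1 + t = 0"
        then have "t = - 1" by (simp add: eq_neg_iff_add_eq_0 add.commute)
        then show False using elim(2) by simp
      qed
      have "(- t / (1 + t)) ^ \<rho> * W (- t / (1 + t)) = t ^ \<rho> * W t / (1 + t) ^ d"
        using elim(4) F[OF t(2)] F[OF elim(3)] by simp
      moreover have "(- t / (1 + t)) ^ \<rho> = t ^ \<rho> * ((- 1) ^ \<rho> / (1 + t) ^ \<rho>)"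
        unfolding power_divide power_minus[of t] by simp
      ultimately have "t ^ \<rho> * ((- 1) ^ \<rho> * W (- t / (1 + t)) / (1 + t) ^ \<rho>) = t ^ \<rho> * (W t / (1 + t) ^ d)"
        by (simp add: mult.assoc)
      moreover have "t ^ \<rho> \<noteq> 0" using t(1) by simp
      ultimately have "(- 1) ^ \<rho> * W (- t / (1 + t)) / (1 + t) ^ \<rho> = W t / (1 + t) ^ d"
        by (rule mult_left_cancel[THEN iffD1, rotated])
      then show ?case by metis
    qed
  qed
  have "(- 1) ^ \<rho> * W 0 / (1 + 0) ^ \<rho> = W 0 / (1 + 0) ^ d"
    by (rule tendsto_unique[OF at_neq_bot lim1 Lim_transform_eventually[OF lim2 ev]])
  then have "(- 1 :: complex) ^ \<rho> = 1" using W(3) by simp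
  then show ?thesis by (cases "even \<rho>") auto
qed

text \<open>Exchanging x and y sends (u, s) to (1/u, s/u), and u = 1 + t turns 1/u into 1 - t / (1 +
  t). Both sides are roots of the same number near \<open>S 0\<close>, so they coincide.\<close>

lemma fermat_branch_involution:
  assumes br: "fermat_branch n 1 S r" and n: "n \<ge> 1"
  shows "\<forall>\<^sub>F t in at 0. S (- t / (1 + t)) = S t / (1 + t)"
proof -
  have r: "r > 0" and S: "S holomorphic_on ball 0 r" "S 0 \<noteq> 0"
    using br unfolding fermat_branch_def by auto
  obtain e where e: "e > 0"
    "\<And>a b. a \<in> ball (S 0) e \<Longrightarrow> b \<in> ball (S 0) e \<Longrightarrow> a ^ n = b ^ n \<Longrightarrow> a = b"
    using local_root_unique[OF S(2) n] by metis
  have "(0::complex) \<in> ball 0 r" using r by simp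
  then have cS: "isCont S 0"
    using holomorphic_on_imp_continuous_on[OF S(1)] by (metis continuous_on_eq_continuous_at open_ball)
  have "((\<lambda>t::complex. - t / (1 + t)) \<longlongrightarrow> - 0 / (1 + 0)) (at 0)" by (intro tendsto_intros) auto
  then have \<tau>: "((\<lambda>t::complex. - t / (1 + t)) \<longlongrightarrow> 0) (at 0)" by simp
  have "((\<lambda>t. S t / (1 + t)) \<longlongrightarrow> S 0 / (1 + 0)) (at 0)"
    using cS unfolding isCont_def by (intro tendsto_intros) auto
  then have "((\<lambda>t. S t / (1 + t)) \<longlongrightarrow> S 0) (at 0)" by simp
  from tendstoD[OF this e(1)] have "\<forall>\<^sub>F t in at 0. S t / (1 + t) \<in> ball (S 0) e"
    by (simp add: dist_commute)
  moreover from tendstoD[OF isCont_tendsto_compose[OF cS \<tau>] e(1)]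
  have "\<forall>\<^sub>F t in at 0. S (- t / (1 + t)) \<in> ball (S 0) e" by (simp add: dist_commute)
  moreover have "\<forall>\<^sub>F t in at (0::complex). t \<in> ball 0 r" using r by (intro eventually_at_in_open') auto
  moreover have "\<forall>\<^sub>F t in at (0::complex). t \<in> ball 0 1" by (intro eventually_at_in_open') auto
  moreover have "\<forall>\<^sub>F t in at (0::complex). - t / (1 + t) \<in> ball 0 r"
    using tendstoD[OF \<tau> r] by (simp add: dist_commute)
  ultimately show ?thesis
  proof eventually_elim
    case (elim t)
    have t1: "1 + t \<noteq> 0"
    proof
      assume "1 + t = 0"
      then have "t = - 1" by (simp add: eq_neg_iff_add_eq_0 add.commute)
      then show False using elim(4) by simp
    qed
    have "S (- t / (1 + t)) ^ n = - (1 + (1 + - t / (1 + t)) ^ n)"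
      using br elim(5) unfolding fermat_branch_def by blast
    also have "1 + - t / (1 + t) = 1 / (1 + t)" using t1 by (simp add: field_simps)
    also have "- (1 + (1 / (1 + t)) ^ n) = - (1 + (1 + t) ^ n) / (1 + t) ^ n"
      using t1 by (simp add: power_divide field_simps)
    also have "- (1 + (1 + t) ^ n) = S t ^ n"
      using br elim(3) unfolding fermat_branch_def by simp
    finally have "S (- t / (1 + t)) ^ n = (S t / (1 + t)) ^ n" by (simp add: power_divide)
    then show ?case using e(2)[OF elim(2,1)] by blast
  qed
qed

text \<open>The differentials invariant under the involution have even order at its fixed points. There
  are so many of them that one has order at least the genus.\<close>

lemma fixed_point_weight:
  assumes br: "fermat_branch n 1 S r" and n: "n \<ge> 5"
  shows "weight n (ppt (1, 1, S 0)) \<noteq> 0"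
proof
  let ?p = "ppt (1, 1, S 0)"
  assume w0: "weight n ?p = 0"
  have n1: "n \<ge> 1" and n3: "n \<ge> 3" using n by simp_all
  have r: "r > 0" and S: "S holomorphic_on ball 0 r" using br unfolding fermat_branch_def by blast+
  define d where "d = n - 3"
  define J where "J = even_gap_indices n"
  have J: "finite J"
    by (rule finite_subset[OF _ finite_gap_indices[of n]])
       (auto simp: J_def even_gap_indices_def gap_indices_def)
  have cJ: "card (gap_indices n) + 2 \<le> 2 * card J"
    unfolding J_def by (rule card_even_gap_indices[OF n])
  have Jd: "even i" "i + k \<le> d" "k < n" if "(i, k) \<in> J" for i k
    using that n by (auto simp: J_def even_gap_indices_def d_def)
  \<comment> \<open>The form (x + y)^(d-i-k) (x - y)^i z^k along the lift (1 + t, 1, S t).\<close>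
  define g where "g = (\<lambda>(i, k) t. (2 + t) ^ (d - i - k) * t ^ i * S t ^ k)"
  have hg: "g p holomorphic_on ball 0 r" for p
    unfolding g_def by (cases p) (auto intro!: holomorphic_intros S)
  have "\<forall>p. \<exists>c R. \<forall>m. R m holomorphic_on ball 0 r \<and> R m 0 = c m \<and>
    (\<forall>t\<in>ball 0 r. g p t = (\<Sum>j<m. c j * t ^ j) + t ^ m * R m t)"
    by (intro allI holomorphic_taylor_remainders[OF hg r])
  from choice[OF this] obtain c where "\<forall>p. \<exists>R. \<forall>m. R m holomorphic_on ball 0 r \<and>
    R m 0 = c p m \<and> (\<forall>t\<in>ball 0 r. g p t = (\<Sum>j<m. c p j * t ^ j) + t ^ m * R m t)" ..
  from choice[OF this] obtain R where Rc: "\<forall>p m. R p m holomorphic_on ball 0 r \<and>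
    R p m 0 = c p m \<and> (\<forall>t\<in>ball 0 r. g p t = (\<Sum>j<m. c p j * t ^ j) + t ^ m * R p m t)" ..
  then have R: "R p m holomorphic_on ball 0 r" "R p m 0 = c p m" for p m by blast+
  have c: "g p t = (\<Sum>j<m. c p j * t ^ j) + t ^ m * R p m t" if "t \<in> ball 0 r" for p m t
    using Rc that by blast
  \<comment> \<open>One unknown more than equations: the coefficients of t^0, t^2, ..., t^(2(card J
    - 2)) are made to vanish. Odd coefficients cannot be the leading one, by symmetry.\<close>
  have "finite {..<card J - 1}" "card {..<card J - 1} < card J" using cJ by simp_all
  then obtain x where x: "\<exists>p\<in>J. x p \<noteq> 0" "\<And>e. e < card J - 1 \<Longrightarrow> (\<Sum>p\<in>J. x p * c p (2 * e)) = 0"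
    using homogeneous_system_solution[of "{..<card J - 1}" J "\<lambda>e p. c p (2 * e)"] J by blast
  define F where "F = (\<lambda>t. \<Sum>p\<in>J. x p * g p t)"
  define C where "C = (\<lambda>j. \<Sum>p\<in>J. x p * c p j)"
  define Q where "Q = (\<lambda>m t. \<Sum>p\<in>J. x p * R p m t)"
  have Q: "Q m holomorphic_on ball 0 r" "Q m 0 = C m" for m
    unfolding Q_def C_def by (auto intro!: holomorphic_intros R(1) simp: R(2))
  have FC: "F t = (\<Sum>j<m. C j * t ^ j) + t ^ m * Q m t" if t: "t \<in> ball 0 r" for m t
  proof -
    have "F t = (\<Sum>p\<in>J. x p * (\<Sum>j<m. c p j * t ^ j)) + (\<Sum>p\<in>J. x p * (t ^ m * R p m t))"
      unfolding F_def c[OF t, of _ m] by (simp add: distrib_left sum.distrib)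
    also have "(\<Sum>p\<in>J. x p * (\<Sum>j<m. c p j * t ^ j)) = (\<Sum>j<m. C j * t ^ j)"
      unfolding C_def sum_distrib_left sum_distrib_right by (subst sum.swap) (simp add: mult.assoc)
    also have "(\<Sum>p\<in>J. x p * (t ^ m * R p m t)) = t ^ m * Q m t"
      unfolding Q_def sum_distrib_left by (simp add: mult.left_commute)
    finally show ?thesis .
  qed
  \<comment> \<open>Otherwise F vanishes identically. Independence of the powers of S separates the
    values of k, and independence of the products of powers of 2 + t and t for fixed k then kills
    every \<open>x p\<close>.\<close>
  have "\<exists>j. C j \<noteq> 0"
  proof (rule ccontr)
    assume "\<nexists>j. C j \<noteq> 0"
    then have FQ: "F t = t ^ m * Q m t" if "t \<in> ball 0 r" for m t using FC[OF that, of m] by simp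
    have hF: "F holomorphic_on ball 0 r" unfolding F_def by (intro holomorphic_intros hg)
    have F0: "F t = 0" if "t \<in> ball 0 r" for t
      by (rule holomorphic_infinite_order_zero[of F r Q t, OF hF r Q(1) FQ that])
    define A where "A = (\<lambda>k. \<Sum>p\<in>J. if snd p = k
      then smult (x p) ([:2, 1:] ^ (d - fst p - snd p) * [:0, 1:] ^ fst p) else 0)"
    have "(\<Sum>k<n. poly (A k) t * S t ^ k) = F t" for t
    proof -
      have "(\<Sum>k<n. poly (A k) t * S t ^ k) = (\<Sum>p\<in>J. \<Sum>k<n. if snd p = k
          then x p * ((2 + t) ^ (d - fst p - snd p) * t ^ fst p) * S t ^ k else 0)"
        unfolding A_def poly_sum sum_distrib_right by (subst sum.swap) (intro sum.cong; simp)
      also have "\<dots> = F t"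
        unfolding F_def
      proof (rule sum.cong[OF refl])
        fix p assume p: "p \<in> J"
        obtain i k where ik: "p = (i, k)" by (cases p)
        have "k < n" using Jd(3) p ik by blast
        then show "(\<Sum>k<n. if snd p = k then x p * ((2 + t) ^ (d - fst p - snd p) * t ^ fst p) * S t ^ k else 0)
          = x p * g p t" by (simp add: ik g_def mult.assoc)
      qed
      finally show ?thesis .
    qed
    then have A0: "A k = 0" if "k < n" for k
      using fermat_branch_independent[OF br n1, of A] F0 that by simp
    have "x p = 0" if p: "p \<in> J" for p
    proof -
      obtain i k where ik: "p = (i, k)" by (cases p)
      have k: "k < n" using Jd(3) p ik by blast
      \<comment> \<open>For fixed k the terms are homogeneous of degree d - k in 2 + t and t; B is
        the dehomogenised polynomial in w = t / (2 + t).\<close>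
      define B where "B = (\<Sum>p\<in>J. if snd p = k then monom (x p) (fst p) else 0)"
      have "poly B w = 0" if w: "w \<in> ball 0 1" for w
      proof -
        \<comment> \<open>Solves t = v w together with 2 + t = v, so that v^(d-k) factors
          out.\<close>
        define v where "v = 2 / (1 - w)"
        have w1: "1 - w \<noteq> 0" using w by auto
        have v0: "v \<noteq> 0" using w1 by (simp add: v_def)
        have v2: "2 + v * w = v" using w1 by (simp add: v_def field_simps)
        have "0 = poly (A k) (v * w)" using A0[OF k] by simp
        also have "\<dots> = (\<Sum>p\<in>J. if snd p = k then x p * (v ^ (d - fst p - snd p) * (v * w) ^ fst p) else 0)"
          unfolding A_def poly_sum by (intro sum.cong) (auto simp: v2)
        also have "\<dots> = (\<Sum>p\<in>J. v ^ (d - k) * (if snd p = k then x p * w ^ fst p else 0))"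
        proof (rule sum.cong[OF refl])
          fix p assume "p \<in> J"
          then have "fst p + snd p \<le> d" using Jd(2)[of "fst p" "snd p"] by simp
          then have "d - snd p = (d - fst p - snd p) + fst p" by simp
          then have "v ^ (d - snd p) = v ^ (d - fst p - snd p) * v ^ fst p" by (simp only: power_add)
          then show "(if snd p = k then x p * (v ^ (d - fst p - snd p) * (v * w) ^ fst p) else 0)
            = v ^ (d - k) * (if snd p = k then x p * w ^ fst p else 0)"
            by (auto simp: power_mult_distrib)
        qed
        also have "\<dots> = v ^ (d - k) * poly B w"
          unfolding B_def poly_sum sum_distrib_left by (intro sum.cong) (auto simp: poly_monom)
        finally show ?thesis using v0 by simp
      qed
      then have "B = 0" using poly_zero_on_ball[of 1 B] by simp
      then have "0 = coeff B i" by simp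
      also have "\<dots> = (\<Sum>q\<in>J. if q = p then x p else 0)"
        unfolding B_def coeff_sum ik by (intro sum.cong) auto
      also have "\<dots> = x p" using J p by simp
      finally show ?thesis by simp
    qed
    then show False using x(1) by blast
  qed
  then obtain \<rho> where \<rho>: "C \<rho> \<noteq> 0" "\<And>j. j < \<rho> \<Longrightarrow> C j = 0"
    using exists_least_iff[of "\<lambda>j. C j \<noteq> 0"] by auto
  have F\<rho>: "F t = t ^ \<rho> * Q \<rho> t" if "t \<in> ball 0 r" for t
    using FC[OF that, of \<rho>] \<rho>(2) by simp
  have "\<forall>\<^sub>F t in at 0. F (- t / (1 + t)) = F t / (1 + t) ^ d"
  proof -
    have "\<forall>\<^sub>F t in at (0::complex). t \<in> ball 0 1" by (intro eventually_at_in_open') auto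
    then show ?thesis using fermat_branch_involution[OF br n1]
    proof eventually_elim
      case (elim t)
      have t1: "1 + t \<noteq> 0"
      proof
        assume "1 + t = 0"
        then have "t = - 1" by (simp add: eq_neg_iff_add_eq_0 add.commute)
        then show False using elim(1) by simp
      qed
      show ?case
        unfolding F_def sum_divide_distrib
      proof (rule sum.cong[OF refl])
        fix p assume p: "p \<in> J"
        obtain i k where ik: "p = (i, k)" by (cases p)
        have i: "even i" "i + k \<le> d" using Jd p ik by blast+
        have e1: "2 + - t / (1 + t) = (2 + t) / (1 + t)" using t1 by (simp add: field_simps)
        have "d = (d - i - k) + i + k" using i(2) by simp
        then have e2: "(1 + t) ^ d = (1 + t) ^ (d - i - k) * (1 + t) ^ i * (1 + t) ^ k"
          by (metis power_add)
        have "g p (- t / (1 + t)) = ((2 + t) / (1 + t)) ^ (d - i - k) * (- t / (1 + t)) ^ i * (S t / (1 + t)) ^ k"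
          unfolding ik g_def split_conv e1 elim(2) ..
        also have "\<dots> = g p t / (1 + t) ^ d"
          unfolding ik g_def split_conv e2 using i(1) by (simp add: power_divide)
        finally show "x p * g p (- t / (1 + t)) = x p * g p t / (1 + t) ^ d" by simp
      qed
    qed
  qed
  then have "even \<rho>"
    using even_order_of_symmetric[OF Q(1) r, of \<rho> F \<rho> d] \<rho>(1) Q(2) F\<rho> by simp
  then obtain e where e: "\<rho> = 2 * e" by (elim evenE)
  have "\<not> e < card J - 1" using x(2)[of e] \<rho>(1) by (auto simp: C_def e)
  \<comment> \<open>\<rho> = 2 e with e >= card J - 1, so \<rho> >= 2 card J - 2 >= g and the gap
    \<rho> + 1 exceeds g.\<close>
  then have big: "card (gap_indices n) < Suc \<rho>" using cJ e by linarith
  \<comment> \<open>The same combination of forms at (v, 1, s), now as a polynomial to which the gap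
    criterion applies.\<close>
  define P where "P = (\<lambda>v s. \<Sum>p\<in>J. x p * ((v + 1) ^ (d - fst p - snd p) * (v - 1) ^ fst p * s ^ snd p))"
  have "bipoly d P"
    unfolding P_def
  proof (rule bipoly_sum)
    fix p assume "p \<in> J"
    then have le: "fst p + snd p \<le> d" using Jd(2)[of "fst p" "snd p"] by simp
    have a: "bipoly (d - fst p - snd p) (\<lambda>v s. (v + 1) ^ (d - fst p - snd p))"
      using bipoly_shifted_power[of "d - fst p - snd p" "d - fst p - snd p" "- 1"] by simp
    have b: "bipoly (fst p) (\<lambda>v s. (v - 1) ^ fst p)" by (rule bipoly_shifted_power[OF order_refl])
    have c: "bipoly (snd p) (\<lambda>v s. s ^ snd p)" using bipoly_power[OF bipoly.snd[of 0], of "snd p"] by simp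
    have "bipoly d (\<lambda>v s. (v + 1) ^ (d - fst p - snd p) * (v - 1) ^ fst p * s ^ snd p)"
      by (rule bipoly.mult[OF bipoly.mult[OF a b order_refl] c]) (use le in simp)
    then show "bipoly d (\<lambda>v s. x p * ((v + 1) ^ (d - fst p - snd p) * (v - 1) ^ fst p * s ^ snd p))"
      by (rule bipoly.mult[OF bipoly.const[of 0]]) simp
  qed
  then have P: "bipoly (n - 3) P" by (simp add: d_def)
  have PF: "P (1 + t) (S t) = F t" for t
    unfolding P_def F_def g_def by (intro sum.cong) (auto simp: add.assoc[symmetric])
  have "Suc \<rho> \<in> gaps n ?p"
  proof (rule gap_criterion[OF br n3 P _ _ \<rho>(1)])
    have "(Q \<rho> \<longlongrightarrow> C \<rho>) (at 0)"
      using holomorphic_on_imp_continuous_on[OF Q(1)[of \<rho>]] r Q(2)[of \<rho>]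
      by (metis centre_in_ball continuous_on_eq_continuous_at isContD open_ball)
    then show "((\<lambda>t. P (1 + t) (S t) / t ^ (Suc \<rho> - 1)) \<longlongrightarrow> C \<rho>) (at 0)"
    proof (rule Lim_transform_eventually)
      have "\<forall>\<^sub>F t in at (0::complex). t \<in> ball 0 r - {0}" using r by (intro eventually_at_in_open) auto
      then show "\<forall>\<^sub>F t in at 0. Q \<rho> t = P (1 + t) (S t) / t ^ (Suc \<rho> - 1)"
        by eventually_elim (use F\<rho> in \<open>auto simp: PF\<close>)
    qed
  qed simp
  moreover have "gaps n ?p = {1..card (gaps n ?p)}"
    by (rule weight_zero_imp_interval[OF card_gaps(1)[OF br n3] w0])
  ultimately have "Suc \<rho> \<le> card (gaps n ?p)" by (metis atLeastAtMost_iff)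
  then show False using big card_gaps(2)[OF br n3] by simp
qed


subsection \<open>Symmetries acting on the flexes\<close>

lemma complex_root_exists:
  fixes a :: complex
  assumes "n \<ge> 1"
  shows "\<exists>z. z ^ n = a"
proof -
  have "n \<noteq> 0" using assms by simp
  then obtain z where "a = z ^ n" by (rule exists_complex_root)
  then show ?thesis by (intro exI[of _ z]) simp
qed

text \<open>Agreement with \<open>M\<close> is assumed on the curve only, so that the lemma also
  covers \<open>inv_into\<close>, which is unspecified elsewhere.\<close>

lemma holo_map_fermat_sym:
  assumes M: "fermat_sym n M" and n: "n \<ge> 1"
    and \<sigma>: "\<And>q. q \<in> fermat n \<Longrightarrow> \<sigma> q = M ` q" "\<sigma> ` fermat n \<subseteq> fermat n"
  shows "holo_map n \<sigma>"
  unfolding holo_map_def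
proof (intro conjI ballI \<sigma>(2))
  fix q assume q: "q \<in> fermat n"
  obtain \<phi> r where ch: "fchart n q \<phi> r" using fchart_exists[OF q n] by blast
  then have r: "r > 0" and h: "holo3 \<phi> (ball 0 r)" and on: "\<And>t. t \<in> ball 0 r \<Longrightarrow> on_fermat n (\<phi> t)"
    unfolding fchart_def by blast+
  have "holo3 (\<lambda>t. M (\<phi> t)) (ball 0 r)" using M h open_ball unfolding fermat_sym_def by blast
  moreover have "M (\<phi> t) \<noteq> (0,0,0) \<and> ppt (M (\<phi> t)) = \<sigma> (ppt (\<phi> t))" if "t \<in> ball 0 r" for t
  proof -
    have "on_fermat n (M (\<phi> t))" using M on[OF that] unfolding fermat_sym_def by blast
    moreover have "ppt (\<phi> t) \<in> fermat n"
      using on[OF that] ppt_in_fermat_iff[OF on_fermat_nonzero] by blast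
    ultimately show ?thesis
      using on_fermat_nonzero \<sigma>(1) ppt_fermat_sym[OF M] by simp
  qed
  ultimately show "\<exists>\<phi> r \<psi> s. fchart n q \<phi> r \<and> 0 < s \<and> s \<le> r \<and> holo3 \<psi> (ball 0 s) \<and>
      (\<forall>t\<in>ball 0 s. \<psi> t \<noteq> (0,0,0) \<and> ppt (\<psi> t) = \<sigma> (ppt (\<phi> t)))"
    using ch r by (intro exI[of _ \<phi>] exI[of _ r] exI[of _ "\<lambda>t. M (\<phi> t)"]) auto
qed

lemma fermat_sym_aut:
  assumes M: "fermat_sym n M" and N: "fermat_sym n N" and n: "n \<ge> 1"
    and inv: "\<And>v. M (N v) = v" "\<And>v. N (M v) = v"
  shows "(\<lambda>L. M ` L) \<in> fermat_aut n"
proof -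
  have into: "M' ` q \<in> fermat n" if M': "fermat_sym n M'" and q: "q \<in> fermat n" for M' q
  proof -
    obtain v where v: "q = ppt v" "on_fermat n v" using fermatE[OF q] by blast
    have "on_fermat n (M' v)" using M' v(2) unfolding fermat_sym_def by blast
    then show ?thesis
      using v(1) ppt_fermat_sym[OF M', of v] ppt_in_fermat_iff[OF on_fermat_nonzero, of n "M' v"] by simp
  qed
  have NM: "N ` M ` q = q" "M ` N ` q = q" for q by (simp_all add: image_image inv)
  have bij: "bij_betw (\<lambda>L. M ` L) (fermat n) (fermat n)"
    by (rule bij_betwI[of _ _ _ "\<lambda>L. N ` L"]) (auto simp: NM into[OF M] into[OF N])
  have inv_eq: "inv_into (fermat n) (\<lambda>L. M ` L) q = N ` q" if "q \<in> fermat n" for q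
    by (rule inv_into_f_eq[OF bij_betw_imp_inj_on[OF bij] into[OF N that]]) (rule NM)
  have "holo_map n (\<lambda>L. M ` L)"
    by (rule holo_map_fermat_sym[OF M n refl]) (use into[OF M] in blast)
  moreover have "holo_map n (inv_into (fermat n) (\<lambda>L. M ` L))"
    by (rule holo_map_fermat_sym[OF N n inv_eq]) (use into[OF N] inv_eq in auto)
  ultimately show ?thesis using bij unfolding fermat_aut_def by simp
qed

text \<open>A transposition moves the vanishing coordinate to the front. Then both s/y and z are
  n-th roots of -1, so they differ by a root of unity, which a diagonal symmetry absorbs.\<close>

lemma flex_to_base:
  assumes v: "on_fermat n v" "fst v = 0 \<or> fst (snd v) = 0 \<or> snd (snd v) = 0"
    and z: "z ^ n = -1" and n: "n \<ge> 1"
  shows "\<exists>M N. fermat_sym n M \<and> fermat_sym n N \<and> (\<forall>w. M (N w) = w) \<and> (\<forall>w. N (M w) = w) \<and>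
    ppt (M v) = ppt (0, 1, z)"
proof -
  have "\<exists>A. fermat_sym n A \<and> (\<forall>w. A (A w) = w) \<and> fst (A v) = 0"
  proof -
    consider "fst v = 0" | "fst (snd v) = 0" | "snd (snd v) = 0" using v(2) by blast
    then show ?thesis
    proof cases
      case 1
      then show ?thesis using fermat_sym_id by (intro exI[of _ "\<lambda>v. v"]) simp
    next
      case 2
      then show ?thesis using fermat_sym_swap12 by (intro exI[of _ swap12]) (simp add: swap12_def)
    next
      case 3
      then show ?thesis using fermat_sym_swap13 by (intro exI[of _ swap13]) (simp add: swap13_def)
    qed
  qed
  then obtain A where A: "fermat_sym n A" "\<And>w. A (A w) = w" "fst (A v) = 0" by blast
  obtain y s where w: "A v = (0, y, s)" using A(3) by (cases "A v") auto
  have "on_fermat n (A v)" using A(1) v(1) unfolding fermat_sym_def by blast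
  then have eq: "y ^ n + s ^ n = 0" "y \<noteq> 0 \<or> s \<noteq> 0"
    using n unfolding w on_fermat_def by (auto simp: power_0_left)
  then have nz: "y \<noteq> 0" "s \<noteq> 0" using n by (auto simp: power_0_left)
  have z0: "z \<noteq> 0" using z n by (auto simp: power_0_left)
  \<comment> \<open>Scaling the last coordinate by this root of unity turns s into z y, hence (0, y,
    s) into y times (0, 1, z).\<close>
  define a where "a = z * y / s"
  have sn: "s ^ n = - (y ^ n)" using eq(1) by (simp add: eq_neg_iff_add_eq_0 add.commute)
  have an: "a ^ n = 1" using nz by (simp add: a_def power_mult_distrib power_divide z sn)
  then have an': "(1 / a) ^ n = 1" by (simp add: power_divide)
  have a0: "a \<noteq> 0" using nz z0 by (simp add: a_def)
  define M where "M = (\<lambda>v. scale3 a (A v))"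
  define N where "N = (\<lambda>v. A (scale3 (1 / a) v))"
  have "fermat_sym n M" unfolding M_def by (rule fermat_sym_comp[OF fermat_sym_scale3[OF an n] A(1)])
  moreover have "fermat_sym n N" unfolding N_def by (rule fermat_sym_comp[OF A(1) fermat_sym_scale3[OF an' n]])
  moreover have "M (N w) = w" "N (M w) = w" for w
    using a0 by (simp_all add: M_def N_def A(2) scale3_def)
  moreover have "ppt (M v) = ppt (0, 1, z)"
  proof -
    have "M v = smul3 y (0, 1, z)" using nz by (simp add: M_def w scale3_def a_def)
    then show ?thesis using ppt_smul3[of y "(0, 1, z)"] nz by simp
  qed
  ultimately show ?thesis by blast
qed

lemma flexes_transitive:
  assumes v: "on_fermat n v" "fst v = 0 \<or> fst (snd v) = 0 \<or> snd (snd v) = 0"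
    and w: "on_fermat n w" "fst w = 0 \<or> fst (snd w) = 0 \<or> snd (snd w) = 0" and n: "n \<ge> 1"
  shows "\<exists>\<sigma>\<in>fermat_aut n. \<sigma> (ppt v) = ppt w"
proof -
  obtain z :: complex where z: "z ^ n = -1" using complex_root_exists[OF n] by blast
  from flex_to_base[OF v z n] obtain M N where M: "fermat_sym n M" "fermat_sym n N"
    "\<forall>w. M (N w) = w" "\<forall>w. N (M w) = w" "ppt (M v) = ppt (0, 1, z)" by (elim exE conjE)
  from flex_to_base[OF w z n] obtain K L where K: "fermat_sym n K" "fermat_sym n L"
    "\<forall>w. K (L w) = w" "\<forall>w. L (K w) = w" "ppt (K w) = ppt (0, 1, z)" by (elim exE conjE)
  have "(\<lambda>q. (\<lambda>x. L (M x)) ` q) \<in> fermat_aut n"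
    by (rule fermat_sym_aut[OF fermat_sym_comp[OF K(2) M(1)] fermat_sym_comp[OF M(2) K(1)] n])
       (simp_all add: M K)
  moreover have "(\<lambda>x. L (M x)) ` ppt v = ppt w"
  proof -
    have "(\<lambda>x. L (M x)) ` ppt v = L ` M ` ppt v" by (simp add: image_image)
    also have "M ` ppt v = K ` ppt w" using M(5) K(5) ppt_fermat_sym[OF M(1)] ppt_fermat_sym[OF K(1)] by simp
    also have "L ` K ` ppt w = ppt w" by (simp add: image_image K(4))
    finally show ?thesis .
  qed
  ultimately show ?thesis by (intro bexI[of _ "\<lambda>q. (\<lambda>x. L (M x)) ` q"])
qed

section \<open>The quartic and the final comparison\<close>

lemma quartic_weight_zero:
  assumes v: "on_fermat 4 (x, y, z)" and nz: "x \<noteq> 0" "y \<noteq> 0" "z \<noteq> 0"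
  shows "weight 4 (ppt (x, y, z)) = 0"
proof -
  define u s where "u = x / y" and "s = z / y"
  have eq: "smul3 (1 / y) (x, y, z) = (u, 1, s)" using nz by (simp add: u_def s_def)
  have p: "ppt (x, y, z) = ppt (u, 1, s)" using ppt_smul3[of "1 / y" "(x, y, z)"] nz eq by simp
  have "on_fermat 4 (u, 1, s)" using v on_fermat_smul3[of "1 / y" 4 "(x, y, z)"] nz eq by simp
  then have "s ^ 4 = - (1 + u ^ 4)" by (simp only: on_fermat_affine)
  moreover have us: "u \<noteq> 0" "s \<noteq> 0" using nz by (simp_all add: u_def s_def)
  ultimately have "\<exists>r S. fermat_branch 4 u S r \<and> S 0 = s"
    by (intro fermat_branch_exists) simp_all
  then obtain r S where br: "fermat_branch 4 u S r" and S0: "S 0 = s" by (elim exE conjE)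
  let ?G = "gaps 4 (ppt (u, 1, S 0))"
  have n3: "(4::nat) \<ge> 3" by simp
  have "Suc 0 \<in> ?G" using linear_gap[OF br n3, of 0] by simp
  moreover have "Suc 1 \<in> ?G" using linear_gap[OF br n3, of 1] by simp
  moreover have "3 \<in> ?G" using tangent_gap[OF br n3 us(1), of 0] by simp
  ultimately have sub: "{1, 2, 3} \<subseteq> ?G" by (simp add: numeral_2_eq_2)
  \<comment> \<open>At most three gaps, the genus of the quartic, so the three already found are
    all.\<close>
  have "gap_indices 4 \<subseteq> {(0, 0), (0, 1), (1, 0)}" by (auto simp: gap_indices_def)
  then have "card (gap_indices 4) \<le> card {(0::nat, 0::nat), (0, 1), (1, 0)}"
    by (intro card_mono) auto
  then have "card ?G \<le> 3" using card_gaps(2)[OF br n3] by simp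
  then have "?G = {1, 2, 3}"
    using card_subset_eq[OF card_gaps(1)[OF br n3] sub] card_mono[OF card_gaps(1)[OF br n3] sub] by simp
  then have "gaps 4 (ppt (x, y, z)) = {1, 2, 3}" using p S0 by simp
  moreover have "{1..3} = {1, 2, 3 :: nat}" by auto
  ultimately show ?thesis by (simp add: weight_def)
qed

theorem theorem20:
  fixes n :: nat
  assumes "n \<ge> 4"
  shows "(\<forall>p q. weierstrass_pt n p \<and> weierstrass_pt n q \<longrightarrow>
            (\<exists>\<sigma>\<in>fermat_aut n. \<sigma> p = q)) \<longleftrightarrow> n = 4"
proof
  assume trans: "\<forall>p q. weierstrass_pt n p \<and> weierstrass_pt n q \<longrightarrow> (\<exists>\<sigma>\<in>fermat_aut n. \<sigma> p = q)"
  show "n = 4"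
  proof (rule ccontr)
    assume "n \<noteq> 4"
    then have n: "n \<ge> 5" using assms by simp
    then have n1: "n \<ge> 1" and n2: "n \<ge> 2" and n3: "n \<ge> 3" by simp_all
    obtain z :: complex where z: "z ^ n = - (1 + 0 ^ n)"
      using complex_root_exists[OF n1] by blast
    have "z \<noteq> 0" using z n1 by (auto simp: power_0_left)
    then obtain r S where br: "fermat_branch n 0 S r"
      using fermat_branch_exists[OF z _ n1] by blast
    \<comment> \<open>The last coordinate of a point (1 : 1 : c), fixed by exchanging x and y; c^n =
      -2.\<close>
    obtain c :: complex where c: "c ^ n = - (1 + 1 ^ n)"
      using complex_root_exists[OF n1] by blast
    have "c \<noteq> 0" using c n1 by (auto simp: power_0_left)
    then obtain r' S' where br': "fermat_branch n 1 S' r'"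
      using fermat_branch_exists[OF c _ n1] by blast
    let ?p = "ppt (0, 1, S 0)" and ?q = "ppt (1, 1, S' 0)"
    have "0 \<in> ball (0::complex) r" "0 \<in> ball (0::complex) r'"
      using br br' unfolding fermat_branch_def by auto
    then have on: "on_fermat n (0, 1, S 0)" "on_fermat n (1, 1, S' 0)"
      using fermat_branch_on_fermat[OF br, of 0] fermat_branch_on_fermat[OF br', of 0] by simp_all
    have pq: "?p \<in> fermat n" "?q \<in> fermat n"
      using on ppt_in_fermat_iff[OF on_fermat_nonzero] by blast+
    have nongap: "n - 1 \<notin> gaps n ?p" by (rule flex_nongap[OF br n2])
    have "weight n ?p \<noteq> 0"
    proof
      assume "weight n ?p = 0"
      from weight_zero_imp_interval[OF card_gaps(1)[OF br n3] this]
      have G: "gaps n ?p = {1..card (gaps n ?p)}" .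
      \<comment> \<open>An interval of gaps starting at 1 that reaches n + 1 would contain the
        nongap n - 1.\<close>
      have "n + 1 \<in> gaps n ?p" by (rule flex_gap[OF br assms])
      then have "n + 1 \<le> card (gaps n ?p)" using G by (metis atLeastAtMost_iff)
      then have "1 \<le> n - 1 \<and> n - 1 \<le> card (gaps n ?p)" using n by linarith
      then have "n - 1 \<in> {1..card (gaps n ?p)}" by (simp only: atLeastAtMost_iff)
      then show False using nongap G by metis
    qed
    then have "weierstrass_pt n ?p" using pq unfolding weierstrass_pt_def by blast
    moreover have "weierstrass_pt n ?q"
      using pq fixed_point_weight[OF br' n] unfolding weierstrass_pt_def by blast
    ultimately obtain \<sigma> where \<sigma>: "\<sigma> \<in> fermat_aut n" "\<sigma> ?p = ?q" using trans by blast
    \<comment> \<open>Nongaps are pulled back, so moving n - 1 from the flex to \<open>?q\<close>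
      takes the map from \<open>?q\<close> to \<open>?p\<close>.\<close>
    define \<tau> where "\<tau> = inv_into (fermat n) \<sigma>"
    have bij: "bij_betw \<sigma> (fermat n) (fermat n)" and \<tau>: "holo_map n \<tau>"
      using \<sigma>(1) unfolding fermat_aut_def \<tau>_def by blast+
    have bij\<tau>: "bij_betw \<tau> (fermat n) (fermat n)" unfolding \<tau>_def by (rule bij_betw_inv_into[OF bij])
    have "\<tau> ?q = ?p"
      unfolding \<tau>_def by (rule inv_into_f_eq[OF bij_betw_imp_inj_on[OF bij] pq(1) \<sigma>(2)])
    then have "n - 1 \<notin> gaps n (\<tau> ?q)" using nongap by simp
    then have "n - 1 \<notin> gaps n ?q"
      using nongap_pullback[OF bij\<tau> \<tau> n1 pq(2)] n by simp
    \<comment> \<open>The largest exponent j = n - 4 allowed in \<open>tangent_gap\<close>; the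
      value is n - 1.\<close>
    moreover have "n - 4 + 3 \<in> gaps n ?q"
      by (rule tangent_gap[OF br' n3]) (use n in simp_all)
    ultimately show False using n by simp
  qed
next
  assume n4: "n = 4"
  show "\<forall>p q. weierstrass_pt n p \<and> weierstrass_pt n q \<longrightarrow> (\<exists>\<sigma>\<in>fermat_aut n. \<sigma> p = q)"
  proof (intro allI impI, elim conjE)
    fix p q assume pq: "weierstrass_pt n p" "weierstrass_pt n q"
    have flex: "\<exists>v. p = ppt v \<and> on_fermat n v \<and> (fst v = 0 \<or> fst (snd v) = 0 \<or> snd (snd v) = 0)"
      if W: "weierstrass_pt n p" for p
    proof -
      obtain v where v: "p = ppt v" "on_fermat n v"
        using W fermatE unfolding weierstrass_pt_def by blast
      obtain x y z where xyz: "v = (x, y, z)" by (cases v)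
      have "x = 0 \<or> y = 0 \<or> z = 0"
        using quartic_weight_zero[of x y z] v W unfolding weierstrass_pt_def n4 xyz by blast
      then show ?thesis using v xyz by auto
    qed
    obtain v w where "p = ppt v" "on_fermat n v" "fst v = 0 \<or> fst (snd v) = 0 \<or> snd (snd v) = 0"
      "q = ppt w" "on_fermat n w" "fst w = 0 \<or> fst (snd w) = 0 \<or> snd (snd w) = 0"
      using flex[OF pq(1)] flex[OF pq(2)] by blast
    then show "\<exists>\<sigma>\<in>fermat_aut n. \<sigma> p = q" using flexes_transitive[of n v w] n4 by simp
  qed
qed

end
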